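(* Let $N>2$ and let $f$ satisfy (H1). For each solution $u$ of $$u''+\frac{N-1}{r}u'+f(u)=0,\ r>0,\qquad u(0)=\alpha,\quad u'(0)=0,$$ with $\alpha>\beta$, the curve $(u(r),\mathcal J(r))$, $r\ge 0$, in the $(s,J)$-plane, where $\mathcal J(r)=-u'(r)/r$ (equivalently, the union of the graphs of $J$ and $\bar J$), satisfies the following. (i) It starts at $\left(\alpha,\frac{f(\alpha)}{N}\right)$, and spirals inwards, counterclockwise, without self-intersections. (ii) It first rotates around the origin, intersecting the $s$-axis outside $(-\beta,\beta)$. In this process it crosses the line $s=0$ exactly $k$ times, $0\le k<\infty$, and then $\alpha\in\mathcal N_k$ and $\alpha\notin\mathcal N_{k+1}$. (iii) After crossing $s=0$ for the $k$-th time, it rotates around $((-1)^kb,0)$, crossing the $s$-axis $j$ times, $0\le j\le\infty$ (if $k=0$, the initial point is counted as $j=1$ and the crossings after it are added). Moreover: (a) if $j=0$, then $J(-b)=0$ (or $\bar J(b)=0$), $u$ tends asymptotically to $\pm b$, and $\alpha\in\mathcal P_{k+1}$; (b) if $j=1$, then either $J(-b)=0$ (or $\bar J(b)=0$), $u$ tends asymptotically to $\pm b$ and $\alpha\in\mathcal P_{k+1}$, or $J(0)=0$ (or $\bar J(0)=0$) and $\alpha\in\mathcal G_{k+1}$, i.e. $u$ is a $(k+1)$-th bound state solution; (c) if $j\ge 2$, then $\alpha\in\mathcal P_{k+1}$ and, after $j$ intersections, $J$ ends in $J(\pm b)=0$ (or $\bar J(\pm b)=0$) and $u$ tends asymptotically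 to $\pm b$; if $j=\infty$ the curve spirals around $(\pm b,0)$ forever. In (a)–(c) the sign in $\pm b$ is that of $(-1)^k$.
   Context: (H1): $f\in C[0,\infty)\cap C^1(0,\infty)$, except possibly for a finite number of points where it is not differentiable; $f(0)=0$ and there is $b\ge 0$ with $f(s)>0$ for $s>b$, $f(s)\le 0$ for $s\in[0,b]$, and $f(s)<0$ on $(0,\epsilon_0)$ for some $\epsilon_0>0$; $f$ is extended to $\mathbb R$ by $f(s)=-f(-s)$; with $F(s)=\int_0^s f(t)\,dt$, there is a unique $\beta\ge b$ with $F(\beta)=0$. Solutions reaching a double zero ($u=u'=0$) are extended by $0$ and considered bound states. Write $u(r)=u(r,\alpha)$. On intervals where $u$ is decreasing, with inverse $r(s)$, set $J(s)=\frac{-1}{r(s)r'(s)}$; where $u$ is increasing, with inverse $\bar r(s)$, set $\bar J(s)=\frac{-1}{\bar r(s)\bar r'(s)}$. In both cases $\mathcal J(r)=-u'(r)/r$ equals $J(u(r))$ or $\bar J(u(r))$ (at $r=0$ by its limit). A statement such as $J(\pm b)=0$ or $J(0)=0$ at an endpoint reached only as $r\to\infty$ is understood as a limit. The curve "spirals inwards, counterclockwise" as $r$ increases: it moves to the left in $\{\mathcal J>0\}$ and to the right in $\{\mathcal J<0\}$, and, not intersecting itself, winds inside its previous turns. Sets of initial conditions: $Z_1(\alpha)=\sup\{r>0: u(s,\alpha)>0,\ u'(s,\alpha)<0\ \forall s\in(0,r)\}$; $\mathcal N_1=\{\alpha\ge\beta: u(Z_1)=0,\ u'(Z_1)<0\}$,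 $\mathcal G_1=\{\alpha\ge\beta: u(Z_1)=0,\ u'(Z_1)=0\}$, $\mathcal P_1=\{\alpha\ge\beta: u(Z_1)>0\}$, where if $Z_1=\infty$, $u(Z_1)$ denotes $\lim_{r\to\infty}u(r,\alpha)$. For $k\ge2$ and $\alpha\in\mathcal N_{k-1}$: $T_{k-1}(\alpha)=\sup\{r>Z_{k-1}(\alpha): (-1)^ku'(s,\alpha)\le0\ \forall s\in(Z_{k-1}(\alpha),r)\}$, $Z_k(\alpha)=\sup\{r>T_{k-1}(\alpha): (-1)^ku(s,\alpha)<0,\ (-1)^ku'(s,\alpha)>0\ \forall s\in(T_{k-1}(\alpha),r)\}$ ($Z_k=\infty$ if $T_{k-1}=\infty$), and $\mathcal N_k=\{\alpha\in\mathcal N_{k-1}: u(Z_k)=0,\ (-1)^ku'(Z_k)>0\}$, $\mathcal G_k=\{\alpha\in\mathcal N_{k-1}: u(Z_k)=0,\ u'(Z_k)=0\}$, $\mathcal P_k=\{\alpha\in\mathcal N_{k-1}: (-1)^ku(Z_k)<0\}$, with values at $Z_k=\infty$ understood as limits. By convention $\mathcal N_0=[\beta,\infty)$. An $m$-th bound state solution is a nonconstant solution tending to $0$ at infinity that changes sign $m-1$ times.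
   Formalization: The assertions that u tends to ±b and that J (or J-bar) ends at 0 at ±b are made only when f<0 on all of (0,b); under (H1) as written f may vanish inside (0,b) and a solution may then tend to such an interior zero instead. All other claims are under (H1) as stated. *)

theory Defs
  imports "HOL-Analysis.Analysis" "HOL-Library.Extended_Nat"
begin

section \<open>The nonlinearity and the initial value problem\<close>

definition H1 :: "(real \<Rightarrow> real) \<Rightarrow> real \<Rightarrow> real \<Rightarrow> bool" where
  "H1 f b \<beta> \<longleftrightarrow>
     continuous_on {0..} f \<and>
     finite {s. 0 < s \<and> \<not> f differentiable (at s)} \<and>
     continuous_on {s. 0 < s \<and> f differentiable (at s)} (deriv f) \<and>
     f 0 = 0 \<and>
     0 \<le> b \<and> (\<forall>s>b. 0 < f s) \<and> (\<forall>s\<in>{0..b}. f s \<le> 0) \<and>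
     (\<exists>\<epsilon>>0. \<forall>s\<in>{0<..<\<epsilon>}. f s < 0) \<and>
     (\<forall>s. f s = - f (- s)) \<and>
     b \<le> \<beta> \<and> integral {0..\<beta>} f = 0 \<and> (\<forall>x\<ge>b. integral {0..x} f = 0 \<longrightarrow> x = \<beta>)"

text \<open>Only the values of \<open>v\<close> on \<open>[0,\<infinity>)\<close> matter. The last conjunct is the convention that a
  solution reaching a double zero is continued by \<open>0\<close>; it has content because \<open>f\<close> need not be
  Lipschitz at \<open>0\<close>.\<close>

definition radial_solution :: "real \<Rightarrow> (real \<Rightarrow> real) \<Rightarrow> real \<Rightarrow> (real \<Rightarrow> real) \<Rightarrow> bool" where
  "radial_solution N f \<alpha> v \<longleftrightarrow>
     v 0 = \<alpha> \<and> (v has_real_derivative 0) (at 0 within {0..}) \<and>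
     (\<forall>r>0. v differentiable (at r) \<and> deriv v differentiable (at r) \<and>
            deriv (deriv v) r + (N - 1) / r * deriv v r + f (v r) = 0) \<and>
     (\<forall>R>0. v R = 0 \<and> deriv v R = 0 \<longrightarrow> (\<forall>r\<ge>R. v r = 0))"

section \<open>The curve\<close>

definition Jcal :: "(real \<Rightarrow> real) \<Rightarrow> real \<Rightarrow> real" where
  "Jcal v r = (if r = 0 then Lim (at_right 0) (\<lambda>t. - deriv v t / t) else - deriv v r / r)"

definition curve :: "(real \<Rightarrow> real) \<Rightarrow> real \<Rightarrow> real \<times> real" where
  "curve v r = (v r, Jcal v r)"

definition monotone_branch :: "(real \<Rightarrow> real) \<Rightarrow> real set \<Rightarrow> bool" where
  "monotone_branch v I \<longleftrightarrow> (\<forall>r\<in>I. deriv v r < 0) \<or> (\<forall>r\<in>I. 0 < deriv v r)"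

text \<open>The function \<open>J\<close> (if \<open>v\<close> decreases on the interval \<open>I\<close>) or \<open>J\<close>-bar (if \<open>v\<close> increases on
  \<open>I\<close>): both are \<open>-1 / (r(s) r'(s))\<close> with \<open>r(s)\<close> the inverse of \<open>v\<close> on \<open>I\<close>.\<close>

definition J_branch :: "(real \<Rightarrow> real) \<Rightarrow> real set \<Rightarrow> real \<Rightarrow> real" where
  "J_branch v I s = - 1 / (inv_into I v s * deriv (inv_into I v) s)"

text \<open>\<open>J(c) = 0\<close> for the last monotone branch: it lives on a time interval \<open>(R,Z)\<close> with
  \<open>Z \<le> \<infinity>\<close>, and if \<open>Z\<close> is finite the curve has reached \<open>(c,0)\<close> at \<open>Z\<close> and stays there
  (this happens for a double zero at finite \<open>Z\<close>, \<open>c = 0\<close>).\<close>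

definition J_ends_at :: "(real \<Rightarrow> real) \<Rightarrow> real \<Rightarrow> bool" where
  "J_ends_at v c \<longleftrightarrow> (\<exists>R::real. \<exists>Z::ereal. 0 \<le> R \<and> ereal R < Z \<and>
     (let I = {r. R < r \<and> ereal r < Z} in
        monotone_branch v I \<and>
        (\<forall>r. Z \<le> ereal r \<longrightarrow> curve v r = (c, 0)) \<and>
        (v \<longlongrightarrow> c) at_top \<and>
        (J_branch v I \<longlongrightarrow> 0) (at c within v ` I)))"

section \<open>Crossings, rotation and spiralling\<close>

definition up_cross :: "(real \<Rightarrow> real) \<Rightarrow> real \<Rightarrow> real \<Rightarrow> bool" where
  "up_cross g c r \<longleftrightarrow> g r = c \<and> (\<forall>\<^sub>F x in at_left r. g x < c) \<and> (\<forall>\<^sub>F x in at_right r. c < g x)"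

definition down_cross :: "(real \<Rightarrow> real) \<Rightarrow> real \<Rightarrow> real \<Rightarrow> bool" where
  "down_cross g c r \<longleftrightarrow> g r = c \<and> (\<forall>\<^sub>F x in at_left r. c < g x) \<and> (\<forall>\<^sub>F x in at_right r. g x < c)"

definition zero_crossings :: "(real \<Rightarrow> real) \<Rightarrow> real set" where
  "zero_crossings v = {r. 0 < r \<and> (up_cross v 0 r \<or> down_cross v 0 r)}"

definition axis_crossings :: "(real \<Rightarrow> real) \<Rightarrow> real set" where
  "axis_crossings v = {r. 0 < r \<and> (up_cross (Jcal v) 0 r \<or> down_cross (Jcal v) 0 r)}"

definition last_zero_crossing :: "(real \<Rightarrow> real) \<Rightarrow> real" where
  "last_zero_crossing v = (if zero_crossings v = {} then 0 else Max (zero_crossings v))"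

definition ecard :: "'a set \<Rightarrow> enat" where
  "ecard A = (if finite A then enat (card A) else \<infinity>)"

text \<open>The number \<open>j\<close>: the starting point counts as an intersection if \<open>v\<close> never changes sign.\<close>

definition final_axis_count :: "(real \<Rightarrow> real) \<Rightarrow> enat" where
  "final_axis_count v =
     ecard {r \<in> axis_crossings v. last_zero_crossing v < r} +
     (if zero_crossings v = {} then 1 else 0)"

text \<open>Counterclockwise rotation around \<open>(c,0)\<close> during the times \<open>I\<close>: the curve avoids the centre,
  crosses the \<open>s\<close>-axis upwards only to the right and downwards only to the left of the centre, and
  crosses the vertical line \<open>s = c\<close> leftwards only above and rightwards only below it.\<close>

definition rotates_about :: "(real \<Rightarrow> real) \<Rightarrow> real \<Rightarrow> real set \<Rightarrow> bool" where
  "rotates_about v c I \<longleftrightarrow> (\<forall>r\<in>I.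
     curve v r \<noteq> (c, 0) \<and>
     (up_cross (Jcal v) 0 r \<longrightarrow> c < v r) \<and>
     (down_cross (Jcal v) 0 r \<longrightarrow> v r < c) \<and>
     (down_cross v c r \<longrightarrow> 0 < Jcal v r) \<and>
     (up_cross v c r \<longrightarrow> Jcal v r < 0))"

definition moves_counterclockwise :: "(real \<Rightarrow> real) \<Rightarrow> bool" where
  "moves_counterclockwise v \<longleftrightarrow> (\<forall>p q. 0 \<le> p \<and> p < q \<longrightarrow>
     ((\<forall>r\<in>{p<..<q}. 0 < Jcal v r) \<longrightarrow> v q < v p) \<and>
     ((\<forall>r\<in>{p<..<q}. Jcal v r < 0) \<longrightarrow> v p < v q))"

text \<open>A parametrized curve that may pause: the same point is met at two different times only if the
  curve rests there in between (as it does at the origin after a double zero).\<close>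

definition no_self_intersection :: "(real \<Rightarrow> real) \<Rightarrow> bool" where
  "no_self_intersection v \<longleftrightarrow> (\<forall>p q. 0 \<le> p \<and> p < q \<and> curve v p = curve v q \<longrightarrow>
     (\<forall>r\<in>{p..q}. curve v r = curve v p))"

text \<open>Later turns lie inside the earlier ones: over the same \<open>s\<close> they are strictly closer to the
  \<open>s\<close>-axis (unless the curve rests), and they never get horizontally past the starting point or
  past an earlier turning point.\<close>

definition winds_inwards :: "(real \<Rightarrow> real) \<Rightarrow> bool" where
  "winds_inwards v \<longleftrightarrow>
     (\<forall>p q. 0 \<le> p \<and> p < q \<and> v p = v q \<longrightarrow>
        \<bar>Jcal v q\<bar> < \<bar>Jcal v p\<bar> \<or> (\<forall>r\<in>{p..q}. curve v r = curve v p)) \<and>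
     (\<forall>q>0. v q < v 0) \<and>
     (\<forall>p q. 0 < p \<and> p < q \<longrightarrow>
        (up_cross (Jcal v) 0 p \<longrightarrow> v q < v p) \<and> (down_cross (Jcal v) 0 p \<longrightarrow> v p < v q))"

section \<open>Sets of initial conditions\<close>

text \<open>\<open>turn_time v k z\<close> is \<open>T\<^sub>k\<close>, given the value \<open>z\<close> of \<open>Z\<^sub>k\<close>.\<close>

definition turn_time :: "(real \<Rightarrow> real) \<Rightarrow> nat \<Rightarrow> ereal \<Rightarrow> ereal" where
  "turn_time v k z = Sup {ereal r | r. z < ereal r \<and>
     (\<forall>s. z < ereal s \<and> s < r \<longrightarrow> (-1) ^ (k + 1) * deriv v s \<le> 0)}"

text \<open>\<open>Z_time v k\<close> is \<open>Z\<^sub>k\<close> for \<open>k \<ge> 1\<close>; the value at \<open>k = 0\<close> is not used. For \<open>k \<ge> 2\<close> it is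
  meaningful only for initial values in \<open>Nset\<close> of index \<open>k - 1\<close>.\<close>

fun Z_time :: "(real \<Rightarrow> real) \<Rightarrow> nat \<Rightarrow> ereal" where
  "Z_time v 0 = 0"
| "Z_time v (Suc 0) = Sup {ereal r | r. 0 < r \<and> (\<forall>s\<in>{0<..<r}. 0 < v s \<and> deriv v s < 0)}"
| "Z_time v (Suc (Suc k)) =
     (let t = turn_time v (Suc k) (Z_time v (Suc k)) in
      if t = \<infinity> then \<infinity>
      else Sup {ereal r | r. t < ereal r \<and>
             (\<forall>s. t < ereal s \<and> s < r \<longrightarrow>
                (-1) ^ Suc (Suc k) * v s < 0 \<and> 0 < (-1) ^ Suc (Suc k) * deriv v s)})"

definition at_time :: "(real \<Rightarrow> real) \<Rightarrow> ereal \<Rightarrow> real" where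
  "at_time g z = (if z = \<infinity> then Lim at_top g else g (real_of_ereal z))"

text \<open>Here \<open>u \<alpha>\<close> is the solution with initial value \<open>\<alpha>\<close>.\<close>

fun Nset :: "real \<Rightarrow> (real \<Rightarrow> real \<Rightarrow> real) \<Rightarrow> nat \<Rightarrow> real set" where
  "Nset \<beta> u 0 = {\<beta>..}"
| "Nset \<beta> u (Suc k) = {\<alpha> \<in> Nset \<beta> u k.
     at_time (u \<alpha>) (Z_time (u \<alpha>) (Suc k)) = 0 \<and>
     0 < (-1) ^ Suc k * at_time (deriv (u \<alpha>)) (Z_time (u \<alpha>) (Suc k))}"

definition Gset :: "real \<Rightarrow> (real \<Rightarrow> real \<Rightarrow> real) \<Rightarrow> nat \<Rightarrow> real set" where
  "Gset \<beta> u k = {\<alpha> \<in> Nset \<beta> u (k - 1).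
     at_time (u \<alpha>) (Z_time (u \<alpha>) k) = 0 \<and> at_time (deriv (u \<alpha>)) (Z_time (u \<alpha>) k) = 0}"

definition Pset :: "real \<Rightarrow> (real \<Rightarrow> real \<Rightarrow> real) \<Rightarrow> nat \<Rightarrow> real set" where
  "Pset \<beta> u k = {\<alpha> \<in> Nset \<beta> u (k - 1). (-1) ^ k * at_time (u \<alpha>) (Z_time (u \<alpha>) k) < 0}"

definition bound_state :: "real \<Rightarrow> (real \<Rightarrow> real) \<Rightarrow> nat \<Rightarrow> (real \<Rightarrow> real) \<Rightarrow> bool" where
  "bound_state N f m v \<longleftrightarrow>
     radial_solution N f (v 0) v \<and> (\<exists>r>0. v r \<noteq> v 0) \<and> (v \<longlongrightarrow> 0) at_top \<and>
     finite (zero_crossings v) \<and> card (zero_crossings v) + 1 = m"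

section \<open>Convergence to a zero of f with |s| = b\<close>

text \<open>\<open>H1\<close> allows \<open>f\<close> to vanish inside \<open>(0,b)\<close>, and then solutions may settle at such an interior
  zero: for \<open>N = 3\<close>, \<open>b = 1\<close>, let \<open>f(s) = 6 s (s - 1/10)\<close> on \<open>[0,1/10]\<close>, \<open>f = 0\<close> on \<open>[1/10,1]\<close>
  and \<open>f(s) = s - 1\<close> for \<open>s \<ge> 1\<close>, so that \<open>\<beta> < 1.05\<close>. The solution with \<open>u(0) = 3/2\<close> is
  \<open>1 + sin r / (2 r)\<close> for \<open>r \<le> pi\<close> and \<open>1/2 + pi / (2 r)\<close> afterwards; it tends to \<open>1/2\<close>, not to
  \<open>b\<close>. Assertions that a solution tends to \<open>b\<close> or \<open>-b\<close> are therefore made under the following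
  condition.\<close>

definition no_interior_zero :: "(real \<Rightarrow> real) \<Rightarrow> real \<Rightarrow> bool" where
  "no_interior_zero f b \<longleftrightarrow> (\<forall>s\<in>{0<..<b}. f s < 0)"

end

theory Submission
  imports Defs
begin

text \<open>The energy \<open>E = u'\<^sup>2/2 + F(u)\<close> is nonincreasing. Since \<open>E = (r J)\<^sup>2/2 + F(s)\<close> on the curve, a
  return to the same \<open>s\<close> happens closer to the axis; this is the inward spiral. While \<open>E > 0\<close> the
  axis can only be met outside \<open>(-\<beta>,\<beta>)\<close>; as soon as \<open>E < 0\<close> the solution keeps its sign.
  Two Lyapunov functions control the long time behaviour. If \<open>E\<close> stays above a level \<open>L\<close> at which
  \<open>(s - c) f(s) > 0\<close> wherever \<open>F(s) \<ge> L\<close>, then \<open>K E + (N-1) (u-c) u'/r + d ln r\<close> decreases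
  eventually for suitable \<open>K, d > 0\<close> although it tends to infinity. With \<open>c = 0\<close> this forces \<open>E \<rightarrow> 0\<close> if there are infinitely
  many sign changes, and then \<open>r E\<close>, corrected by a multiple of \<open>h(u) u'\<close> with \<open>h\<close> supported on
  large \<open>|u|\<close>, drops by a fixed amount at each of them, again absurd. With \<open>c = b\<close> it shows that a
  trapped solution converges to \<open>b\<close>.\<close>

text \<open>\<open>H1\<close> gives no Lipschitz bound at 0 or at the exceptional points, and f may
  vanish inside (0,b). Uniqueness is therefore not freely available, and at a critical point with
  f(u) = 0 the second derivative decides nothing. The substitutes are the flux r^(N-1) u', monotone
  while f(u) keeps a sign, and a lower bound on the decay of E - F(b), which keeps critical points
  away from \<plusminus>b. Both Lyapunov functions start from an exact computation. In (r E)' = F(u)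
  - (N - 3/2) u'^2 the only positive contribution comes from |u| > \<beta>, and it is absorbed by
  the term -h f in the derivative of h u'. In ((u-c) u'/r)' = (u'^2 - (u-c) f(u) - N (u-c) u'/r) / r
  the kinetic part is paid for by E; the gain is only of order 1/r, and its divergent integral is
  the logarithm. Since f is odd, it suffices to follow positive excursions of u and of -u.\<close>

section \<open>Limits, signs and compactness on the real line\<close>

text \<open>By the mean value theorem on [r, r+1] the derivative takes the value h(r+1) - h(r)
  somewhere beyond r, and this tends to 0. Convergence is assumed for the modulus only, because the
  energy determines u' up to sign.\<close>

lemma deriv_limit_zero_subseq:
  fixes h h' :: "real \<Rightarrow> real"
  assumes "\<And>r. R \<le> r \<Longrightarrow> (h has_real_derivative h' r) (at r)"
    and "(h \<longlongrightarrow> l) at_top" and "((\<lambda>r. \<bar>h' r\<bar>) \<longlongrightarrow> m) at_top"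
  shows "m = 0"
proof -
  have "\<exists>x>r. r \<ge> R \<longrightarrow> h (r + 1) - h r = h' x" for r
  proof (cases "r \<ge> R")
    case True
    then obtain z where "r < z" "h (r + 1) - h r = (r + 1 - r) * h' z"
      using MVT2[of r "r + 1" h h'] assms(1) by fastforce
    then show ?thesis by auto
  qed (auto intro: gt_ex)
  then obtain x where x: "\<And>r. r < x r" "\<And>r. r \<ge> R \<Longrightarrow> h (r + 1) - h r = h' (x r)" by metis
  have "filterlim x at_top at_top"
    by (rule filterlim_at_top_mono[OF filterlim_ident]) (use x(1) in \<open>auto intro!: always_eventually less_imp_le\<close>)
  with assms(3) have "((\<lambda>r. \<bar>h' (x r)\<bar>) \<longlongrightarrow> m) at_top" by (rule filterlim_compose)
  moreover have "((\<lambda>r. \<bar>h (r + 1) - h r\<bar>) \<longlongrightarrow> \<bar>l - l\<bar>) at_top"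
    by (intro tendsto_intros filterlim_compose[OF assms(2)] filterlim_tendsto_add_at_top[OF tendsto_const filterlim_ident, of 1, simplified add.commute] assms(2))
  moreover have "\<forall>\<^sub>F r in at_top. \<bar>h (r + 1) - h r\<bar> = \<bar>h' (x r)\<bar>"
    using eventually_ge_at_top[of R] by eventually_elim (simp add: x)
  ultimately have "((\<lambda>r. \<bar>h' (x r)\<bar>) \<longlongrightarrow> 0) at_top" by (auto dest: tendsto_cong)
  then show ?thesis
    using \<open>((\<lambda>r. \<bar>h' (x r)\<bar>) \<longlongrightarrow> m) at_top\<close> tendsto_unique trivial_limit_at_top_linorder by blast
qed

lemma antimono_bounded_below_convergent:
  fixes h :: "real \<Rightarrow> real"
  assumes mono: "\<And>r s. R \<le> r \<Longrightarrow> r \<le> s \<Longrightarrow> h s \<le> h r" and bd: "\<And>r. R \<le> r \<Longrightarrow> B \<le> h r"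
  obtains l where "(h \<longlongrightarrow> l) at_top" "\<And>r. R \<le> r \<Longrightarrow> l \<le> h r" "B \<le> l"
proof -
  define l where "l = Inf (h ` {R..})"
  have bb: "bdd_below (h ` {R..})" using bd by (auto intro!: bdd_belowI)
  have l: "l \<le> h r" if "R \<le> r" for r
    unfolding l_def using bb that by (auto intro: cInf_lower)
  have "(h \<longlongrightarrow> l) at_top"
  proof (rule order_tendstoI)
    fix y assume y: "y < l"
    show "\<forall>\<^sub>F r in at_top. y < h r"
      using eventually_ge_at_top[of R] by eventually_elim (use y l in fastforce)
  next
    fix y assume y: "l < y"
    then obtain r where r: "R \<le> r" "h r < y"
      unfolding l_def using cInf_less_iff[OF _ bb, of y] by auto
    show "\<forall>\<^sub>F r in at_top. h r < y"
      using eventually_ge_at_top[of r] by eventually_elim (use r mono in force)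
  qed
  moreover have "B \<le> l" unfolding l_def by (rule cINF_greatest) (use bd in auto)
  ultimately show ?thesis using that l by blast
qed

lemma nonzero_constant_sign:
  fixes h :: "real \<Rightarrow> real"
  assumes "is_interval I" "continuous_on I h" "\<And>r. r \<in> I \<Longrightarrow> h r \<noteq> 0"
  shows "(\<forall>r\<in>I. h r < 0) \<or> (\<forall>r\<in>I. 0 < h r)"
proof (rule ccontr)
  assume "\<not> ?thesis"
  then obtain p q where pq: "p \<in> I" "q \<in> I" "h p > 0" "h q < 0"
    using assms(3) by (metis not_less_iff_gr_or_eq)
  have "connected (h ` I)"
    using assms by (intro connected_continuous_image) (auto simp: is_interval_connected)
  then have "0 \<in> h ` I"
    using pq connected_contains_Icc[of "h ` I" "h q" "h p"] by fastforce
  with assms(3) show False by auto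
qed

text \<open>If no pair served, K = n and d = 1/(n+1) would fail at some point of S for every n, and
  a limit point would have p = 0 and q \<le> 0. The penalty K p makes up for the part of S where q
  is not positive.\<close>

lemma compact_penalty:
  fixes p q :: "real \<Rightarrow> real"
  assumes "compact S" "continuous_on S p" "continuous_on S q"
    and "\<And>s. s \<in> S \<Longrightarrow> 0 \<le> p s" and "\<And>s. s \<in> S \<Longrightarrow> p s = 0 \<Longrightarrow> 0 < q s"
  obtains K d where "K \<ge> 0" "d > 0" "\<And>s. s \<in> S \<Longrightarrow> d \<le> K * p s + q s"
proof -
  have "\<exists>K\<ge>0. \<exists>d>0. \<forall>s\<in>S. d \<le> K * p s + q s"
  proof (rule ccontr)
    assume neg: "\<not> ?thesis"
    have "\<exists>s\<in>S. real n * p s + q s < inverse (Suc n)" for n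
      using neg by (metis inverse_positive_iff_positive not_less of_nat_0_le_iff of_nat_0_less_iff zero_less_Suc)
    then obtain x where x: "\<And>n. x n \<in> S" "\<And>n. real n * p (x n) + q (x n) < inverse (Suc n)" by metis
    obtain l \<phi> where l: "l \<in> S" "strict_mono \<phi>" "(x \<circ> \<phi>) \<longlonglongrightarrow> l"
      using assms(1) x(1) unfolding compact_def by metis
    have pl: "(\<lambda>n. p ((x \<circ> \<phi>) n)) \<longlonglongrightarrow> p l"
      by (rule continuous_on_tendsto_compose[OF assms(2) l(3,1)]) (simp add: x)
    have ql: "(\<lambda>n. q ((x \<circ> \<phi>) n)) \<longlonglongrightarrow> q l"
      by (rule continuous_on_tendsto_compose[OF assms(3) l(3,1)]) (simp add: x)
    have i: "(\<lambda>n. inverse (real (Suc (\<phi> n)))) \<longlonglongrightarrow> 0"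
      using LIMSEQ_subseq_LIMSEQ[OF LIMSEQ_inverse_real_of_nat l(2)] by (simp add: o_def)
    have "q l \<le> 0"
    proof (rule LIMSEQ_le[OF ql i])
      show "\<exists>N. \<forall>n\<ge>N. q ((x \<circ> \<phi>) n) \<le> inverse (real (Suc (\<phi> n)))"
        using x(2)[of "\<phi> _"] assms(4)[OF x(1)] mult_nonneg_nonneg[OF of_nat_0_le_iff assms(4)[OF x(1)]]
        by (intro exI[of _ 0] allI impI) (smt (verit) comp_apply)
    qed
    moreover have "p l = 0"
    proof (rule ccontr)
      assume "p l \<noteq> 0"
      then have pp: "p l > 0" using assms(4)[OF l(1)] by simp
      have ev: "\<forall>\<^sub>F n in sequentially. p l / 2 < p (x (\<phi> n))"
        using order_tendstoD(1)[OF pl, of "p l / 2"] pp by simp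
      have "filterlim (\<lambda>n. real n * (p l / 2)) at_top sequentially"
        using pp by (intro filterlim_at_top_mult_tendsto_pos[OF tendsto_const]) (auto intro: filterlim_real_sequentially)
      then have "filterlim (\<lambda>n. q (x (\<phi> n)) + real n * (p l / 2)) at_top sequentially"
        using ql by (intro filterlim_tendsto_add_at_top) (auto simp: o_def)
      then have ev2: "\<forall>\<^sub>F n in sequentially. q (x (\<phi> n)) + real n * (p l / 2) > 1"
        by (simp add: filterlim_at_top_dense)
      from eventually_conj[OF ev ev2] obtain n where
        n: "p l / 2 < p (x (\<phi> n))" "q (x (\<phi> n)) + real n * (p l / 2) > 1"
        using eventually_sequentially by (metis (no_types, lifting) eventually_conj_iff order_refl)
      have "real n * (p l / 2) \<le> real (\<phi> n) * p (x (\<phi> n))"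
        using n(1) pp seq_suble[OF l(2), of n] by (intro mult_mono) auto
      moreover have "inverse (real (Suc (\<phi> n))) \<le> 1" by (simp add: inverse_le_1_iff)
      ultimately show False using x(2)[of "\<phi> n"] n(2) by linarith
    qed
    ultimately show False using assms(5)[OF l(1)] by simp
  qed
  then show ?thesis using that by blast
qed

section \<open>The nonlinearity and its potential\<close>

locale nonlinearity =
  fixes f :: "real \<Rightarrow> real" and b \<beta> :: real
  assumes H1: "H1 f b \<beta>"
begin

lemma f_minus [simp]: "f (- s) = - f s"
  using H1 unfolding H1_def by (metis minus_minus)

lemma f_zero [simp]: "f 0 = 0" using H1 by (simp add: H1_def)

lemma f_pos: "b < s \<Longrightarrow> 0 < f s" using H1 by (simp add: H1_def)

lemma f_nonpos: "0 \<le> s \<Longrightarrow> s \<le> b \<Longrightarrow> f s \<le> 0" using H1 by (simp add: H1_def)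

lemma f_neg_near_zero: obtains \<epsilon> where "\<epsilon> > 0" "\<And>s. 0 < s \<Longrightarrow> s < \<epsilon> \<Longrightarrow> f s < 0"
  using H1 unfolding H1_def by (metis greaterThanLessThan_iff)

lemma b_pos: "0 < b"
proof (rule ccontr)
  assume "\<not> ?thesis"
  then have "b = 0" using H1 by (simp add: H1_def)
  moreover obtain \<epsilon> where "\<epsilon> > 0" "\<And>s. 0 < s \<Longrightarrow> s < \<epsilon> \<Longrightarrow> f s < 0" by (blast intro: f_neg_near_zero)
  ultimately show False using f_pos[of "\<epsilon>/2"] by (metis field_sum_of_halves less_add_same_cancel1 not_less_iff_gr_or_eq half_gt_zero)
qed

lemma f_cont: "continuous_on UNIV f"
proof -
  have 1: "continuous_on {0..} f" using H1 by (simp add: H1_def)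
  have "continuous_on {..0} (\<lambda>s. - f (- s))"
    by (intro continuous_intros continuous_on_compose2[OF 1]) auto
  then have "continuous_on ({0..} \<union> {..0}) f"
    using 1 by (intro continuous_on_closed_Un) (auto)
  moreover have "{0..} \<union> {..0} = (UNIV :: real set)" by auto
  ultimately show ?thesis by simp
qed

lemma f_isCont: "isCont f s"
  using f_cont by (simp add: continuous_on_eq_continuous_at)

text \<open>A signed interval integral, so that F is an antiderivative of f on the whole line;
  \<open>integral {0..s} f\<close> would be 0 for negative s.\<close>

definition F :: "real \<Rightarrow> real" where "F s = (LBINT y=0..s. f y)"

lemma F_deriv: "(F has_real_derivative f s) (at s)"
proof -
  have "((\<lambda>u. LBINT y=0..u. f y) has_vector_derivative f s) (at s within {- \<bar>s\<bar> - 1.. \<bar>s\<bar> + 1})"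
    using interval_integral_FTC2[of "- \<bar>s\<bar> - 1" 0 "\<bar>s\<bar> + 1" f s] continuous_on_subset[OF f_cont]
    by (auto simp: zero_ereal_def)
  then have "(F has_real_derivative f s) (at s within {- \<bar>s\<bar> - 1.. \<bar>s\<bar> + 1})"
    unfolding F_def has_real_derivative_iff_has_vector_derivative by simp
  moreover have "s \<in> interior {- \<bar>s\<bar> - 1.. \<bar>s\<bar> + 1}" by (simp) linarith
  ultimately show ?thesis by (metis at_within_interior)
qed

lemma F_cont: "continuous_on S F"
  using F_deriv by (meson DERIV_isCont continuous_at_imp_continuous_on)

lemma F_zero [simp]: "F 0 = 0" by (simp add: F_def zero_ereal_def[symmetric])

lemma F_minus [simp]: "F (- s) = F s"
proof -
  have "((\<lambda>s. F (- s) - F s) has_real_derivative 0) (at s)" for s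
    by (rule derivative_eq_intros F_deriv[THEN DERIV_chain2] F_deriv refl | simp)+
  then have "F (- s) - F s = F (- 0) - F 0" by (intro DERIV_isconst_all[of _ s 0, simplified]) auto
  then show ?thesis by simp
qed

lemma F_abs: "F \<bar>s\<bar> = F s" by (simp add: abs_if)

lemma F_integral: "0 \<le> x \<Longrightarrow> integral {0..x} f = F x"
  unfolding F_def using f_cont
  by (subst interval_integral_eq_integral[symmetric])
     (auto intro!: borel_integrable_atLeastAtMost' continuous_on_subset[OF f_cont] simp: zero_ereal_def)

lemma b_le_beta: "b \<le> \<beta>" using H1 by (simp add: H1_def)

lemma F_beta [simp]: "F \<beta> = 0"
  using H1 F_integral[of \<beta>] b_pos b_le_beta unfolding H1_def by linarith

lemma F_antimono: "0 \<le> s \<Longrightarrow> s \<le> t \<Longrightarrow> t \<le> b \<Longrightarrow> F t \<le> F s"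
  by (rule DERIV_nonpos_imp_nonincreasing) (auto intro!: exI F_deriv f_nonpos)

lemma F_mono: "b \<le> s \<Longrightarrow> s < t \<Longrightarrow> F s < F t"
  by (rule DERIV_pos_imp_increasing_open) (auto intro!: exI F_deriv F_cont f_pos)

text \<open>Strictness is gained on (0,\<epsilon>), the only part of (0,b] where f is known to be
  negative; after that F merely does not increase.\<close>

lemma F_neg_le_b: assumes "0 < s" "s \<le> b" shows "F s < 0"
proof -
  obtain \<epsilon> where e: "\<epsilon> > 0" "\<And>s. 0 < s \<Longrightarrow> s < \<epsilon> \<Longrightarrow> f s < 0" by (blast intro: f_neg_near_zero)
  have "F (min s \<epsilon>) < F 0"
    by (rule DERIV_neg_imp_decreasing_open) (use assms e in \<open>auto intro!: exI F_deriv F_cont\<close>)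
  moreover have "F s \<le> F (min s \<epsilon>)" using assms e by (intro F_antimono) auto
  ultimately show ?thesis by simp
qed

lemma b_less_beta: "b < \<beta>"
  using F_neg_le_b[of b] b_pos b_le_beta F_beta by (metis less_irrefl order_le_less)

lemma F_neg: assumes "s \<noteq> 0" "\<bar>s\<bar> < \<beta>" shows "F s < 0"
proof (cases "\<bar>s\<bar> \<le> b")
  case True then show ?thesis using F_neg_le_b[of "\<bar>s\<bar>"] assms by (simp add: F_abs)
next
  case False then show ?thesis using F_mono[of "\<bar>s\<bar>" \<beta>] assms by (simp add: F_abs)
qed

lemma F_pos: "\<beta> < \<bar>s\<bar> \<Longrightarrow> 0 < F s"
  using F_mono[of \<beta> "\<bar>s\<bar>"] b_less_beta by (simp add: F_abs)

lemma F_nonpos: "\<bar>s\<bar> \<le> \<beta> \<Longrightarrow> F s \<le> 0"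
  using F_neg[of s] F_beta F_abs[of s] F_zero by (metis less_eq_real_def)

lemma F_nonneg_imp: "0 \<le> F s \<Longrightarrow> s \<noteq> 0 \<Longrightarrow> \<beta> \<le> \<bar>s\<bar>"
  using F_neg[of s] by linarith

lemma F_ge: "F b \<le> F s"
proof (cases "\<bar>s\<bar> \<le> b")
  case True then show ?thesis using F_antimono[of "\<bar>s\<bar>" b] by (simp add: F_abs)
next
  case False then show ?thesis using F_mono[of b "\<bar>s\<bar>"] by (simp add: F_abs)
qed

text \<open>Turns a drop of the energy into a bound on the amplitude: beyond b the potential
  increases strictly in |s|.\<close>

lemma F_less_imp_abs: "b \<le> \<bar>t\<bar> \<Longrightarrow> F s < F t \<Longrightarrow> \<bar>s\<bar> < \<bar>t\<bar>"
  using F_mono[of "\<bar>t\<bar>" "\<bar>s\<bar>"] unfolding F_abs by (smt (verit) F_abs)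

text \<open>In general f may vanish on an interval ending at b, and F is then minimal on all of it;
  the first assumption excludes this.\<close>

lemma F_b_minimum: assumes "no_interior_zero f b" "s > 0" "F s = F b" shows "s = b"
proof (rule ccontr)
  assume "s \<noteq> b"
  then consider "s < b" | "b < s" by linarith
  then show False
  proof cases
    case 1
    have "F b < F s"
      by (rule DERIV_neg_imp_decreasing_open)
        (use assms 1 in \<open>auto intro!: exI F_deriv F_cont simp: no_interior_zero_def\<close>)
    then show ?thesis using assms by simp
  next
    case 2 then show ?thesis using F_mono[of b s] assms by simp
  qed
qed

end

section \<open>The radial equation: reflection, flux and behaviour at the origin\<close>

lemma deriv_pos_eventually:
  fixes h :: "real \<Rightarrow> real"
  assumes "(h has_real_derivative l) (at x)" "0 < l"
  shows "\<forall>\<^sub>F y in at_left x. h y < h x" "\<forall>\<^sub>F y in at_right x. h x < h y"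
proof -
  obtain d where d: "d > 0" "\<And>e. e > 0 \<Longrightarrow> e < d \<Longrightarrow> h (x - e) < h x"
    using DERIV_pos_inc_left[OF assms] by blast
  show "\<forall>\<^sub>F y in at_left x. h y < h x"
    unfolding eventually_at_left_field
    by (intro exI[of _ "x - d"]) (use d(1) d(2)[of "x - _"] in auto)
  obtain d where d: "d > 0" "\<And>e. e > 0 \<Longrightarrow> e < d \<Longrightarrow> h x < h (x + e)"
    using DERIV_pos_inc_right[OF assms] by blast
  show "\<forall>\<^sub>F y in at_right x. h x < h y"
    unfolding eventually_at_right_field
    by (intro exI[of _ "x + d"]) (use d(1) d(2)[of "_ - x"] in auto)
qed

lemma deriv_neg_eventually:
  fixes h :: "real \<Rightarrow> real"
  assumes "(h has_real_derivative l) (at x)" "l < 0"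
  shows "\<forall>\<^sub>F y in at_left x. h x < h y" "\<forall>\<^sub>F y in at_right x. h y < h x"
  using deriv_pos_eventually[of "\<lambda>y. - h y" "- l" x] assms by (auto intro: DERIV_minus)

text \<open>The amplitude is bounded through |a| so that -v with initial value -a is an instance of
  the same locale. Results on maxima then serve for minima as well.\<close>

locale radial_ode = nonlinearity f b \<beta> for f b \<beta> +
  fixes N :: real and v :: "real \<Rightarrow> real" and a :: real
  assumes N: "2 < N" and sol: "radial_solution N f a v" and a: "\<beta> < \<bar>a\<bar>"
begin

abbreviation v' :: "real \<Rightarrow> real" where "v' \<equiv> deriv v"

lemma v_0: "v 0 = a" using sol by (simp add: radial_solution_def)

lemma v_deriv: "0 < r \<Longrightarrow> (v has_real_derivative v' r) (at r)"
  using sol unfolding radial_solution_def by (metis DERIV_deriv_iff_real_differentiable)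

lemma v'_deriv: assumes "0 < r" shows "(v' has_real_derivative - (N - 1) / r * v' r - f (v r)) (at r)"
proof -
  have "(v' has_real_derivative deriv v' r) (at r)"
    using sol assms unfolding radial_solution_def by (metis DERIV_deriv_iff_real_differentiable)
  moreover have "deriv v' r + (N - 1) / r * v' r + f (v r) = 0"
    using sol assms unfolding radial_solution_def by blast
  then have "deriv v' r = - (N - 1) / r * v' r - f (v r)"
    by (simp only: minus_divide_left [symmetric] mult_minus_left)
  ultimately show ?thesis by simp
qed

lemma v_isCont: "0 < r \<Longrightarrow> isCont v r" using v_deriv DERIV_isCont by blast

lemma v'_isCont: "0 < r \<Longrightarrow> isCont v' r" using v'_deriv DERIV_isCont by blast

lemma v_deriv_0: "(v has_real_derivative 0) (at 0 within {0..})"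
  using sol by (simp add: radial_solution_def)

lemma v_cont: "continuous_on {0..} v"
proof (rule continuous_on_eq_continuous_within[THEN iffD2], rule ballI)
  fix r :: real assume "r \<in> {0..}"
  then consider "r = 0" | "0 < r" by fastforce
  then show "continuous (at r within {0..}) v"
  proof cases
    case 1 then show ?thesis using v_deriv_0 DERIV_continuous by blast
  next
    case 2 then show ?thesis using v_isCont continuous_at_imp_continuous_within by blast
  qed
qed

lemma v_tendsto_0: "(v \<longlongrightarrow> a) (at_right 0)"
proof -
  have "(v \<longlongrightarrow> v 0) (at 0 within {0..})"
    using v_cont by (simp add: continuous_on_def)
  then show ?thesis unfolding v_0 by (rule tendsto_within_subset) auto
qed

lemma double_zero: "0 < R \<Longrightarrow> v R = 0 \<Longrightarrow> v' R = 0 \<Longrightarrow> R \<le> r \<Longrightarrow> v r = 0"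
  using sol unfolding radial_solution_def by blast

lemma double_zero_deriv: assumes "0 < R" "v R = 0" "v' R = 0" "R \<le> r" shows "v' r = 0"
proof (cases "r = R")
  case False
  then have "R < r" using assms by simp
  have z: "v x = 0" if "x \<in> {R<..}" for x using double_zero[OF assms(1-3)] that by simp
  have "(v has_real_derivative 0) (at r)"
    by (rule has_field_derivative_transform_within_open[of "\<lambda>_. 0" 0 r "{R<..}"])
       (use z \<open>R < r\<close> in auto)
  then show ?thesis by (rule DERIV_imp_deriv)
qed (use assms in simp)

lemma neg: "radial_ode f b \<beta> N (\<lambda>r. - v r) (- a)"
proof unfold_locales
  have d: "(deriv (\<lambda>r. - v r)) r = - v' r" if "0 < r" for r
    by (rule DERIV_imp_deriv) (intro DERIV_minus v_deriv that)
  have dd: "((deriv (\<lambda>r. - v r)) has_real_derivative - (- (N - 1) / r * v' r - f (v r))) (at r)" if "0 < r" for r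
    by (rule has_field_derivative_transform_within_open[of "\<lambda>r. - v' r" _ r "{0<..}"])
       (use that d v'_deriv in \<open>auto intro: DERIV_minus simp del: minus_diff_eq\<close>)
  show "radial_solution N f (- a) (\<lambda>r. - v r)"
    unfolding radial_solution_def
  proof (intro conjI allI impI)
    show "((\<lambda>r. - v r) has_real_derivative 0) (at 0 within {0..})"
      using DERIV_minus[OF v_deriv_0] by simp
    fix r :: real assume r: "0 < r"
    show "(\<lambda>r. - v r) differentiable at r"
      by (use DERIV_minus[OF v_deriv[OF r]] in \<open>auto simp: real_differentiable_def\<close>)
    show "deriv (\<lambda>r. - v r) differentiable at r"
      by (use dd[OF r] in \<open>auto simp: real_differentiable_def simp del: minus_diff_eq\<close>)
    show "deriv (deriv (\<lambda>r. - v r)) r + (N - 1) / r * deriv (\<lambda>r. - v r) r + f (- v r) = 0"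
      using DERIV_imp_deriv[OF dd[OF r]] d[OF r] by (simp add: algebra_simps)
  qed (use d double_zero v_0 in auto)
qed (use N a in auto)

lemma deriv_neg: "0 < r \<Longrightarrow> deriv (\<lambda>r. - v r) r = - v' r"
  by (rule DERIV_imp_deriv) (intro DERIV_minus v_deriv)

text \<open>The flux of the equation in divergence form, (r^(N-1) v')' = -r^(N-1) f(v). It has the
  sign of v' and is monotone wherever f(v) keeps a weak sign, also where f(v) = 0 and v'' gives no
  information.\<close>

definition g :: "real \<Rightarrow> real" where "g r = r powr (N - 1) * v' r"

lemma g_deriv: assumes "0 < r" shows "(g has_real_derivative - (r powr (N - 1)) * f (v r)) (at r)"
proof -
  have "((\<lambda>r. r powr (N - 1) * v' r) has_real_derivative
     (N - 1) * r powr (N - 1 - 1) * v' r + (- (N - 1) / r * v' r - f (v r)) * r powr (N - 1)) (at r)"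
    by (rule DERIV_mult[OF has_real_derivative_powr v'_deriv]) (use assms in auto)
  moreover have e: "r powr (N - 1) = r * r powr (N - 1 - 1)"
    using assms powr_add[of r 1 "N - 1 - 1"] by simp
  then have "(N - 1) * r powr (N - 1 - 1) * v' r + (- (N - 1) / r * v' r - f (v r)) * r powr (N - 1)
      = - (r powr (N - 1)) * f (v r)"
    using assms unfolding e by (simp add: field_simps)
  ultimately show ?thesis unfolding g_def[abs_def] by simp
qed

lemma g_sgn: "0 < r \<Longrightarrow> (0 < g r \<longleftrightarrow> 0 < v' r) \<and> (g r < 0 \<longleftrightarrow> v' r < 0) \<and> (g r = 0 \<longleftrightarrow> v' r = 0)"
  by (auto simp: g_def zero_less_mult_iff mult_less_0_iff)

lemma g_mono: assumes "0 < p" "p \<le> q" "\<And>r. p \<le> r \<Longrightarrow> r \<le> q \<Longrightarrow> 0 \<le> v r \<and> v r \<le> b" shows "g p \<le> g q"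
proof (rule DERIV_nonneg_imp_nondecreasing[OF assms(2)])
  fix r assume "p \<le> r" "r \<le> q"
  then show "\<exists>y. (g has_real_derivative y) (at r) \<and> 0 \<le> y"
    using assms f_nonpos[of "v r"]
    by (intro exI[of _ "- (r powr (N - 1)) * f (v r)"] conjI g_deriv) (auto simp: mult_le_0_iff)
qed

lemma g_antimono: assumes "0 < p" "p < q" "\<And>r. p \<le> r \<Longrightarrow> r \<le> q \<Longrightarrow> b < v r" shows "g q < g p"
proof (rule DERIV_neg_imp_decreasing[OF assms(2)])
  fix r assume "p \<le> r" "r \<le> q"
  then show "\<exists>y. (g has_real_derivative y) (at r) \<and> y < 0"
    using assms f_pos[of "v r"]
    by (intro exI[of _ "- (r powr (N - 1)) * f (v r)"] conjI g_deriv) (auto simp: mult_less_0_iff)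
qed

text \<open>Differentiability at 0 controls difference quotients of v, not v' itself. The mean value
  theorem on [x, 2x] yields single points of small slope, enough to evaluate g near 0 along a
  sequence.\<close>

lemma v'_small_near_0: assumes "0 < \<eta>" obtains x where "0 < x" "x < \<eta>" "\<bar>v' x\<bar> \<le> 1"
proof -
  have "((\<lambda>y. (v y - v 0) / (y - 0)) \<longlongrightarrow> 0) (at 0 within {0..})"
    using v_deriv_0 by (simp add: has_field_derivative_iff)
  then have "\<forall>\<^sub>F y in at 0 within {0..}. dist ((v y - v 0) / (y - 0)) 0 < 1 / 4"
    by (rule tendstoD) simp
  then obtain d where d: "d > 0" "\<And>y. 0 < y \<Longrightarrow> y < d \<Longrightarrow> \<bar>(v y - a) / y\<bar> < 1 / 4"
    unfolding eventually_at by (force simp: v_0)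
  define x where "x = min \<eta> d / 3"
  have x: "0 < x" "2 * x < \<eta>" "2 * x < d" using assms d(1) by (auto simp: x_def)
  obtain z where z: "x < z" "z < 2 * x" "v (2 * x) - v x = (2 * x - x) * v' z"
    using MVT2[of x "2 * x" v v'] x(1) v_deriv by fastforce
  have "\<bar>v x - a\<bar> < x / 4" using d(2)[of x] x by (simp add: abs_divide field_simps)
  moreover have "\<bar>v (2 * x) - a\<bar> < x / 2" using d(2)[of "2 * x"] x by (simp add: abs_divide field_simps)
  ultimately have "\<bar>v (2 * x) - v x\<bar> < x" by linarith
  then have "\<bar>x * v' z\<bar> < x * 1" by (simp add: z(3))
  then have "\<bar>v' z\<bar> < 1" using x(1) by (simp add: abs_mult)
  then show ?thesis using that[of z] z x by auto
qed

text \<open>Integrates -g' \<ge> m r^(N-1) from 0. The lower end contributes nothing, because g is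
  small at the points provided by \<open>v'_small_near_0\<close>.\<close>

lemma v'_over_r_bound:
  assumes "0 < \<rho>" "0 < r" "r < \<rho>" and bd: "\<And>x. 0 < x \<Longrightarrow> x < \<rho> \<Longrightarrow> m \<le> f (v x)"
  shows "m / N \<le> - v' r / r"
proof -
  define h where "h x = - g x - m * x powr N / N" for x
  have hd: "(h has_real_derivative x powr (N - 1) * (f (v x) - m)) (at x)" if "0 < x" for x
  proof -
    have "(h has_real_derivative - (- (x powr (N - 1)) * f (v x)) - m * (N * x powr (N - 1)) / N) (at x)"
      unfolding h_def[abs_def] using that
      by (intro DERIV_diff DERIV_minus DERIV_cdivide DERIV_cmult has_real_derivative_powr g_deriv)
    then show ?thesis using N by (simp add: algebra_simps)
  qed
  have mono: "h x \<le> h r" if "0 < x" "x \<le> r" for x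
  proof (rule DERIV_nonneg_imp_nondecreasing[OF that(2)])
    fix y assume "x \<le> y" "y \<le> r"
    then show "\<exists>l. (h has_real_derivative l) (at y) \<and> 0 \<le> l"
      using that assms bd[of y] by (intro exI[of _ "y powr (N - 1) * (f (v y) - m)"] conjI hd) auto
  qed
  have "0 \<le> h r"
  proof (rule ccontr)
    assume neg: "\<not> 0 \<le> h r"
    have "((\<lambda>x. x powr (N - 1) + \<bar>m\<bar> * x powr N / N) \<longlongrightarrow> 0 + \<bar>m\<bar> * 0 / N) (at_right 0)"
      using N by (intro tendsto_intros tendsto_zero_powrI[of "\<lambda>x. x"])
        (auto intro!: eventually_mono[OF eventually_at_right_less])
    then have "\<forall>\<^sub>F x in at_right 0. x powr (N - 1) + \<bar>m\<bar> * x powr N / N < - h r"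
      by (rule order_tendstoD) (use neg in simp)
    then obtain d where d: "d > 0" "\<And>x. 0 < x \<Longrightarrow> x < d \<Longrightarrow> x powr (N - 1) + \<bar>m\<bar> * x powr N / N < - h r"
      unfolding eventually_at_right_field by auto
    obtain x where x: "0 < x" "x < min d r" "\<bar>v' x\<bar> \<le> 1"
      using v'_small_near_0[of "min d r"] d(1) assms by auto
    have "\<bar>g x\<bar> \<le> x powr (N - 1)" using x by (simp add: g_def abs_mult mult_left_le)
    moreover define A B where "A = m * x powr N / N" and "B = \<bar>m\<bar> * x powr N / N"
    have "A \<le> B" unfolding A_def B_def using N by (intro divide_right_mono mult_right_mono) auto
    moreover have "x powr (N - 1) + B < - h r" using d(2)[of x] x by (simp add: B_def)
    moreover have "h x = - g x - A" by (simp add: h_def A_def)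
    ultimately have "h r < h x" by linarith
    then show False using mono[of x] x by auto
  qed
  then have "m * (r powr (N - 1) * r) / N \<le> - (r powr (N - 1) * v' r)"
    using assms(2) powr_add[of r "N - 1" 1] by (simp add: h_def g_def)
  then have "r powr (N - 1) * (m / N * r) \<le> r powr (N - 1) * - v' r" by (simp add: algebra_simps)
  then have "m / N * r \<le> - v' r" by (rule mult_left_le_imp_le) (use assms(2) in simp)
  then show ?thesis using pos_le_divide_eq[OF assms(2)] by blast
qed

lemma v'_over_r_lower: assumes "c < f a / N" shows "\<forall>\<^sub>F r in at_right 0. c < - v' r / r"
proof -
  obtain m where m: "c < m / N" "m < f a"
    using assms N dense[of "c * N" "f a"] by (auto simp: field_simps)
  have "((\<lambda>r. f (v r)) \<longlongrightarrow> f a) (at_right 0)"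
    by (rule isCont_tendsto_compose[OF f_isCont v_tendsto_0])
  then have "\<forall>\<^sub>F r in at_right 0. m < f (v r)" by (rule order_tendstoD) (rule m)
  then obtain d where d: "d > 0" "\<And>x. 0 < x \<Longrightarrow> x < d \<Longrightarrow> m < f (v x)"
    unfolding eventually_at_right_field by auto
  have "c < - v' y / y" if "0 < y" "y < d" for y
    using v'_over_r_bound[OF d(1) that less_imp_le[OF d(2)]] m(1) by linarith
  then show ?thesis unfolding eventually_at_right_field using d(1) by blast
qed

text \<open>Since f is odd, the lower bound for -v is the upper bound for v.\<close>

lemma v'_over_r_tendsto: "((\<lambda>r. - v' r / r) \<longlongrightarrow> f a / N) (at_right 0)"
proof (rule order_tendstoI)
  interpret neg: radial_ode f b \<beta> N "\<lambda>r. - v r" "- a" by (rule neg)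
  fix c assume "f a / N < c"
  then have "\<forall>\<^sub>F r in at_right 0. - c < - neg.v' r / r" by (intro neg.v'_over_r_lower) simp
  then show "\<forall>\<^sub>F r in at_right 0. - v' r / r < c"
    using eventually_at_right_less[of "0::real"] by eventually_elim (simp add: deriv_neg)
qed (rule v'_over_r_lower)

lemma Jcal_0: "Jcal v 0 = f a / N"
  unfolding Jcal_def using v'_over_r_tendsto by (auto intro!: tendsto_Lim)

lemma Jcal_pos: "0 < r \<Longrightarrow> Jcal v r = - v' r / r" by (simp add: Jcal_def)

lemma curve_cont: "continuous_on {0..} (curve v)"
proof -
  have "continuous_on {0..} (Jcal v)"
  proof (rule continuous_on_eq_continuous_within[THEN iffD2], rule ballI)
    fix r :: real assume "r \<in> {0..}"
    then consider "r = 0" | "0 < r" by fastforce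
    then show "continuous (at r within {0..}) (Jcal v)"
    proof cases
      case 1
      have "((\<lambda>r. - v' r / r) \<longlongrightarrow> Jcal v 0) (at_right 0)" using v'_over_r_tendsto Jcal_0 by simp
      then have "(Jcal v \<longlongrightarrow> Jcal v 0) (at_right 0)"
        by (rule Lim_transform_eventually) (auto simp: Jcal_pos intro!: eventually_mono[OF eventually_at_right_less])
      then show ?thesis using 1 by (simp add: continuous_within at_within_Ici_at_right)
    next
      case 2
      have "isCont (\<lambda>r. - v' r / r) r" using 2 by (intro continuous_intros v'_isCont) auto
      then have "isCont (Jcal v) r"
        by (rule continuous_transform_within[of r UNIV _ r])(use 2 in \<open>auto simp: Jcal_def dist_real_def\<close>)
      then show ?thesis using continuous_at_imp_continuous_within by blast
    qed
  qed
  then show ?thesis unfolding curve_def[abs_def] by (intro continuous_intros v_cont)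
qed


section \<open>Energy\<close>

definition E :: "real \<Rightarrow> real" where "E r = (v' r)\<^sup>2 / 2 + F (v r)"

lemma E_deriv: assumes "0 < r" shows "(E has_real_derivative - ((N - 1) / r * (v' r)\<^sup>2)) (at r)"
proof -
  have "(E has_real_derivative (2 * v' r * (- (N - 1) / r * v' r - f (v r))) / 2 + f (v r) * v' r) (at r)"
    unfolding E_def[abs_def] using assms
    by (auto intro!: derivative_eq_intros v'_deriv DERIV_chain2[OF F_deriv] v_deriv)
  moreover have "(2 * v' r * (- (N - 1) / r * v' r - f (v r))) / 2 + f (v r) * v' r = - ((N - 1) / r * (v' r)\<^sup>2)"
    using assms by (simp add: field_simps power2_eq_square)
  ultimately show ?thesis by simp
qed

lemma E_antimono: assumes "0 < p" "p \<le> q" shows "E q \<le> E p"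
proof (rule DERIV_nonpos_imp_nonincreasing[OF assms(2)])
  fix r assume "p \<le> r" "r \<le> q"
  then show "\<exists>y. (E has_real_derivative y) (at r) \<and> y \<le> 0"
    using assms N by (intro exI[of _ "- ((N - 1) / r * (v' r)\<^sup>2)"] conjI E_deriv) auto
qed

text \<open>Equal energies force E' = -(N-1) v'^2 / r to vanish on the interval, so the solution
  rests there. This gives strict decay of the energy wherever v moves.\<close>

lemma E_const_imp_rest:
  assumes "0 < p" "p < q" "E q = E p" "p \<le> r" "r \<le> q"
  shows "v' r = 0" "v r = v p"
proof -
  have z: "v' r = 0" if "p < r" "r < q" for r
  proof -
    have cst: "E p = E x" if "x \<in> {p<..<q}" for x
      using E_antimono[of p x] E_antimono[of x q] that assms by force
    have "(E has_real_derivative 0) (at r)"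
      by (rule has_field_derivative_transform_within_open[OF DERIV_const open_greaterThanLessThan[of p q] _ cst])
        (use that in simp_all)
    from DERIV_unique[OF this E_deriv] have "(N - 1) / r * (v' r)\<^sup>2 = 0" using that assms(1) by simp
    then show ?thesis using N that assms(1) by auto
  qed
  have vp: "v r = v p" if "p \<le> r" "r \<le> q" for r
  proof (rule DERIV_isconst2[OF assms(2) _ _ that])
    show "continuous_on {p..q} v" using v_cont by (rule continuous_on_subset) (use assms in auto)
    fix x assume "p < x" "x < q"
    then show "(v has_real_derivative 0) (at x)" using v_deriv[of x] z[of x] assms(1) by simp
  qed
  show "v r = v p" using vp assms by blast
  \<comment> \<open>The end points are not covered by the interior argument; there v' is recovered
    from E, which still has the constant value \<open>F (v p)\<close>.\<close>
  have "(v' r)\<^sup>2 = 2 * (E r - F (v p))" using vp[of r] assms by (simp add: E_def)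
  also have "E r = E ((p + q) / 2)"
    using E_antimono[of p r] E_antimono[of r q] E_antimono[of p "(p+q)/2"] E_antimono[of "(p+q)/2" q] assms by simp
  also have "\<dots> = F (v p)" using vp[of "(p+q)/2"] z[of "(p+q)/2"] assms by (simp add: E_def)
  finally show "v' r = 0" by simp
qed

lemma E_strict: assumes "0 < p" "p \<le> x" "x \<le> q" "p < q" "v' x \<noteq> 0" shows "E q < E p"
  using E_const_imp_rest(1)[of p q x] E_antimono[of p q] assms by force

lemma v'_tendsto_0: "(v' \<longlongrightarrow> 0) (at_right 0)"
proof -
  have "((\<lambda>r. - (- v' r / r) * r) \<longlongrightarrow> - (f a / N) * 0) (at_right 0)"
    by (intro tendsto_intros v'_over_r_tendsto)
  then show ?thesis
    unfolding mult_zero_right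
    by (rule Lim_transform_eventually) (rule eventually_mono[OF eventually_at_right_less[of "0::real"]], simp)
qed

lemma E_tendsto_0: "(E \<longlongrightarrow> F a) (at_right 0)"
proof -
  have "((\<lambda>r. (v' r)\<^sup>2 / 2 + F (v r)) \<longlongrightarrow> 0\<^sup>2 / 2 + F a) (at_right 0)"
    by (intro tendsto_intros v'_tendsto_0 isCont_tendsto_compose[OF _ v_tendsto_0] DERIV_isCont[OF F_deriv]) simp
  then show ?thesis by (simp add: E_def[abs_def])
qed

lemma f_a: "0 < a * f a"
proof (cases "0 < a")
  case True then show ?thesis using f_pos[of a] a b_less_beta by simp
next
  case False then show ?thesis using f_pos[of "- a"] a b_less_beta b_pos by (auto simp: mult_neg_neg)
qed

lemma v'_near_0: obtains d where "d > 0" "\<And>r. 0 < r \<Longrightarrow> r < d \<Longrightarrow> a * v' r < 0"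
proof -
  have "((\<lambda>r. a * (- v' r / r)) \<longlongrightarrow> a * (f a / N)) (at_right 0)"
    by (intro tendsto_intros v'_over_r_tendsto)
  moreover have "0 < a * (f a / N)" using f_a N by simp
  ultimately have "\<forall>\<^sub>F r in at_right 0. 0 < a * (- v' r / r)" by (rule order_tendstoD)
  then obtain d where d: "d > 0" "\<And>r. 0 < r \<Longrightarrow> r < d \<Longrightarrow> 0 < a * (- v' r / r)"
    unfolding eventually_at_right_field by auto
  have "a * v' r < 0" if "0 < r" "r < d" for r
    using d(2)[OF that] that by (simp add: field_simps)
  then show ?thesis using that d(1) by blast
qed

lemma E_le_Fa: assumes "0 < r" shows "E r \<le> F a"
proof (rule tendsto_lowerbound[OF E_tendsto_0])
  show "\<forall>\<^sub>F x in at_right 0. E r \<le> E x"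
    unfolding eventually_at_right_field using assms E_antimono by (intro exI[of _ r]) auto
qed auto

text \<open>The slope is nonzero at small positive times, because f a \<noteq> 0, so the energy
  falls strictly at once.\<close>

lemma E_less_Fa: assumes "0 < r" shows "E r < F a"
proof -
  obtain d where d: "d > 0" "\<And>r. 0 < r \<Longrightarrow> r < d \<Longrightarrow> a * v' r < 0" by (blast intro: v'_near_0)
  define p where "p = min r d / 2"
  have p: "0 < p" "p < r" "p < d" using assms d(1) by (auto simp: p_def)
  have "E r < E p" by (rule E_strict[of p p]) (use p d(2)[of p] in auto)
  then show ?thesis using E_le_Fa[of p] p by simp
qed

lemma abs_v_less: assumes "0 < r" shows "\<bar>v r\<bar> < \<bar>a\<bar>"
proof (rule F_less_imp_abs)
  show "F (v r) < F a" using E_less_Fa[OF assms] zero_le_power2[of "v' r"] unfolding E_def by linarith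
qed (use a b_less_beta in simp)

lemma v'_bounded: assumes "0 < r" shows "\<bar>v' r\<bar> \<le> sqrt (2 * (F a - F b))"
proof -
  have "(v' r)\<^sup>2 \<le> 2 * (F a - F b)"
    using E_less_Fa[OF assms] F_ge[of "v r"] by (simp add: E_def)
  then show ?thesis by (simp add: real_le_rsqrt)
qed

text \<open>The excess \<open>E - F b\<close> decays at most like \<open>r\<^sup>-\<^sup>2\<^sup>(\<^sup>N\<^sup>-\<^sup>1\<^sup>)\<close>, so that the minimum of the potential is not
  reached in finite time even if \<open>f\<close> is not Lipschitz there.\<close>

lemma E_gt_Fb: assumes "0 < r" shows "F b < E r"
proof -
  define h where "h x = x powr (2 * (N - 1)) * (E x - F b)" for x
  have "0 < F a" using F_pos a by simp
  then have "F b < F a" using F_neg_le_b[of b] b_pos by simp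
  then have "\<forall>\<^sub>F x in at_right 0. F b < E x" by (intro order_tendstoD(1)[OF E_tendsto_0])
  then obtain d where d: "d > 0" "\<And>x. 0 < x \<Longrightarrow> x < d \<Longrightarrow> F b < E x"
    unfolding eventually_at_right_field by auto
  define p where "p = min r d / 2"
  have p: "0 < p" "p < r" "p < d" using assms d(1) by (auto simp: p_def)
  have hd: "(h has_real_derivative x powr (2 * (N - 1)) * (2 * (N - 1) / x) * (F (v x) - F b)) (at x)" if "0 < x" for x
  proof -
    have e: "x powr (2 * (N - 1)) = x * x powr (2 * (N - 1) - 1)"
      using that powr_add[of x 1 "2 * (N - 1) - 1"] by simp
    have "(h has_real_derivative (2 * (N - 1) * x powr (2 * (N - 1) - 1)) * (E x - F b)
        + (- ((N - 1) / x * (v' x)\<^sup>2) - 0) * x powr (2 * (N - 1))) (at x)"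
      unfolding h_def[abs_def]
      by (intro DERIV_mult has_real_derivative_powr DERIV_diff E_deriv DERIV_const that)
    moreover have "(2 * (N - 1) * x powr (2 * (N - 1) - 1)) * (E x - F b)
        + (- ((N - 1) / x * (v' x)\<^sup>2) - 0) * x powr (2 * (N - 1))
      = x powr (2 * (N - 1)) * (2 * (N - 1) / x) * (F (v x) - F b)"
      using that unfolding e by (simp add: field_simps E_def)
    ultimately show ?thesis by simp
  qed
  have "h p \<le> h r"
  proof (rule DERIV_nonneg_imp_nondecreasing[of p r h])
    fix x assume x: "p \<le> x" "x \<le> r"
    have "0 \<le> x powr (2 * (N - 1)) * (2 * (N - 1) / x) * (F (v x) - F b)"
      using x p N F_ge[of "v x"] by auto
    then show "\<exists>y. (h has_real_derivative y) (at x) \<and> 0 \<le> y" using hd[of x] x p by auto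
  qed (use p in simp)
  moreover have "0 < h p" using d(2)[of p] p by (simp add: h_def)
  ultimately have "0 < h r" by simp
  then show ?thesis by (simp add: h_def zero_less_mult_iff)
qed

text \<open>A critical point at \<plusminus>b would have exactly the energy F b, which is never
  reached. This does the work of uniqueness for the constant solutions \<plusminus>b.\<close>

lemma critical_ne_b: assumes "0 < r" "v' r = 0" shows "\<bar>v r\<bar> \<noteq> b"
  using E_gt_Fb[OF assms(1)] assms(2) F_abs[of "v r"] by (auto simp: E_def)

lemma E_critical: "v' r = 0 \<Longrightarrow> E r = F (v r)" by (simp add: E_def)

lemma F_le_E: "F (v r) \<le> E r" by (simp add: E_def)

lemma critical_beta: assumes "0 < r" "v' r = 0" "0 \<le> E r" "v r \<noteq> 0" shows "\<beta> \<le> \<bar>v r\<bar>"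
  using F_nonneg_imp assms by (simp add: E_critical)

subsection \<open>Crossings\<close>

lemma up_cross_Jcal_iff: assumes "0 < r"
  shows "up_cross (Jcal v) 0 r \<longleftrightarrow>
    v' r = 0 \<and> (\<forall>\<^sub>F x in at_left r. 0 < v' x) \<and> (\<forall>\<^sub>F x in at_right r. v' x < 0)"
proof -
  have l: "\<forall>\<^sub>F x in at_left r. 0 < x" using eventually_at_left_field assms by blast
  have rr: "\<forall>\<^sub>F x in at_right r. 0 < x"
    using eventually_at_right_less[of r] by eventually_elim (use assms in simp)
  have "(\<forall>\<^sub>F x in at_left r. Jcal v x < 0) \<longleftrightarrow> (\<forall>\<^sub>F x in at_left r. 0 < v' x)"
    by (rule eventually_cong[OF l]) (simp add: Jcal_pos field_simps)
  moreover have "(\<forall>\<^sub>F x in at_right r. 0 < Jcal v x) \<longleftrightarrow> (\<forall>\<^sub>F x in at_right r. v' x < 0)"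
    by (rule eventually_cong[OF rr]) (simp add: Jcal_pos field_simps)
  ultimately show ?thesis using assms by (simp add: up_cross_def Jcal_pos)
qed

lemma down_cross_Jcal_iff: assumes "0 < r"
  shows "down_cross (Jcal v) 0 r \<longleftrightarrow>
    v' r = 0 \<and> (\<forall>\<^sub>F x in at_left r. v' x < 0) \<and> (\<forall>\<^sub>F x in at_right r. 0 < v' x)"
proof -
  have l: "\<forall>\<^sub>F x in at_left r. 0 < x" using eventually_at_left_field assms by blast
  have rr: "\<forall>\<^sub>F x in at_right r. 0 < x"
    using eventually_at_right_less[of r] by eventually_elim (use assms in simp)
  have "(\<forall>\<^sub>F x in at_left r. 0 < Jcal v x) \<longleftrightarrow> (\<forall>\<^sub>F x in at_left r. v' x < 0)"
    by (rule eventually_cong[OF l]) (simp add: Jcal_pos field_simps)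
  moreover have "(\<forall>\<^sub>F x in at_right r. Jcal v x < 0) \<longleftrightarrow> (\<forall>\<^sub>F x in at_right r. 0 < v' x)"
    by (rule eventually_cong[OF rr]) (simp add: Jcal_pos field_simps)
  ultimately show ?thesis using assms by (simp add: down_cross_def Jcal_pos)
qed

lemma neg_eventually_iff: assumes "0 < r"
  shows "(\<forall>\<^sub>F x in at_left r. 0 < deriv (\<lambda>r. - v r) x) \<longleftrightarrow> (\<forall>\<^sub>F x in at_left r. v' x < 0)"
    "(\<forall>\<^sub>F x in at_left r. deriv (\<lambda>r. - v r) x < 0) \<longleftrightarrow> (\<forall>\<^sub>F x in at_left r. 0 < v' x)"
    "(\<forall>\<^sub>F x in at_right r. 0 < deriv (\<lambda>r. - v r) x) \<longleftrightarrow> (\<forall>\<^sub>F x in at_right r. v' x < 0)"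
    "(\<forall>\<^sub>F x in at_right r. deriv (\<lambda>r. - v r) x < 0) \<longleftrightarrow> (\<forall>\<^sub>F x in at_right r. 0 < v' x)"
proof -
  have l: "\<forall>\<^sub>F x in at_left r. 0 < x" using eventually_at_left_field assms by blast
  have rr: "\<forall>\<^sub>F x in at_right r. 0 < x"
    using eventually_at_right_less[of r] by eventually_elim (use assms in simp)
  show "(\<forall>\<^sub>F x in at_left r. 0 < deriv (\<lambda>r. - v r) x) \<longleftrightarrow> (\<forall>\<^sub>F x in at_left r. v' x < 0)"
    "(\<forall>\<^sub>F x in at_left r. deriv (\<lambda>r. - v r) x < 0) \<longleftrightarrow> (\<forall>\<^sub>F x in at_left r. 0 < v' x)"
    by (rule eventually_cong[OF l], simp add: deriv_neg)+
  show "(\<forall>\<^sub>F x in at_right r. 0 < deriv (\<lambda>r. - v r) x) \<longleftrightarrow> (\<forall>\<^sub>F x in at_right r. v' x < 0)"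
    "(\<forall>\<^sub>F x in at_right r. deriv (\<lambda>r. - v r) x < 0) \<longleftrightarrow> (\<forall>\<^sub>F x in at_right r. 0 < v' x)"
    by (rule eventually_cong[OF rr], simp add: deriv_neg)+
qed

lemma up_cross_Jcal_neg: assumes "0 < r"
  shows "up_cross (Jcal (\<lambda>r. - v r)) 0 r \<longleftrightarrow> down_cross (Jcal v) 0 r"
    "down_cross (Jcal (\<lambda>r. - v r)) 0 r \<longleftrightarrow> up_cross (Jcal v) 0 r"
proof -
  interpret neg: radial_ode f b \<beta> N "\<lambda>r. - v r" "- a" by (rule neg)
  show "up_cross (Jcal (\<lambda>r. - v r)) 0 r \<longleftrightarrow> down_cross (Jcal v) 0 r"
    "down_cross (Jcal (\<lambda>r. - v r)) 0 r \<longleftrightarrow> up_cross (Jcal v) 0 r"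
    unfolding neg.up_cross_Jcal_iff[OF assms] neg.down_cross_Jcal_iff[OF assms]
      up_cross_Jcal_iff[OF assms] down_cross_Jcal_iff[OF assms] neg_eventually_iff[OF assms]
    by (auto simp: deriv_neg[OF assms])
qed

text \<open>At a critical point the equation reads v'' = -f(v). Since \<open>Jcal\<close> is -v'/r,
  a strict local maximum of v is an upward crossing of the axis.\<close>

lemma critical_imp_cross: assumes "0 < r" "v' r = 0"
  shows "0 < f (v r) \<Longrightarrow> up_cross (Jcal v) 0 r" "f (v r) < 0 \<Longrightarrow> down_cross (Jcal v) 0 r"
proof -
  have d: "(v' has_real_derivative - f (v r)) (at r)" using v'_deriv[OF assms(1)] assms(2) by simp
  show "up_cross (Jcal v) 0 r" if "0 < f (v r)"
    using deriv_neg_eventually[OF d] that assms by (simp add: up_cross_Jcal_iff)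
  show "down_cross (Jcal v) 0 r" if "f (v r) < 0"
    using deriv_pos_eventually[OF d] that assms by (simp add: down_cross_Jcal_iff)
qed

text \<open>An upward crossing is a strict local maximum of v. Besides the heights above b it can
  occur between -b and 0, where the curve turns around (-b,0). The other positions are excluded by
  v'' (below -b), by the double zero convention (at 0), by the flux (in (0,b)) and by the energy (at
  \<plusminus>b).\<close>

lemma up_cross_Jcal_imp: assumes r: "0 < r" and u: "up_cross (Jcal v) 0 r"
  shows "b < v r \<or> - b < v r \<and> v r < 0"
proof -
  have u: "v' r = 0" "\<forall>\<^sub>F x in at_left r. 0 < v' x" "\<forall>\<^sub>F x in at_right r. v' x < 0"
    using u r by (auto simp: up_cross_Jcal_iff)
  have 1: "\<not> v r < - b"
  proof
    assume "v r < - b"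
    then have "f (v r) < 0" using f_pos[of "- v r"] by simp
    then have "\<forall>\<^sub>F x in at_right r. 0 < v' x"
      using critical_imp_cross(2)[OF r u(1)] r by (simp add: down_cross_Jcal_iff)
    with u(3) have "\<forall>\<^sub>F x in at_right r. False" by eventually_elim simp
    then show False by simp
  qed
  have 2: "v r \<noteq> 0"
  proof
    assume "v r = 0"
    then have "\<forall>\<^sub>F x in at_right r. v' x = 0"
      using double_zero_deriv[OF r] u(1) eventually_at_right_less[of r] by (auto elim!: eventually_mono)
    with u(3) have "\<forall>\<^sub>F x in at_right r. False" by eventually_elim simp
    then show False by simp
  qed
  \<comment> \<open>f may vanish at \<open>v r\<close>, so v'' need not decide. To the left of r the
    flux is nondecreasing and reaches 0 at r, so v' cannot be positive there.\<close>
  have 3: "\<not> (0 < v r \<and> v r < b)"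
  proof
    assume v: "0 < v r \<and> v r < b"
    have "\<forall>\<^sub>F x in at r. 0 < v x" "\<forall>\<^sub>F x in at r. v x < b"
      using v order_tendstoD[OF isContD[OF v_isCont[OF r]]] by blast+
    then have "\<forall>\<^sub>F x in at_left r. 0 \<le> v x \<and> v x \<le> b"
      unfolding eventually_at_split by (auto elim: eventually_elim2 intro: less_imp_le)
    moreover have "\<forall>\<^sub>F x in at_left r. 0 < x" using eventually_at_left_field r by blast
    ultimately have "\<forall>\<^sub>F x in at_left r. 0 < x \<and> 0 < v' x \<and> 0 \<le> v x \<and> v x \<le> b"
      using u(2) by eventually_elim simp
    then obtain c where c: "c < r" "\<And>x. c < x \<Longrightarrow> x < r \<Longrightarrow> 0 < x \<and> 0 < v' x \<and> 0 \<le> v x \<and> v x \<le> b"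
      unfolding eventually_at_left_field by blast
    define x where "x = (c + r) / 2"
    have x: "c < x" "x < r" using c by (auto simp: x_def)
    then have "0 < x" "0 < v' x" using c(2)[of x] by auto
    moreover have "g x \<le> g r"
    proof (rule g_mono)
      fix y assume "x \<le> y" "y \<le> r"
      then show "0 \<le> v y \<and> v y \<le> b" using c(2)[of y] x v by (cases "y = r") auto
    qed (use \<open>0 < x\<close> x in auto)
    ultimately show False using g_sgn[of x] g_sgn[OF r] u(1) by auto
  qed
  show ?thesis using 1 2 3 critical_ne_b[OF r u(1)] by (auto simp: abs_if split: if_splits)
qed

lemma down_cross_Jcal_imp: assumes "0 < r" and "down_cross (Jcal v) 0 r"
  shows "v r < - b \<or> 0 < v r \<and> v r < b"
proof -
  interpret neg: radial_ode f b \<beta> N "\<lambda>r. - v r" "- a" by (rule neg)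
  show ?thesis using neg.up_cross_Jcal_imp[of r] assms by (auto simp: up_cross_Jcal_neg)
qed

lemma up_cross_v_imp: assumes "0 < r" "up_cross v c r" shows "v r = c" "0 \<le> v' r"
proof -
  show "v r = c" using assms by (simp add: up_cross_def)
  show "0 \<le> v' r"
  proof (rule ccontr)
    assume "\<not> 0 \<le> v' r"
    then have "\<forall>\<^sub>F x in at_right r. v x < v r" using deriv_neg_eventually(2)[OF v_deriv[OF assms(1)]] by simp
    moreover have "\<forall>\<^sub>F x in at_right r. c < v x" using assms by (simp add: up_cross_def)
    ultimately have "\<forall>\<^sub>F x in at_right r. False" by eventually_elim (use \<open>v r = c\<close> in simp)
    then show False by simp
  qed
qed

lemma down_cross_v_imp: assumes "0 < r" "down_cross v c r" shows "v r = c" "v' r \<le> 0"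
proof -
  show "v r = c" using assms by (simp add: down_cross_def)
  show "v' r \<le> 0"
  proof (rule ccontr)
    assume "\<not> v' r \<le> 0"
    then have "\<forall>\<^sub>F x in at_right r. v r < v x" using deriv_pos_eventually(2)[OF v_deriv[OF assms(1)]] by simp
    moreover have "\<forall>\<^sub>F x in at_right r. v x < c" using assms by (simp add: down_cross_def)
    ultimately have "\<forall>\<^sub>F x in at_right r. False" by eventually_elim (use \<open>v r = c\<close> in simp)
    then show False by simp
  qed
qed

text \<open>A double zero is followed by rest at 0 and so is never a sign change; at any other zero
  the slope decides.\<close>

lemma zero_crossing_iff: "r \<in> zero_crossings v \<longleftrightarrow> 0 < r \<and> v r = 0 \<and> v' r \<noteq> 0"
proof (cases "0 < r")
  case r: True
  have "v r = 0 \<and> v' r \<noteq> 0" if c: "up_cross v 0 r \<or> down_cross v 0 r"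
  proof (intro conjI notI)
    show v: "v r = 0" using c by (auto simp: up_cross_def down_cross_def)
    assume "v' r = 0"
    then have "\<forall>\<^sub>F x in at_right r. v x = 0"
      using double_zero[OF r v] eventually_at_right_less[of r] by (auto elim!: eventually_mono)
    moreover have "\<forall>\<^sub>F x in at_right r. v x \<noteq> 0"
      using c by (auto simp: up_cross_def down_cross_def elim!: eventually_mono)
    ultimately have "\<forall>\<^sub>F x in at_right r. False" by eventually_elim simp
    then show False by simp
  qed
  moreover have "up_cross v 0 r \<or> down_cross v 0 r" if "v r = 0" "v' r \<noteq> 0"
  proof (cases "0 < v' r")
    case True
    then show ?thesis using deriv_pos_eventually[OF v_deriv[OF r]] that by (simp add: up_cross_def)
  next
    case False
    then show ?thesis using deriv_neg_eventually[OF v_deriv[OF r]] that by (simp add: down_cross_def)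
  qed
  ultimately show ?thesis using r by (auto simp: zero_crossings_def)
qed (simp add: zero_crossings_def)

lemma zero_crossings_neg: "zero_crossings (\<lambda>r. - v r) = zero_crossings v"
proof -
  interpret neg: radial_ode f b \<beta> N "\<lambda>r. - v r" "- a" by (rule neg)
  show ?thesis using neg.zero_crossing_iff zero_crossing_iff by (auto simp: deriv_neg)
qed

lemma axis_crossings_neg: "axis_crossings (\<lambda>r. - v r) = axis_crossings v"
  unfolding axis_crossings_def using up_cross_Jcal_neg by blast

lemma axis_crossing_critical: "r \<in> axis_crossings v \<Longrightarrow> 0 < r \<and> v' r = 0"
  by (auto simp: axis_crossings_def up_cross_Jcal_iff down_cross_Jcal_iff)

subsection \<open>The spiral\<close>

lemma moves_counterclockwise_v: "moves_counterclockwise v"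
  unfolding moves_counterclockwise_def
proof (intro allI impI conjI; elim conjE)
  fix p q :: real assume pq: "0 \<le> p" "p < q"
  have c: "continuous_on {p..q} v" using v_cont by (rule continuous_on_subset) (use pq in auto)
  show "v q < v p" if J: "\<forall>r\<in>{p<..<q}. 0 < Jcal v r"
  proof (rule DERIV_neg_imp_decreasing_open[OF pq(2) _ c])
    fix x assume x: "p < x" "x < q"
    then have "0 < - v' x / x" using bspec[OF J, of x] Jcal_pos[of x] pq by simp
    then have "v' x < 0" using x pq by (auto simp: divide_less_0_iff)
    then show "\<exists>y. (v has_real_derivative y) (at x) \<and> y < 0" using v_deriv[of x] x pq by auto
  qed
  show "v p < v q" if J: "\<forall>r\<in>{p<..<q}. Jcal v r < 0"
  proof (rule DERIV_pos_imp_increasing_open[OF pq(2) _ c])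
    fix x assume x: "p < x" "x < q"
    then have "- v' x / x < 0" using bspec[OF J, of x] Jcal_pos[of x] pq by simp
    then have "0 < v' x" using x pq by (auto simp: zero_less_divide_iff)
    then show "\<exists>y. (v has_real_derivative y) (at x) \<and> 0 < y" using v_deriv[of x] x pq by auto
  qed
qed

text \<open>The energy drops strictly just after p, so F (v q) < F (v p) at all later times. If v p
  > b, this bounds |v q|. If -b < v p < 0, the energy is negative and v cannot return to 0; as F
  grows weakly from -b towards 0, only v q < v p is left.\<close>

lemma up_cross_Jcal_later: assumes p: "0 < p" "p < q" and u: "up_cross (Jcal v) 0 p"
  shows "v q < v p"
proof -
  have u': "v' p = 0" "\<forall>\<^sub>F x in at_right p. v' x < 0"
    using u p by (auto simp: up_cross_Jcal_iff)
  then obtain c where c: "p < c" "\<And>x. p < x \<Longrightarrow> x < c \<Longrightarrow> v' x < 0"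
    unfolding eventually_at_right_field by blast
  have Elt: "E y < E p" if "p < y" for y
  proof -
    define x where "x = (p + min c y) / 2"
    have x: "p < x" "x \<le> y" "x < c" using that c by (auto simp: x_def min_def)
    show ?thesis by (rule E_strict[of p x]) (use that x p c(2)[of x] in auto)
  qed
  have Flt: "F (v y) < F (v p)" if "p < y" for y
    using Elt[OF that] F_le_E[of y] E_critical[OF u'(1)] by simp
  consider "b < v p" | "- b < v p" "v p < 0" using up_cross_Jcal_imp[OF p(1) u] by blast
  then show ?thesis
  proof cases
    case 1
    then have "\<bar>v q\<bar> < \<bar>v p\<bar>" using F_less_imp_abs[OF _ Flt[OF p(2)]] by simp
    then show ?thesis using 1 b_pos by simp
  next
    case 2
    have F0: "F (v p) < 0" using 2 F_neg[of "v p"] b_less_beta by simp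
    have "v q < 0"
    proof (rule ccontr)
      assume "\<not> v q < 0"
      then obtain y where "p \<le> y" "y \<le> q" "v y = 0"
        using IVT'[of v p 0 q] 2 p continuous_on_subset[OF v_cont, of "{p..q}"] by auto
      then show False using Flt[of y] F0 2 by (cases "y = p") auto
    qed
    then have "v p \<le> v q \<Longrightarrow> F (v p) \<le> F (v q)" using F_antimono[of "- v q" "- v p"] 2 by simp
    then show ?thesis using Flt[OF p(2)] by linarith
  qed
qed

lemma down_cross_Jcal_later: assumes "0 < p" "p < q" and "down_cross (Jcal v) 0 p"
  shows "v p < v q"
proof -
  interpret neg: radial_ode f b \<beta> N "\<lambda>r. - v r" "- a" by (rule neg)
  show ?thesis using neg.up_cross_Jcal_later[OF assms(1,2)] assms by (auto simp: up_cross_Jcal_neg)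
qed

text \<open>Equal heights give |v' q| \<le> |v' p|, and division by the larger radius makes this
  strict. If v' p = 0, the energy is constant on [p,q] and the curve rests. The initial height is
  never met again.\<close>

lemma return_closer: assumes "0 \<le> p" "p < q" "v p = v q"
  shows "\<bar>Jcal v q\<bar> < \<bar>Jcal v p\<bar> \<or> (\<forall>r\<in>{p..q}. curve v r = curve v p)"
proof (cases "p = 0")
  case True
  then show ?thesis using abs_v_less[of q] assms v_0 by auto
next
  case False
  then have p: "0 < p" using assms by simp
  have E: "E q \<le> E p" using E_antimono p assms by simp
  then have "\<bar>v' q\<bar> \<le> \<bar>v' p\<bar>" unfolding E_def using assms by (simp add: abs_le_square_iff)
  show ?thesis
  proof (cases "v' p = 0")
    case True
    then have "E q = E p" using E \<open>\<bar>v' q\<bar> \<le> \<bar>v' p\<bar>\<close> assms by (simp add: E_def)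
    have "curve v r = curve v p" if r: "r \<in> {p..q}" for r
    proof -
      have "v' r = 0" "v r = v p"
        using E_const_imp_rest[OF p assms(2) \<open>E q = E p\<close>, of r] r by auto
      then show ?thesis using p r True by (simp add: curve_def Jcal_pos)
    qed
    then show ?thesis by blast
  next
    case False
    have "\<bar>v' q\<bar> / q \<le> \<bar>v' p\<bar> / q" using \<open>\<bar>v' q\<bar> \<le> \<bar>v' p\<bar>\<close> p assms by (simp add: divide_right_mono)
    also have "\<dots> < \<bar>v' p\<bar> / p" using False p assms by (simp add: divide_strict_left_mono)
    finally show ?thesis using p assms by (simp add: Jcal_pos abs_divide)
  qed
qed

lemma winds_inwards_v: assumes "0 < a" shows "winds_inwards v"
  unfolding winds_inwards_def
  using return_closer up_cross_Jcal_later down_cross_Jcal_later abs_v_less v_0 assms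
  by (auto simp: abs_less_iff)

lemma no_self_intersection_v: "no_self_intersection v"
  unfolding no_self_intersection_def
proof (intro allI impI; elim conjE)
  fix p q assume pq: "0 \<le> p" "p < q" "curve v p = curve v q"
  then have "v p = v q" "Jcal v p = Jcal v q" by (simp_all add: curve_def)
  then show "\<forall>r\<in>{p..q}. curve v r = curve v p"
    using return_closer[OF pq(1,2)] by (metis less_irrefl)
qed

subsection \<open>Monotone branches\<close>

lemma monotone_branch_mono:
  assumes "is_interval I" "I \<subseteq> {0<..}" "monotone_branch v I"
  shows "(\<forall>p\<in>I. \<forall>q\<in>I. p < q \<longrightarrow> v q < v p) \<or> (\<forall>p\<in>I. \<forall>q\<in>I. p < q \<longrightarrow> v p < v q)"
proof -
  have sub: "x \<in> I" if "p \<in> I" "q \<in> I" "p \<le> x" "x \<le> q" for p q x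
    using assms(1) that unfolding is_interval_1 by blast
  have c: "continuous_on {p..q} v" if "p \<in> I" for p q
    using v_cont by (rule continuous_on_subset) (use that assms in auto)
  consider "\<forall>r\<in>I. v' r < 0" | "\<forall>r\<in>I. 0 < v' r" using assms(3) unfolding monotone_branch_def by blast
  then show ?thesis
  proof cases
    case 1
    have "v q < v p" if "p \<in> I" "q \<in> I" "p < q" for p q
    proof (rule DERIV_neg_imp_decreasing_open[OF that(3) _ c[OF that(1)]])
      fix x assume "p < x" "x < q"
      then have "x \<in> I" using sub[OF that(1,2), of x] by simp
      then show "\<exists>y. (v has_real_derivative y) (at x) \<and> y < 0" using v_deriv[of x] 1 assms(2) by auto
    qed
    then show ?thesis by blast
  next
    case 2
    have "v p < v q" if "p \<in> I" "q \<in> I" "p < q" for p q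
    proof (rule DERIV_pos_imp_increasing_open[OF that(3) _ c[OF that(1)]])
      fix x assume "p < x" "x < q"
      then have "x \<in> I" using sub[OF that(1,2), of x] by simp
      then show "\<exists>y. (v has_real_derivative y) (at x) \<and> 0 < y" using v_deriv[of x] 2 assms(2) by auto
    qed
    then show ?thesis by blast
  qed
qed

text \<open>The inverse function theorem gives r'(s) = 1/v'(r), so -1/(r r') is -v'/r.\<close>

lemma J_branch_eq:
  assumes I: "is_interval I" "open I" "I \<subseteq> {0<..}" "monotone_branch v I" and r: "r \<in> I"
  shows "J_branch v I (v r) = Jcal v r"
proof -
  have inj: "inj_on v I"
  proof (rule linorder_inj_onI')
    show "v p \<noteq> v q" if "p \<in> I" "q \<in> I" "p < q" for p q
      using monotone_branch_mono[OF I(1,3,4)] that by fastforce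
  qed
  have inv: "inv_into I v (v x) = x" if "x \<in> I" for x using inv_into_f_f[OF inj that] .
  have r0: "0 < r" using I r by auto
  have "v' r \<noteq> 0" using I(4) r unfolding monotone_branch_def by fastforce
  have "(inv_into I v has_field_derivative inverse (v' r)) (at (v r))"
    unfolding has_field_derivative_def
  proof (rule has_derivative_inverse_strong[OF I(2) r, of v "inv_into I v"])
    show "continuous_on I v" using v_cont by (rule continuous_on_subset) (use I in auto)
    show "\<And>x. x \<in> I \<Longrightarrow> inv_into I v (v x) = x" by (rule inv)
    show "(v has_derivative (*) (v' r)) (at r)" using v_deriv[OF r0] by (simp add: has_field_derivative_def)
    show "(*) (v' r) \<circ> (*) (inverse (v' r)) = id" using \<open>v' r \<noteq> 0\<close> by (auto simp: o_def)
  qed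
  then have "deriv (inv_into I v) (v r) = inverse (v' r)" by (rule DERIV_imp_deriv)
  then show ?thesis unfolding J_branch_def inv[OF r] using r0 by (simp add: Jcal_pos field_simps)
qed

lemma curve_eq_graph:
  assumes "is_interval I" "open I" "I \<subseteq> {0<..}" "monotone_branch v I"
  shows "curve v ` I = (\<lambda>s. (s, J_branch v I s)) ` (v ` I)"
  using J_branch_eq[OF assms] by (simp add: curve_def[abs_def] image_image)

text \<open>\<open>J_ends_at\<close> takes a limit in s, whereas v' is known to tend to 0 in time.
  The translation works because |v - c| decreases strictly along the last branch: points of the
  graph near c come from late times.\<close>

lemma J_ends_atI:
  assumes R: "0 \<le> R" "ereal R < Z" and mono: "monotone_branch v {r. R < r \<and> ereal r < Z}"
    and rest: "\<And>r. Z \<le> ereal r \<Longrightarrow> v r = c \<and> v' r = 0"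
    and lim: "(v \<longlongrightarrow> c) at_top" and vZ: "Z \<noteq> \<infinity> \<Longrightarrow> Z = ereal z"
    and v'0: "(v' \<longlongrightarrow> 0) at_top"
  shows "J_ends_at v c"
proof -
  define I where "I = {r. R < r \<and> ereal r < Z}"
  have pos: "0 < r" if "r \<in> I \<or> Z \<le> ereal r" for r
    using that R unfolding I_def by (auto dest: less_le_trans)
  have I: "is_interval I" "open I" "I \<subseteq> {0<..}" "monotone_branch v I"
  proof -
    have e: "I = ereal -` {ereal R<..<Z}" by (auto simp: I_def)
    show "open I" unfolding e by (intro open_vimage) (auto intro: continuous_on_ereal continuous_intros)
    show "is_interval I" unfolding is_interval_1 I_def
      by (auto intro: le_less_trans[of "ereal _" "ereal _"])
    show "I \<subseteq> {0<..}" using pos by auto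
  qed (use mono I_def in simp)
  have J: "\<exists>r0\<in>I. \<forall>r\<in>I. r0 < r \<longrightarrow> \<bar>Jcal v r\<bar> < e" if e: "0 < e" for e
  proof (cases "Z = \<infinity>")
    case True
    have "((\<lambda>r. - v' r / r) \<longlongrightarrow> 0) at_top"
      using tendsto_divide_0[OF tendsto_minus[OF v'0] filterlim_at_top_imp_at_infinity[OF filterlim_ident]] by simp
    from tendstoD[OF this e] obtain M where M: "\<And>r. M \<le> r \<Longrightarrow> \<bar>- v' r / r\<bar> < e"
      unfolding eventually_at_top_linorder dist_real_def by auto
    show ?thesis
    proof (intro bexI[of _ "max M R + 1"] ballI impI)
      fix r assume "r \<in> I" "max M R + 1 < r"
      then show "\<bar>Jcal v r\<bar> < e" using M[of r] pos[of r] by (simp add: Jcal_pos)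
    qed (use True I_def in auto)
  next
    case False
    then have Z: "Z = ereal z" "R < z" using vZ R by auto
    have z: "0 < z" "v' z = 0" using pos[of z] rest[of z] Z by auto
    have "isCont (\<lambda>r. - v' r / r) z" using z by (intro continuous_intros v'_isCont) auto
    then have "((\<lambda>r. - v' r / r) \<longlongrightarrow> 0) (at_left z)"
      using z by (auto simp: isCont_def intro: tendsto_within_subset)
    from tendstoD[OF this e] have "\<forall>\<^sub>F r in at_left z. \<bar>- v' r / r\<bar> < e"
      by (simp add: dist_real_def)
    then obtain M where M: "M < z" "\<And>r. M < r \<Longrightarrow> r < z \<Longrightarrow> \<bar>- v' r / r\<bar> < e"
      unfolding eventually_at_left_field by blast
    show ?thesis
    proof (intro bexI[of _ "(max M R + z) / 2"] ballI impI)
      fix r assume "r \<in> I" "(max M R + z) / 2 < r"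
      then show "\<bar>Jcal v r\<bar> < e" using M(1) M(2)[of r] pos[of r] Z by (auto simp: Jcal_pos I_def max_def split: if_splits)
    qed (use M Z I_def in auto)
  qed
  \<comment> \<open>\<open>G\<close> is the approach to the end of the branch: \<open>at_top\<close>
    if Z is infinite, the left neighbourhoods of z otherwise. The monotonicity argument is then the
    same in both cases.\<close>
  obtain G where G: "G \<noteq> bot" "(v \<longlongrightarrow> c) G" "\<And>r1. r1 \<in> I \<Longrightarrow> \<forall>\<^sub>F x in G. r1 < x \<and> x \<in> I"
  proof (cases "Z = \<infinity>")
    case True
    show ?thesis
    proof (rule that[OF _ lim])
      fix r1 assume r1: "r1 \<in> I"
      show "\<forall>\<^sub>F x in at_top. r1 < x \<and> x \<in> I"
        using eventually_gt_at_top[of r1] by eventually_elim (use r1 in \<open>auto simp: I_def True\<close>)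
    qed simp
  next
    case False
    then have Z: "Z = ereal z" "R < z" using vZ R by auto
    have z: "0 < z" "v z = c" using pos[of z] rest[of z] Z by auto
    show ?thesis
    proof (rule that[of "at_left z"])
      show "(v \<longlongrightarrow> c) (at_left z)"
        using v_isCont[OF z(1)] z(2) by (auto simp: isCont_def intro: tendsto_within_subset)
      fix r1 assume "r1 \<in> I"
      then show "\<forall>\<^sub>F x in at_left z. r1 < x \<and> x \<in> I"
        unfolding eventually_at_left_field by (intro exI[of _ r1]) (auto simp: I_def Z)
    qed simp
  qed
  have later: "\<exists>r1\<in>I. r < r1" if rI: "r \<in> I" for r
  proof -
    obtain y where "ereal r < y" "y < Z" using rI dense[of "ereal r" Z] unfolding I_def by blast
    then show ?thesis using rI by (cases y) (auto simp: I_def intro!: exI[of _ "real_of_ereal y"])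
  qed
  have beyond: "\<bar>v r - c\<bar> < \<bar>v r0 - c\<bar>" if rr: "r \<in> I" "r0 \<in> I" "r0 < r" for r r0
  proof -
    obtain r1 where r1: "r1 \<in> I" "r < r1" using later rr by blast
    consider "\<forall>p\<in>I. \<forall>q\<in>I. p < q \<longrightarrow> v q < v p" | "\<forall>p\<in>I. \<forall>q\<in>I. p < q \<longrightarrow> v p < v q"
      using monotone_branch_mono[OF I(1,3,4)] by blast
    then show ?thesis
    proof cases
      case 1
      have "c \<le> v r1"
        by (rule tendsto_upperbound[OF G(2) _ G(1)], rule eventually_mono[OF G(3)[OF r1(1)]])
          (use 1 r1(1) in \<open>auto intro: less_imp_le\<close>)
      moreover have "v r < v r0" "v r1 < v r" using 1 rr r1 by blast+
      ultimately show ?thesis by linarith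
    next
      case 2
      have "v r1 \<le> c"
        by (rule tendsto_lowerbound[OF G(2) _ G(1)], rule eventually_mono[OF G(3)[OF r1(1)]])
          (use 2 r1(1) in \<open>auto intro: less_imp_le\<close>)
      moreover have "v r0 < v r" "v r < v r1" using 2 rr r1 by blast+
      ultimately show ?thesis by linarith
    qed
  qed
  have "(J_branch v I \<longlongrightarrow> 0) (at c within v ` I)"
  proof (rule tendstoI)
    fix e :: real assume "0 < e"
    then obtain r0 where r0: "r0 \<in> I" "\<And>r. r \<in> I \<Longrightarrow> r0 < r \<Longrightarrow> \<bar>Jcal v r\<bar> < e" using J by blast
    obtain r1 where r1: "r1 \<in> I" "r0 < r1" using later r0(1) by blast
    \<comment> \<open>This distance serves as the radius of the neighbourhood of c. It is positive
      because v comes strictly closer to c after \<open>r1\<close>.\<close>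
    have "0 < \<bar>v r1 - c\<bar>"
    proof -
      obtain r2 where "r2 \<in> I" "r1 < r2" using later r1(1) by blast
      then show ?thesis using beyond[of r2 r1] r1 by linarith
    qed
    moreover have "dist (J_branch v I s) 0 < e" if s: "s \<in> v ` I" "dist s c < \<bar>v r1 - c\<bar>" for s
    proof -
      obtain r where r: "r \<in> I" "s = v r" using s by blast
      have "r1 < r"
      proof (rule ccontr)
        assume "\<not> r1 < r"
        then consider "r < r1" | "r = r1" by linarith
        then show False using beyond[of r1 r] r r1 s by cases (auto simp: dist_real_def)
      qed
      then show ?thesis using r0(2)[of r] r r1 J_branch_eq[OF I r(1)] by (simp add: dist_real_def)
    qed
    ultimately show "\<forall>\<^sub>F s in at c within v ` I. dist (J_branch v I s) 0 < e"
      unfolding eventually_at by blast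
  qed
  moreover have "curve v r = (c, 0)" if "Z \<le> ereal r" for r
    using rest[OF that] pos[of r] that by (simp add: curve_def Jcal_pos)
  ultimately show ?thesis
    unfolding J_ends_at_def Let_def using R mono lim I_def by blast
qed

end

text \<open>The square removes the kink of the positive part. A cut-off of v built from it can be
  differentiated along the solution without exceptional times.\<close>

lemma DERIV_max_zero_square: "((\<lambda>x::real. (max 0 x)\<^sup>2) has_real_derivative 2 * max 0 x) (at x)"
proof -
  consider "0 < x" | "x < 0" | "x = 0" by linarith
  then show ?thesis
  proof cases
    case 1
    have "((\<lambda>x::real. x\<^sup>2) has_real_derivative 2 * max 0 x) (at x)"
      using 1 by (auto intro!: derivative_eq_intros)
    then show ?thesis
      by (rule has_field_derivative_transform_within_open[of _ _ _ "{0<..}"]) (use 1 in auto)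
  next
    case 2
    have "((\<lambda>x::real. 0) has_real_derivative 2 * max 0 x) (at x)" using 2 by simp
    then show ?thesis
      by (rule has_field_derivative_transform_within_open[of _ _ _ "{..<0}"]) (use 2 in auto)
  next
    case 3
    have "((\<lambda>y::real. ((max 0 y)\<^sup>2 - (max 0 0)\<^sup>2) / (y - 0)) \<longlongrightarrow> 0) (at 0)"
    proof (rule Lim_null_comparison)
      show "\<forall>\<^sub>F y::real in at 0. norm (((max 0 y)\<^sup>2 - (max 0 0)\<^sup>2) / (y - 0)) \<le> \<bar>y\<bar>"
        by (rule always_eventually) (auto simp: max_def power2_eq_square abs_mult)
    qed (auto intro!: tendsto_eq_intros)
    then show ?thesis using 3 by (simp add: has_field_derivative_iff)
  qed
qed

lemma infinite_bounded_reals_islimpt: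
  fixes A :: "real set"
  assumes "infinite A" "A \<subseteq> {0..R}"
  obtains x where "x \<in> {0..R}" "x islimpt A"
  using assms compact_eq_Bolzano_Weierstrass[of "{0..R}"] by auto

context radial_ode
begin

subsection \<open>Limits\<close>

lemma E_converges: obtains L where "(E \<longlongrightarrow> L) at_top" "\<And>r. 0 < r \<Longrightarrow> L \<le> E r" "F b \<le> L"
proof (rule antimono_bounded_below_convergent[of 1 E "F b"])
  show "E s \<le> E r" if "1 \<le> r" "r \<le> s" for r s using E_antimono[of r s] that by simp
  show "F b \<le> E r" if "1 \<le> r" for r using E_gt_Fb[of r] that by simp
  fix l assume l: "(E \<longlongrightarrow> l) at_top" "\<And>r. 1 \<le> r \<Longrightarrow> l \<le> E r" "F b \<le> l"
  have "l \<le> E r" if "0 < r" for r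
    using l(2)[of "max 1 r"] E_antimono[of r "max 1 r"] that by simp
  with l that show thesis by blast
qed

text \<open>E and F(v) converge, hence so does |v'|, and its limit can only be 0. Then v'' tends to
  -f(l), and the same argument applied to v' gives f(l) = 0.\<close>

lemma limit_imp:
  assumes v: "(v \<longlongrightarrow> l) at_top"
  shows "(v' \<longlongrightarrow> 0) at_top" "f l = 0" "(E \<longlongrightarrow> F l) at_top"
proof -
  obtain L where L: "(E \<longlongrightarrow> L) at_top" by (rule E_converges)
  have Fv: "((\<lambda>r. F (v r)) \<longlongrightarrow> F l) at_top"
    by (rule isCont_tendsto_compose[OF DERIV_isCont[OF F_deriv] v])
  have "((\<lambda>r. sqrt (2 * (E r - F (v r)))) \<longlongrightarrow> sqrt (2 * (L - F l))) at_top"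
    by (intro tendsto_intros L Fv)
  then have lim: "((\<lambda>r. \<bar>v' r\<bar>) \<longlongrightarrow> sqrt (2 * (L - F l))) at_top" by (simp add: E_def)
  have "sqrt (2 * (L - F l)) = 0"
    by (rule deriv_limit_zero_subseq[OF v_deriv v lim, of 1]) simp
  with lim show v'0: "(v' \<longlongrightarrow> 0) at_top" by (simp add: tendsto_rabs_zero_iff)
  have "((\<lambda>r. (v' r)\<^sup>2 / 2 + F (v r)) \<longlongrightarrow> 0\<^sup>2 / 2 + F l) at_top" by (intro tendsto_intros v'0 Fv) simp
  then show "(E \<longlongrightarrow> F l) at_top" by (simp add: E_def[abs_def])
  have "((\<lambda>r. v' r / r) \<longlongrightarrow> 0) at_top"
    by (rule tendsto_divide_0[OF v'0 filterlim_at_top_imp_at_infinity[OF filterlim_ident]])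
  then have "((\<lambda>r. \<bar>- ((N - 1) * (v' r / r)) - f (v r)\<bar>) \<longlongrightarrow> \<bar>- ((N - 1) * 0) - f l\<bar>) at_top"
    by (intro tendsto_intros isCont_tendsto_compose[OF f_isCont v])
  then have "((\<lambda>r. \<bar>- (N - 1) / r * v' r - f (v r)\<bar>) \<longlongrightarrow> \<bar>f l\<bar>) at_top"
    by (simp add: diff_divide_distrib algebra_simps)
  from deriv_limit_zero_subseq[OF v'_deriv v'0 this, of 1] show "f l = 0" by simp
qed

lemma abs_limit_le_b: assumes "(v \<longlongrightarrow> l) at_top" shows "\<bar>l\<bar> \<le> b"
  using limit_imp(2)[OF assms] f_pos[of l] f_pos[of "- l"] by (auto simp: abs_if not_less[symmetric])

section \<open>Lyapunov functions and finiteness of the sign changes\<close>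

lemma virial_contradiction:
  assumes R: "0 < R" and E: "\<And>r. R \<le> r \<Longrightarrow> L \<le> E r" and S: "compact S" "\<And>r. R \<le> r \<Longrightarrow> v r \<in> S"
    and pos: "\<And>s. s \<in> S \<Longrightarrow> L \<le> F s \<Longrightarrow> 0 < (s - c) * f s"
  shows False
proof -
  \<comment> \<open>Where F(v) < L, the bound E \<ge> L gives v'^2 \<ge> 2 (L - F(v)), so K v'^2
    dominates the penalty term. Where F(v) \<ge> L, the assumption makes (v - c) f(v)
    positive.\<close>
  obtain K d where K: "K \<ge> 0" "d > 0" "\<And>s. s \<in> S \<Longrightarrow> d \<le> K * max 0 (2 * (L - F s)) + (s - c) * f s"
  proof (rule compact_penalty[OF S(1)])
    show "continuous_on S (\<lambda>s. max 0 (2 * (L - F s)))" by (intro continuous_intros F_cont)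
    show "continuous_on S (\<lambda>s. (s - c) * f s)"
      by (intro continuous_intros continuous_on_subset[OF f_cont]) auto
    show "0 < (s - c) * f s" if "s \<in> S" "max 0 (2 * (L - F s)) = 0" for s
      using pos[of s] that by (auto simp: max_def split: if_splits)
  qed auto
  define M where "M = sqrt (2 * (F a - F b))"
  define B where "B = (\<bar>a\<bar> + \<bar>c\<bar>) * M"
  have M: "0 \<le> M" using v'_bounded[of 1] unfolding M_def by linarith
  have B: "\<bar>(v r - c) * v' r\<bar> \<le> B" if "0 < r" for r
    unfolding abs_mult B_def M_def
    using abs_v_less[OF that] v'_bounded[OF that] by (intro mult_mono) auto
  have B0: "0 \<le> B" using B[of 1] by linarith
  \<comment> \<open>From \<open>R1\<close> on the remainder N (v - c) v' / r is at most d/2 in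
    modulus; the logarithm in \<open>h\<close> uses up the other half of d.\<close>
  define R1 where "R1 = max R (2 * N * B / d)"
  have R1: "0 < R1" "R \<le> R1" using R by (auto simp: R1_def)
  \<comment> \<open>The 1 in K + 1 cancels the term (N-1) v'^2 / r produced by differentiating the
    second summand; K pays the penalty.\<close>
  define h where "h r = (K + 1) * E r + (N - 1) * ((v r - c) * v' r / r) + (N - 1) * d / 2 * ln r" for r
  have hd: "\<exists>y. (h has_real_derivative y) (at r) \<and> y \<le> 0" if r: "R1 \<le> r" for r
  proof -
    have r0: "0 < r" using r R1 by simp
    have "2 * N * B / d \<le> r" using r by (simp add: R1_def)
    then have "N * B / r \<le> d / 2" using K(2) r0 by (simp add: field_simps)
    moreover have "- ((v r - c) * v' r) / r * N \<le> B / r * N"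
      using B[OF r0] r0 N by (intro mult_right_mono divide_right_mono) auto
    moreover have "- (N * ((v r - c) * v' r) / r) = - ((v r - c) * v' r) / r * N" "N * B / r = B / r * N" by simp_all
    ultimately have 1: "- (N * ((v r - c) * v' r) / r) \<le> d / 2" by linarith
    have "v' r ^ 2 \<ge> max 0 (2 * (L - F (v r)))"
      using E[of r] r R1 by (simp add: E_def)
    then have "K * max 0 (2 * (L - F (v r))) \<le> K * v' r ^ 2" using K(1) by (rule mult_left_mono)
    then have 2: "d \<le> K * v' r ^ 2 + (v r - c) * f (v r)" using K(3)[OF S(2), of r] r R1 by simp
    have "(h has_real_derivative (K + 1) * - ((N - 1) / r * (v' r)\<^sup>2)
        + (N - 1) * ((((v' r - 0) * v' r + (- (N - 1) / r * v' r - f (v r)) * (v r - c)) * r - (v r - c) * v' r * 1) / (r * r))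
        + (N - 1) * d / 2 * (1 / r)) (at r)"
      unfolding h_def[abs_def]
      by (intro DERIV_add DERIV_cmult DERIV_divide DERIV_mult E_deriv DERIV_diff v_deriv v'_deriv DERIV_const
          DERIV_ident DERIV_ln_divide r0) (use r0 in simp)
    moreover have "(K + 1) * - ((N - 1) / r * (v' r)\<^sup>2)
        + (N - 1) * ((((v' r - 0) * v' r + (- (N - 1) / r * v' r - f (v r)) * (v r - c)) * r - (v r - c) * v' r * 1) / (r * r))
        + (N - 1) * d / 2 * (1 / r)
      = (N - 1) / r * (- (K * v' r ^ 2 + (v r - c) * f (v r)) + - (N * ((v r - c) * v' r) / r) + d / 2)"
      using r0 by (simp add: field_simps power2_eq_square)
    moreover have "\<dots> \<le> 0"
    proof (rule mult_nonneg_nonpos)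
      show "0 \<le> (N - 1) / r" using r0 N by simp
    qed (use 1 2 in linarith)
    ultimately show ?thesis by auto
  qed
  have mono: "h r \<le> h R1" if "R1 \<le> r" for r
    by (rule DERIV_nonpos_imp_nonincreasing[OF that hd])
  define C where "C = (K + 1) * F b - (N - 1) * (B / R1)"
  have low: "C + (N - 1) * d / 2 * ln r \<le> h r" if r: "R1 \<le> r" for r
  proof -
    have r0: "0 < r" using r R1 by simp
    have "(K + 1) * F b \<le> (K + 1) * E r" using E_gt_Fb[OF r0] K(1) by (intro mult_left_mono) auto
    moreover have "- (B / R1) \<le> (v r - c) * v' r / r"
    proof -
      have "- ((v r - c) * v' r) / r \<le> B / r" using B[OF r0] r0 by (intro divide_right_mono) auto
      also have "\<dots> \<le> B / R1" using r R1 B0 by (intro divide_left_mono) auto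
      finally show ?thesis by simp
    qed
    then have "(N - 1) * - (B / R1) \<le> (N - 1) * ((v r - c) * v' r / r)"
      using N by (intro mult_left_mono) auto
    ultimately show ?thesis unfolding C_def h_def by linarith
  qed
  define c1 where "c1 = (N - 1) * d / 2"
  have c1: "0 < c1" using K N by (simp add: c1_def)
  have "\<forall>\<^sub>F r in at_top. (h R1 - C) / c1 < ln r"
    using ln_at_top by (simp add: filterlim_at_top_dense)
  then have "\<forall>\<^sub>F r in at_top. (h R1 - C) / c1 < ln r \<and> R1 \<le> r"
    by (rule eventually_conj) (rule eventually_ge_at_top)
  then obtain r where r: "(h R1 - C) / c1 < ln r" "R1 \<le> r" by (auto simp: eventually_at_top_linorder)
  then have "h R1 - C < c1 * ln r" using c1 by (simp add: field_simps)
  then show False using mono[OF r(2)] low[OF r(2)] unfolding c1_def by linarith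
qed

text \<open>The critical point comes from Rolle's theorem. Its energy is at least that of the later
  simple zero q, hence positive, which forces a height of at least \<beta>.\<close>

lemma critical_between_zero_crossings:
  assumes "p \<in> zero_crossings v" "q \<in> zero_crossings v" "p < q"
  obtains x where "p < x" "x < q" "v' x = 0" "\<beta> \<le> \<bar>v x\<bar>"
proof -
  have pq: "0 < p" "v p = 0" "0 < q" "v q = 0" "v' q \<noteq> 0" using assms zero_crossing_iff by auto
  have "\<exists>x. p < x \<and> x < q \<and> (v has_real_derivative 0) (at x)"
  proof (rule Rolle[OF assms(3)])
    show "continuous_on {p..q} v" using v_cont by (rule continuous_on_subset) (use pq in auto)
    show "v differentiable at x" if "p < x" "x < q" for x
      using v_deriv[of x] that pq by (auto simp: real_differentiable_def)
  qed (use pq in simp)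
  then obtain x where x: "p < x" "x < q" "v' x = 0" using DERIV_imp_deriv by blast
  have "E q > 0" using pq by (simp add: E_def)
  then have "0 < E x" using E_antimono[of x q] x pq by simp
  moreover have "v x \<noteq> 0" using \<open>0 < E x\<close> x by (auto simp: E_def)
  ultimately show ?thesis using that[OF x] critical_beta[of x] x pq by simp
qed

text \<open>From one sign change to the next v has to reach height \<beta>, and its speed is
  bounded. The added 1 gives the strict inequality.\<close>

lemma zero_crossings_gap:
  assumes "p \<in> zero_crossings v" "q \<in> zero_crossings v" "p < q"
  shows "\<beta> < (q - p) * (sqrt (2 * (F a - F b)) + 1)"
proof -
  obtain x where x: "p < x" "x < q" "v' x = 0" "\<beta> \<le> \<bar>v x\<bar>"
    using critical_between_zero_crossings[OF assms] .
  have p: "0 < p" "v p = 0" using assms zero_crossing_iff by auto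
  obtain z where z: "p < z" "z < x" "v x - v p = (x - p) * v' z"
    using MVT2[OF x(1), of v v'] v_deriv p by force
  have S: "0 \<le> sqrt (2 * (F a - F b))" using v'_bounded[OF p(1)] by linarith
  have "\<beta> \<le> (x - p) * \<bar>v' z\<bar>" using z x p by (simp add: abs_mult)
  also have "\<dots> \<le> (x - p) * sqrt (2 * (F a - F b))"
    using v'_bounded[of z] z p x by (intro mult_left_mono) auto
  also have "\<dots> < (q - p) * (sqrt (2 * (F a - F b)) + 1)"
    by (rule mult_strict_mono') (use x S in linarith)+
  finally show ?thesis .
qed

text \<open>With unboundedly many sign changes E is positive throughout and tends to 0. Then \<Phi>
  = r E + \<kappa> h(v) v' satisfies \<Phi>' \<le> -v'^2/4 eventually and is bounded below, although
  every passage from 0 to height \<beta> costs it a fixed amount.\<close>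

lemma zero_crossings_bounded: "\<exists>R. \<forall>r\<in>zero_crossings v. r \<le> R"
proof (rule ccontr)
  assume "\<not> ?thesis"
  then have unb: "\<And>R. \<exists>r\<in>zero_crossings v. R < r" by (auto simp: not_le)
  have Epos: "0 < E r" if "0 < r" for r
  proof -
    obtain z where z: "z \<in> zero_crossings v" "r < z" using unb by blast
    then have "0 < E z" by (simp add: zero_crossing_iff E_def)
    then show ?thesis using E_antimono[of r z] z that by simp
  qed
  obtain L where L: "(E \<longlongrightarrow> L) at_top" "\<And>r. 0 < r \<Longrightarrow> L \<le> E r" using E_converges by blast
  have "0 \<le> L"
    using tendsto_lowerbound[OF L(1), of 0] eventually_mono[OF eventually_gt_at_top[of 0]] Epos
    by (meson less_imp_le trivial_limit_at_top_linorder)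
  moreover have "\<not> 0 < L"
  proof
    assume "0 < L"
    show False
    proof (rule virial_contradiction[of 1 L "{- \<bar>a\<bar>..\<bar>a\<bar>}" 0])
      show "v r \<in> {- \<bar>a\<bar>..\<bar>a\<bar>}" if "1 \<le> r" for r using abs_v_less[of r] that by auto
      fix s assume "L \<le> F s"
      then have "0 < F s" using \<open>0 < L\<close> by simp
      then have "\<beta> \<le> \<bar>s\<bar>" using F_nonneg_imp[of s] by fastforce
      then show "0 < (s - 0) * f s"
        using f_pos[of s] f_pos[of "- s"] b_less_beta b_pos by (cases "0 \<le> s") (auto intro: mult_neg_neg)
    qed (use L in auto)
  qed
  ultimately have E0: "(E \<longlongrightarrow> 0) at_top" using L by (simp add: not_less order_antisym_conv)
  \<comment> \<open>Heights within \<delta> of \<open>b1\<close> lie in (b,\<beta>), where f > 0 and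
    F < 0: there F < 0 < E forces a minimal speed, while f > 0 from \<open>b1\<close> upwards lets
    the correction act.\<close>
  define b1 where "b1 = (b + \<beta>) / 2"
  define \<delta> where "\<delta> = (\<beta> - b) / 4"
  have b1: "b < b1" "b1 < \<beta>" "b1 + \<delta> < \<beta>" "b < b1 - \<delta>" "0 < \<delta>"
    using b_less_beta by (auto simp: b1_def \<delta>_def field_simps)
  define M where "M = sqrt (2 * (F a - F b)) + 1"
  have M: "\<bar>v' r\<bar> \<le> M" if "0 < r" for r using v'_bounded[OF that] by (simp add: M_def)
  have M1: "1 \<le> M" using F_ge[of a] by (simp add: M_def)
  obtain m where m: "0 < m" "\<And>s. b1 \<le> s \<Longrightarrow> s \<le> \<bar>a\<bar> \<Longrightarrow> m \<le> f s"
  proof -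
    have "\<exists>x\<in>{b1..\<bar>a\<bar>}. \<forall>y\<in>{b1..\<bar>a\<bar>}. f x \<le> f y"
      using a b1 by (intro continuous_attains_inf continuous_on_subset[OF f_cont]) auto
    then obtain x where "x \<in> {b1..\<bar>a\<bar>}" "\<forall>y\<in>{b1..\<bar>a\<bar>}. f x \<le> f y" by blast
    then show ?thesis using that[of "f x"] f_pos[of x] b1 by auto
  qed
  \<comment> \<open>On the range of v the slope of \<open>h\<close> is at most 2|a|, so \<kappa> h'
    \<le> 1/4, and N > 2 keeps the factor N - 3/2 - \<kappa> h' of -v'^2 above 1/4.\<close>
  define \<kappa> where "\<kappa> = 1 / (8 * \<bar>a\<bar>)"
  have a0: "0 < \<bar>a\<bar>" using a b_less_beta b_pos by simp
  have \<kappa>: "0 < \<kappa>" using a0 by (simp add: \<kappa>_def)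
  \<comment> \<open>An odd C^1 function that vanishes for |s| \<le> b1 and has the sign of f beyond,
    so that -\<kappa> h f \<le> 0 acts only where |v| is large.\<close>
  define h where "h s = (max 0 (s - b1))\<^sup>2 - (max 0 (- s - b1))\<^sup>2" for s
  define h' where "h' s = 2 * max 0 (s - b1) + 2 * max 0 (- s - b1)" for s
  have hd: "(h has_real_derivative h' s) (at s)" for s
  proof -
    have "(h has_real_derivative 2 * max 0 (s - b1) * (1 - 0) - 2 * max 0 (- s - b1) * (- 1 - 0)) (at s)"
      unfolding h_def[abs_def]
      by (intro DERIV_diff DERIV_chain2[OF DERIV_max_zero_square] DERIV_ident DERIV_const DERIV_minus)
    then show ?thesis by (simp add: h'_def)
  qed
  have h'_le: "h' s \<le> 2 * \<bar>a\<bar>" if "\<bar>s\<bar> \<le> \<bar>a\<bar>" for s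
    using that b1 b_pos by (auto simp: h'_def max_def)
  have h_small: "h s = 0" if "\<bar>s\<bar> \<le> b1" for s using that by (auto simp: h_def max_def)
  have hf: "h s * f s = \<bar>h s\<bar> * f \<bar>s\<bar>" if "b1 < \<bar>s\<bar>" for s
    using that b1 b_pos by (auto simp: h_def max_def abs_if)
  have h_large: "(\<beta> - b1)\<^sup>2 \<le> \<bar>h s\<bar>" if "\<beta> \<le> \<bar>s\<bar>" for s
    using that b1 b_pos by (auto simp: h_def max_def abs_if intro!: power_mono split: if_splits)
  have h_bd: "\<bar>h s\<bar> \<le> a\<^sup>2" if "\<bar>s\<bar> \<le> \<bar>a\<bar>" for s
  proof -
    have "\<bar>h s\<bar> \<le> \<bar>s\<bar>\<^sup>2"
    proof (cases "\<bar>s\<bar> \<le> b1")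
      case False
      then have "\<bar>h s\<bar> = (\<bar>s\<bar> - b1)\<^sup>2" using b1 b_pos by (cases "0 \<le> s") (auto simp: h_def max_def)
      also have "\<dots> \<le> \<bar>s\<bar>\<^sup>2" using False b1 b_pos by (intro power_mono) auto
      finally show ?thesis .
    qed (simp add: h_small)
    then show ?thesis using that by (metis abs_le_square_iff order_trans power2_abs)
  qed
  \<comment> \<open>For \<beta> \<le> |s| \<le> |a| this is a lower bound for half of \<kappa>
    |h(s)| f(|s|). Once E < \<eta>, also F(v) < \<eta>, so that half absorbs the only positive term
    of (r E)'.\<close>
  define \<eta> where "\<eta> = \<kappa> * (\<beta> - b1)\<^sup>2 * m / 2"
  have \<eta>: "0 < \<eta>" using \<kappa> b1 m by (simp add: \<eta>_def)
  obtain R0 where R0: "\<And>r. R0 \<le> r \<Longrightarrow> E r < \<eta>"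
    using order_tendstoD(2)[OF E0 \<eta>] by (auto simp: eventually_at_top_linorder)
  \<comment> \<open>The last entry makes the friction term \<open>e\<close> below at most half of
    \<kappa> |h| f; the other half is reserved for F(v).\<close>
  define R where "R = max 1 (max R0 (2 * (N - 1) * M / m))"
  have R: "1 \<le> R" "R0 \<le> R" by (auto simp: R_def)
  define \<Phi> where "\<Phi> r = r * E r + \<kappa> * (h (v r) * v' r)" for r
  have \<Phi>d: "\<exists>y. (\<Phi> has_real_derivative y) (at r) \<and> y \<le> - (v' r)\<^sup>2 / 4" if r: "R \<le> r" for r
  proof -
    have r0: "0 < r" using r R by simp
    have va: "\<bar>v r\<bar> \<le> \<bar>a\<bar>" using abs_v_less[OF r0] by simp
    define e where "e = \<kappa> * ((N - 1) / r * (h (v r) * v' r))"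
    have "(\<Phi> has_real_derivative 1 * E r + - ((N - 1) / r * (v' r)\<^sup>2) * r
       + \<kappa> * ((h' (v r) * v' r) * v' r + (- (N - 1) / r * v' r - f (v r)) * h (v r))) (at r)"
      unfolding \<Phi>_def[abs_def]
      by (intro DERIV_add DERIV_cmult DERIV_mult E_deriv DERIV_chain2[OF hd] v_deriv v'_deriv DERIV_ident r0)
    moreover have "1 * E r + - ((N - 1) / r * (v' r)\<^sup>2) * r
       + \<kappa> * ((h' (v r) * v' r) * v' r + (- (N - 1) / r * v' r - f (v r)) * h (v r))
      = (F (v r) - \<kappa> * (h (v r) * f (v r)) - e) - (N - 3/2 - \<kappa> * h' (v r)) * (v' r)\<^sup>2"
      using r0 by (simp add: field_simps power2_eq_square E_def e_def)
    moreover have "F (v r) - \<kappa> * (h (v r) * f (v r)) - e \<le> 0"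
    proof (cases "\<bar>v r\<bar> \<le> b1")
      case True
      then show ?thesis using F_nonpos[of "v r"] b1 h_small[OF True] by (simp add: e_def)
    next
      case False
      have fm: "m \<le> f \<bar>v r\<bar>" using m(2)[of "\<bar>v r\<bar>"] False va by simp
      have "2 * (N - 1) * M / m \<le> r" using r by (simp add: R_def)
      then have "(N - 1) / r * M \<le> m / 2" using m(1) r0 by (simp add: field_simps)
      moreover have "(N - 1) / r * \<bar>v' r\<bar> \<le> (N - 1) / r * M"
        using M[OF r0] r0 N by (intro mult_left_mono) auto
      ultimately have "(N - 1) / r * \<bar>v' r\<bar> \<le> f \<bar>v r\<bar> / 2" using fm by linarith
      then have "\<kappa> * \<bar>h (v r)\<bar> * ((N - 1) / r * \<bar>v' r\<bar>) \<le> \<kappa> * \<bar>h (v r)\<bar> * (f \<bar>v r\<bar> / 2)"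
        using \<kappa> by (intro mult_left_mono) auto
      moreover have "\<bar>e\<bar> = \<kappa> * \<bar>h (v r)\<bar> * ((N - 1) / r * \<bar>v' r\<bar>)"
        using \<kappa> N r0 by (simp add: e_def abs_mult)
      ultimately have e: "\<bar>e\<bar> \<le> \<kappa> * \<bar>h (v r)\<bar> * (f \<bar>v r\<bar> / 2)" by simp
      have hf': "\<kappa> * (h (v r) * f (v r)) = 2 * (\<kappa> * \<bar>h (v r)\<bar> * (f \<bar>v r\<bar> / 2))"
        using hf[of "v r"] False by simp
      have "F (v r) \<le> \<kappa> * \<bar>h (v r)\<bar> * (f \<bar>v r\<bar> / 2)"
      proof (cases "\<bar>v r\<bar> \<le> \<beta>")
        case True
        have "0 \<le> \<kappa> * \<bar>h (v r)\<bar> * (f \<bar>v r\<bar> / 2)" using \<kappa> fm m(1) by simp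
        then show ?thesis using F_nonpos[OF True] by linarith
      next
        case False
        have "\<eta> = \<kappa> * (\<beta> - b1)\<^sup>2 * (m / 2)" by (simp add: \<eta>_def)
        also have "\<dots> \<le> \<kappa> * \<bar>h (v r)\<bar> * (f \<bar>v r\<bar> / 2)"
          using \<kappa> fm m(1) h_large[of "v r"] False by (intro mult_mono) auto
        finally show ?thesis using R0[of r] r R F_le_E[of r] by linarith
      qed
      then show ?thesis using e hf' by linarith
    qed
    moreover have "1 / 4 * (v' r)\<^sup>2 \<le> (N - 3/2 - \<kappa> * h' (v r)) * (v' r)\<^sup>2"
    proof (rule mult_right_mono)
      have "\<kappa> * h' (v r) \<le> \<kappa> * (2 * \<bar>a\<bar>)" using h'_le[OF va] \<kappa> by (intro mult_left_mono) auto
      also have "\<dots> = 1 / 4" using a0 by (simp add: \<kappa>_def)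
      finally show "1 / 4 \<le> N - 3/2 - \<kappa> * h' (v r)" using N by simp
    qed simp
    ultimately show ?thesis by fastforce
  qed
  have \<Phi>_anti: "\<Phi> s \<le> \<Phi> r" if "R \<le> r" "r \<le> s" for r s
  proof (rule DERIV_nonpos_imp_nonincreasing[OF that(2)])
    fix x assume "r \<le> x" "x \<le> s"
    then have "R \<le> x" using \<open>R \<le> r\<close> by simp
    then obtain y where y: "(\<Phi> has_real_derivative y) (at x)" "y \<le> - (v' x)\<^sup>2 / 4"
      using \<Phi>d by blast
    moreover have "- (v' x)\<^sup>2 / 4 \<le> 0" by simp
    ultimately show "\<exists>y. (\<Phi> has_real_derivative y) (at x) \<and> y \<le> 0" by (metis order_trans)
  qed
  have \<Phi>_low: "- (\<kappa> * (a\<^sup>2 * M)) \<le> \<Phi> r" if "R \<le> r" for r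
  proof -
    have r0: "0 < r" using that R by simp
    have "\<bar>h (v r) * v' r\<bar> \<le> a\<^sup>2 * M"
      unfolding abs_mult using h_bd[of "v r"] abs_v_less[OF r0] M[OF r0] by (intro mult_mono) auto
    then have "\<kappa> * - (h (v r) * v' r) \<le> \<kappa> * (a\<^sup>2 * M)" using \<kappa> by (intro mult_left_mono) auto
    moreover have "0 \<le> r * E r" using Epos[OF r0] r0 by simp
    ultimately show ?thesis by (simp add: \<Phi>_def)
  qed
  obtain l where l: "(\<Phi> \<longlongrightarrow> l) at_top" "\<And>r. R \<le> r \<Longrightarrow> l \<le> \<Phi> r"
    by (rule antimono_bounded_below_convergent[of R \<Phi>, OF \<Phi>_anti \<Phi>_low]) blast+
  \<comment> \<open>While |v| is within \<delta> of \<open>b1\<close>, F(v) \<le> -m2 and E > 0 give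
    v'^2 \<ge> 2 m2. Since the speed is at most M, this lasts for a time of at least \<tau> =
    \<delta>/M.\<close>
  define m2 where "m2 = - F (b1 + \<delta>)"
  have m2: "0 < m2" using F_neg[of "b1 + \<delta>"] b1 b_pos by (simp add: m2_def)
  define \<tau> where "\<tau> = \<delta> / M"
  have \<tau>: "0 < \<tau>" using b1 M1 by (simp add: \<tau>_def)
  \<comment> \<open>From \<open>R2\<close> on \<Phi> exceeds its limit by less than the amount
    \<tau> m2 / 2 lost in one passage.\<close>
  have "\<forall>\<^sub>F r in at_top. \<Phi> r < l + \<tau> * (m2 / 2)"
    using \<tau> m2 by (intro order_tendstoD(2)[OF l(1)]) simp
  then obtain R2 where R2: "\<And>r. R2 \<le> r \<Longrightarrow> \<Phi> r < l + \<tau> * (m2 / 2)" by (auto simp: eventually_at_top_linorder)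
  obtain p where p: "p \<in> zero_crossings v" "max R R2 < p" using unb by blast
  obtain q where q: "q \<in> zero_crossings v" "p < q" using unb by blast
  obtain x where x: "p < x" "x < q" "v' x = 0" "\<beta> \<le> \<bar>v x\<bar>"
    using critical_between_zero_crossings[OF p(1) q] .
  have "\<exists>y\<ge>p. y \<le> x \<and> \<bar>v y\<bar> = b1"
  proof (rule IVT')
    show "continuous_on {p..x} (\<lambda>y. \<bar>v y\<bar>)"
      by (intro continuous_intros continuous_on_subset[OF v_cont]) (use p R in auto)
  qed (use p x b1 b_pos in \<open>auto simp: zero_crossing_iff\<close>)
  then obtain y where y: "p \<le> y" "\<bar>v y\<bar> = b1" by blast
  have y0: "R \<le> y" "0 < y" "R2 \<le> y" using y p R by auto
  have v'2: "2 * m2 \<le> (v' z)\<^sup>2" if z: "y \<le> z" "z \<le> y + \<tau>" for z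
  proof -
    have "\<bar>v z - v y\<bar> \<le> \<delta>"
    proof (cases "z = y")
      case False
      then obtain w where w: "y < w" "w < z" "v z - v y = (z - y) * v' w"
        using MVT2[of y z v v'] z v_deriv y0 by force
      have "\<bar>v z - v y\<bar> \<le> \<tau> * M"
        unfolding w(3) abs_mult using z w y0 M[of w] \<tau> by (intro mult_mono) auto
      then show ?thesis using M1 by (simp add: \<tau>_def)
    qed (use b1 in simp)
    then have vz: "b1 - \<delta> \<le> \<bar>v z\<bar>" "\<bar>v z\<bar> \<le> b1 + \<delta>" using y(2) by linarith+
    have "F \<bar>v z\<bar> \<le> F (b1 + \<delta>)"
      using F_mono[of "\<bar>v z\<bar>" "b1 + \<delta>"] vz b1 by (cases "\<bar>v z\<bar> = b1 + \<delta>") auto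
    then have "F (v z) \<le> F (b1 + \<delta>)" unfolding F_abs .
    then show ?thesis using Epos[of z] z y0 by (simp add: E_def m2_def)
  qed
  have "\<Phi> (y + \<tau>) + m2 / 2 * (y + \<tau>) \<le> \<Phi> y + m2 / 2 * y"
  proof (rule DERIV_nonpos_imp_nonincreasing[of y "y + \<tau>" "\<lambda>z. \<Phi> z + m2 / 2 * z"])
    fix z assume z: "y \<le> z" "z \<le> y + \<tau>"
    then have "R \<le> z" using y0 by simp
    then obtain d where d: "(\<Phi> has_real_derivative d) (at z)" "d \<le> - (v' z)\<^sup>2 / 4"
      using \<Phi>d by blast
    have "((\<lambda>z. \<Phi> z + m2 / 2 * z) has_real_derivative d + m2 / 2 * 1) (at z)"
      by (intro DERIV_add d DERIV_cmult DERIV_ident)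
    moreover have "d + m2 / 2 * 1 \<le> 0" using d(2) v'2[OF z] by simp
    ultimately show "\<exists>y. ((\<lambda>z. \<Phi> z + m2 / 2 * z) has_real_derivative y) (at z) \<and> y \<le> 0" by blast
  qed (use \<tau> in simp)
  moreover have "m2 / 2 * (y + \<tau>) = m2 / 2 * y + \<tau> * (m2 / 2)" by (simp add: field_simps)
  ultimately have "\<Phi> (y + \<tau>) \<le> \<Phi> y - \<tau> * (m2 / 2)" by linarith
  moreover have "l \<le> \<Phi> (y + \<tau>)" using l(2)[of "y + \<tau>"] y0 \<tau> by simp
  ultimately show False using R2[OF y0(3)] by linarith
qed

text \<open>An infinite bounded set would accumulate, against the minimal gap \<beta>/M. The radius
  \<open>e\<close> is half that gap, so two points of the ball are too close.\<close>

lemma finite_zero_crossings: "finite (zero_crossings v)"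
proof (rule ccontr)
  assume inf: "infinite (zero_crossings v)"
  obtain R where "\<forall>r\<in>zero_crossings v. r \<le> R" using zero_crossings_bounded by blast
  then have "zero_crossings v \<subseteq> {0..R}" by (auto simp: zero_crossings_def)
  then obtain x where x: "x islimpt zero_crossings v" using infinite_bounded_reals_islimpt[OF inf] by blast
  define M where "M = sqrt (2 * (F a - F b)) + 1"
  have M: "0 < M" using F_ge[of a] by (auto simp: M_def intro: add_nonneg_pos)
  define e where "e = \<beta> / M / 2"
  have e: "0 < e" using M b_less_beta b_pos by (simp add: e_def)
  have "infinite (zero_crossings v \<inter> ball x e)" using x e islimpt_eq_infinite_ball[of x] by blast
  then obtain p q where pq: "p \<in> zero_crossings v \<inter> ball x e" "q \<in> zero_crossings v \<inter> ball x e" "p \<noteq> q"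
    by (metis finite.emptyI finite.insertI ex_in_conv infinite_remove insertE insert_Diff_single subsetI finite_subset singletonI)
  have "\<beta> < \<bar>q - p\<bar> * M"
    using zero_crossings_gap[of p q] zero_crossings_gap[of q p] pq unfolding M_def
    by (cases "p < q") (auto simp: abs_if)
  moreover have "\<bar>q - p\<bar> < \<beta> / M" using pq e unfolding e_def by (auto simp: dist_real_def)
  then have "\<bar>q - p\<bar> * M < \<beta>" using M by (simp add: field_simps)
  ultimately show False by simp
qed

end

lemma cross_sides:
  assumes "\<forall>\<^sub>F x in at_right p. P x" "\<forall>\<^sub>F x in at_left q. Q x" "p < (q::real)"
  obtains x y where "p < x" "x < y" "y < q" "P x" "Q y"
proof -
  obtain c where c: "c > p" "\<And>x. p < x \<Longrightarrow> x < c \<Longrightarrow> P x" using assms(1) unfolding eventually_at_right_field by blast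
  obtain d where d: "d < q" "\<And>x. d < x \<Longrightarrow> x < q \<Longrightarrow> Q x" using assms(2) unfolding eventually_at_left_field by blast
  define m where "m = (p + q) / 2"
  have m: "p < m" "m < q" using assms(3) by (auto simp: m_def)
  show ?thesis
  proof (rule that[of "(p + min c m) / 2" "(q + max d m) / 2"])
    show "P ((p + min c m) / 2)" by (rule c(2)) (use c(1) m in \<open>auto simp: min_def\<close>)
    show "Q ((q + max d m) / 2)" by (rule d(2)) (use d(1) m in \<open>auto simp: max_def\<close>)
  qed (use c(1) d(1) m in \<open>auto simp: min_def max_def\<close>)
qed

context radial_ode
begin

subsection \<open>Trapped solutions\<close>

text \<open>A zero of v would need E \<ge> F 0 = 0.\<close>

lemma trapped_sign:
  assumes "0 < r0" "E r0 < 0" "0 < v r0" "r0 \<le> r"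
  shows "0 < v r"
proof (rule ccontr)
  assume "\<not> 0 < v r"
  then obtain y where y: "r0 \<le> y" "y \<le> r" "v y = 0"
    using IVT2'[of v r 0 r0] assms continuous_on_subset[OF v_cont, of "{r0..r}"] by auto
  have "0 \<le> E y" using y by (simp add: E_def)
  then show False using E_antimono[of r0 y] y assms by simp
qed

text \<open>Negative energy keeps v in a compact set of positive numbers, on which (s - b) f(s) > 0
  except at b. The virial argument with c = b brings E down to F b, and b is the only positive
  minimiser of F.\<close>

lemma trapped_tendsto:
  assumes nz: "no_interior_zero f b" and r0: "0 < r0" "E r0 < 0" "0 < v r0"
  shows "(v \<longlongrightarrow> b) at_top"
proof -
  have pos: "0 < v r" if "r0 \<le> r" for r using trapped_sign[OF r0 that] .
  have F_gt: "F b < F s" if "0 < s" "s \<noteq> b" for s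
    using F_b_minimum[OF nz, of s] F_ge[of s] that by fastforce
  obtain L where L: "(E \<longlongrightarrow> L) at_top" "\<And>r. 0 < r \<Longrightarrow> L \<le> E r" "F b \<le> L" using E_converges by blast
  \<comment> \<open>Near 0 the potential is close to F 0 = 0 > E r0, a value that v can no longer
    afford; so v keeps a distance d from 0.\<close>
  have "\<forall>\<^sub>F s in at 0. E r0 < F s"
    using order_tendstoD(1)[OF isContD[OF DERIV_isCont[OF F_deriv[of 0]]], of "E r0"] r0 by simp
  then obtain d where d: "d > 0" "\<And>s. s \<noteq> 0 \<Longrightarrow> \<bar>s\<bar> < d \<Longrightarrow> E r0 < F s"
    unfolding eventually_at by (auto simp: dist_real_def)
  have vS: "v r \<in> {d..\<bar>a\<bar>}" if "r0 \<le> r" for r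
  proof -
    have "F (v r) \<le> E r0" using F_le_E[of r] E_antimono[of r0 r] that r0 by simp
    then have "d \<le> v r" using d(2)[of "v r"] pos[OF that] by fastforce
    then show ?thesis using abs_v_less[of r] that r0 by simp
  qed
  have "\<not> F b < L"
  proof
    assume "F b < L"
    show False
    proof (rule virial_contradiction[of r0 L "{d..\<bar>a\<bar>}" b])
      fix s assume s: "s \<in> {d..\<bar>a\<bar>}" "L \<le> F s"
      then have "s \<noteq> b" "0 < s" using \<open>F b < L\<close> d(1) by auto
      then consider "0 < s" "s < b" | "b < s" by linarith
      then show "0 < (s - b) * f s"
      proof cases
        case 1
        then have "f s < 0" using nz by (simp add: no_interior_zero_def)
        then show ?thesis using 1 by (intro mult_neg_neg) auto
      next
        case 2 then show ?thesis using f_pos[of s] by simp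
      qed
    qed (use r0 L vS in auto)
  qed
  then have E: "(E \<longlongrightarrow> F b) at_top" using L by simp
  have Fy: "\<forall>\<^sub>F r in at_top. r0 \<le> r \<and> F (v r) < F y" if "0 < y" "y \<noteq> b" for y
    using order_tendstoD(2)[OF E F_gt[OF that]] eventually_ge_at_top[of r0]
    by eventually_elim (use F_le_E le_less_trans in blast)
  show ?thesis
  proof (rule order_tendstoI)
    fix y assume y: "y < b"
    show "\<forall>\<^sub>F r in at_top. y < v r"
    proof (cases "0 < y")
      case True
      show ?thesis
        using Fy[OF True] y pos F_antimono[of "v _" y]
        by (auto elim!: eventually_mono) (meson less_imp_le not_le)
    next
      case False
      have "y < v r" if "r0 \<le> r" for r using pos[OF that] False by simp
      then show ?thesis unfolding eventually_at_top_linorder by blast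
    qed
  next
    fix y assume y: "b < y"
    have "v r < y" if "F (v r) < F y" for r
      using F_less_imp_abs[OF _ that] y b_pos by simp
    moreover have "\<forall>\<^sub>F r in at_top. r0 \<le> r \<and> F (v r) < F y" using Fy[of y] y b_pos by simp
    ultimately show "\<forall>\<^sub>F r in at_top. v r < y" by (auto elim!: eventually_mono)
  qed
qed

lemma axis_crossing_nonzero: assumes "r \<in> axis_crossings v" shows "v r \<noteq> 0"
  using assms up_cross_Jcal_imp[of r] down_cross_Jcal_imp[of r] b_pos by (auto simp: axis_crossings_def)

text \<open>f may vanish near \<open>v x\<close>, and critical points may then accumulate at x.
  Between x and a nearby one the monotone flux is 0 at both ends, so v rests in between, and an end
  point of a rest is no crossing.\<close>

lemma axis_crossing_isolated_pos:
  assumes x: "0 < x" "v' x = 0" "0 < v x" "v x < b"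
  shows "\<forall>\<^sub>F y in at x. y \<notin> axis_crossings v"
proof -
  have "\<forall>\<^sub>F y in at x. 0 < v y" "\<forall>\<^sub>F y in at x. v y < b"
    using x order_tendstoD[OF isContD[OF v_isCont[OF x(1)]]] by blast+
  then have "\<forall>\<^sub>F y in at x. 0 < v y \<and> v y < b" by eventually_elim simp
  then obtain d where d: "d > 0" "\<And>y. y \<noteq> x \<Longrightarrow> \<bar>y - x\<bar> < d \<Longrightarrow> 0 < v y \<and> v y < b"
    unfolding eventually_at by (auto simp: dist_real_def)
  define e where "e = min d x"
  have e: "e > 0" "e \<le> x" "e \<le> d" using d x by (auto simp: e_def)
  have vb: "0 \<le> v y \<and> v y \<le> b" if "\<bar>y - x\<bar> < e" for y
    using d(2)[of y] x that e by (cases "y = x") auto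
  have rest: "v' z = 0" if "0 < p" "p \<le> z" "z \<le> q" "v' p = 0" "v' q = 0" "\<bar>p - x\<bar> < e" "\<bar>q - x\<bar> < e" for p q z
  proof -
    have vb': "0 \<le> v y \<and> v y \<le> b" if "p \<le> y" "y \<le> q" for y
      using vb[of y] that \<open>\<bar>p - x\<bar> < e\<close> \<open>\<bar>q - x\<bar> < e\<close> by linarith
    have "g p \<le> g z" by (rule g_mono) (use that vb' in auto)
    moreover have "g z \<le> g q" by (rule g_mono) (use that vb' in auto)
    ultimately show ?thesis using that g_sgn[of p] g_sgn[of q] g_sgn[of z] by simp
  qed
  have "y \<notin> axis_crossings v" if y: "y \<noteq> x" "\<bar>y - x\<bar> < e" for y
  proof
    assume yA: "y \<in> axis_crossings v"
    then have y0: "0 < y" "v' y = 0" using axis_crossing_critical by blast+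
    show False
    proof (cases "y < x")
      case True
      then have "\<forall>\<^sub>F z in at_right y. v' z = 0"
        unfolding eventually_at_right_field using rest[of y _ x] y y0 x e(1)
        by (intro exI[of _ x]) auto
      moreover have "\<forall>\<^sub>F z in at_right y. v' z \<noteq> 0"
        using yA y0 by (auto simp: axis_crossings_def up_cross_Jcal_iff down_cross_Jcal_iff elim!: eventually_mono)
      ultimately have "\<forall>\<^sub>F z in at_right y. False" by eventually_elim simp
      then show False by simp
    next
      case False
      then have "x < y" using y by simp
      then have "\<forall>\<^sub>F z in at_left y. v' z = 0"
        unfolding eventually_at_left_field using rest[of x _ y] y y0 x e(1)
        by (intro exI[of _ x]) auto
      moreover have "\<forall>\<^sub>F z in at_left y. v' z \<noteq> 0"
        using yA y0 by (auto simp: axis_crossings_def up_cross_Jcal_iff down_cross_Jcal_iff elim!: eventually_mono)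
      ultimately have "\<forall>\<^sub>F z in at_left y. False" by eventually_elim simp
      then show False by simp
    qed
  qed
  then show ?thesis unfolding eventually_at using e(1) by (intro exI[of _ e]) (auto simp: dist_real_def)
qed

lemma axis_crossing_isolated: assumes x: "0 < x" shows "\<forall>\<^sub>F y in at x. y \<notin> axis_crossings v"
proof -
  have crit: "\<forall>\<^sub>F y in at x. y \<notin> axis_crossings v" if "\<forall>\<^sub>F y in at x. v' y \<noteq> 0"
    using that by eventually_elim (use axis_crossing_critical in blast)
  consider "v' x \<noteq> 0" | "v' x = 0" "f (v x) \<noteq> 0" | "v' x = 0" "f (v x) = 0" by blast
  then show ?thesis
  proof cases
    case 1
    then show ?thesis using tendsto_imp_eventually_ne[OF isContD[OF v'_isCont[OF x]]] crit by blast
  next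
    case 2
    have d: "(v' has_real_derivative - f (v x)) (at x)" using v'_deriv[OF x] 2 by simp
    have "\<forall>\<^sub>F y in at x. v' y \<noteq> 0"
      using deriv_pos_eventually[OF d] deriv_neg_eventually[OF d] 2 unfolding eventually_at_split
      by (cases "f (v x) < 0") (auto elim: eventually_mono)
    then show ?thesis by (rule crit)
  next
    case 3
    interpret neg: radial_ode f b \<beta> N "\<lambda>r. - v r" "- a" by (rule neg)
    have "\<bar>v x\<bar> \<le> b" using f_pos[of "\<bar>v x\<bar>"] 3 by (fastforce simp: abs_if)
    then have "\<bar>v x\<bar> < b" using critical_ne_b[OF x] 3 by simp
    then consider "v x = 0" | "0 < v x" "v x < b" | "0 < - v x" "- v x < b" by linarith
    then show ?thesis
    proof cases
      \<comment> \<open>A double zero: afterwards v rests at 0; before it E \<ge> 0, so a critical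
        point other than a zero has |v| \<ge> \<beta> and is not near x.\<close>
      case 1
      have "\<forall>\<^sub>F y in at x. - \<beta> < v y" "\<forall>\<^sub>F y in at x. v y < \<beta>"
        using 1 order_tendstoD[OF isContD[OF v_isCont[OF x]]] b_less_beta b_pos by simp_all
      then have ev: "\<forall>\<^sub>F y in at x. \<bar>v y\<bar> < \<beta>" by eventually_elim simp
      show ?thesis
        using ev
      proof eventually_elim
        case (elim y)
        show ?case
        proof
          assume yA: "y \<in> axis_crossings v"
          then have y: "0 < y" "v' y = 0" "v y \<noteq> 0"
            using axis_crossing_critical axis_crossing_nonzero by blast+
          then have "y < x" using double_zero[OF x 1 3(1), of y] by fastforce
          moreover have "E x = 0" using 1 3 by (simp add: E_def)
          ultimately have "0 \<le> E y" using E_antimono[of y x] y by simp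
          then show False using critical_beta[of y] y elim by simp
        qed
      qed
    next
      case 2 then show ?thesis using axis_crossing_isolated_pos[OF x 3(1)] by simp
    next
      case 3
      then show ?thesis
        using neg.axis_crossing_isolated_pos[OF x] \<open>v' x = 0\<close> x by (simp add: deriv_neg axis_crossings_neg)
    qed
  qed
qed

text \<open>Crossings are isolated at positive times, and the slope has a fixed sign near 0, so no
  point of [0,R] is a point of accumulation.\<close>

lemma finite_axis_crossings: "finite {r \<in> axis_crossings v. r \<le> R}"
proof (rule ccontr)
  assume inf: "infinite {r \<in> axis_crossings v. r \<le> R}"
  have "{r \<in> axis_crossings v. r \<le> R} \<subseteq> {0..R}" using axis_crossing_critical by fastforce
  from infinite_bounded_reals_islimpt[OF inf this] obtain x where
    x: "x \<in> {0..R}" "x islimpt {r \<in> axis_crossings v. r \<le> R}" .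
  show False
  proof (cases "x = 0")
    case True
    obtain d where d: "d > 0" "\<And>r. 0 < r \<Longrightarrow> r < d \<Longrightarrow> a * v' r < 0" by (blast intro: v'_near_0)
    from x(2) obtain y where "y \<in> axis_crossings v" "dist y 0 < d" using d(1) True unfolding islimpt_approachable by blast
    then show False using d(2)[of y] axis_crossing_critical[of y] by (auto simp: dist_real_def)
  next
    case False
    then have "\<forall>\<^sub>F y in at x. y \<notin> {r \<in> axis_crossings v. r \<le> R}"
      using axis_crossing_isolated[of x] x(1) by (auto elim: eventually_mono)
    then show False using x(2) islimpt_iff_eventually by blast
  qed
qed

subsection \<open>Infinitely many axis crossings\<close>

text \<open>Gronwall's argument. Differentiability of f at the single zero s0 gives |f(s)| \<le> C
  |s - s0| nearby, which suffices for forward uniqueness of the constant solution s0.\<close>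

lemma rest_at_differentiable_zero:
  assumes r: "0 < r" "v' r = 0" "f (v r) = 0" and diff: "f differentiable (at (v r))" and x1: "r \<le> x1"
  shows "v' x1 = 0"
proof (rule ccontr)
  assume nz: "v' x1 \<noteq> 0"
  define s0 where "s0 = v r"
  obtain D where D: "(f has_real_derivative D) (at s0)"
    using diff unfolding real_differentiable_def s0_def by blast
  define C where "C = \<bar>D\<bar> + 1"
  have "((\<lambda>s. (f s - f s0) / (s - s0)) \<longlongrightarrow> D) (at s0)" using D by (simp add: has_field_derivative_iff)
  then have "\<forall>\<^sub>F s in at s0. dist ((f s - f s0) / (s - s0)) D < 1" by (rule tendstoD) simp
  then obtain \<delta> where \<delta>: "\<delta> > 0" "\<And>s. s \<noteq> s0 \<Longrightarrow> \<bar>s - s0\<bar> < \<delta> \<Longrightarrow> \<bar>f s / (s - s0) - D\<bar> < 1"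
    unfolding eventually_at using r by (auto simp: dist_real_def s0_def)
  have lip: "\<bar>f s\<bar> \<le> C * \<bar>s - s0\<bar>" if "\<bar>s - s0\<bar> < \<delta>" for s
  proof (cases "s = s0")
    case False
    then have "\<bar>f s / (s - s0)\<bar> \<le> C" using \<delta>(2)[OF False that] unfolding C_def by linarith
    then show ?thesis using False by (simp add: abs_divide pos_divide_le_eq)
  qed (use r in \<open>simp add: s0_def\<close>)
  define Y where "Y x = (v x - s0)\<^sup>2 + (v' x)\<^sup>2" for x
  have Yc: "continuous_on {r..x1} Y"
    unfolding Y_def[abs_def] using r
    by (intro continuous_intros continuous_at_imp_continuous_on ballI v_isCont v'_isCont) auto
  have "closed ({r..x1} \<inter> Y -` {0})" by (rule continuous_closed_preimage[OF Yc]) auto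
  from compact_Int_closed[OF compact_Icc this, of r x1] have "compact ({r..x1} \<inter> Y -` {0})"
    by (simp add: inf.left_idem)
  moreover have "r \<in> {r..x1} \<inter> Y -` {0}" using r x1 by (simp add: Y_def s0_def)
  \<comment> \<open>The last time in [r,x1] at which v has height s0 and slope 0; the estimate is
    applied just after it.\<close>
  ultimately obtain x0 where x0: "x0 \<in> {r..x1} \<inter> Y -` {0}" "\<And>x. x \<in> {r..x1} \<inter> Y -` {0} \<Longrightarrow> x \<le> x0"
    using compact_attains_sup by (metis empty_iff)
  have x0': "0 < x0" "x0 < x1" "v x0 = s0" "v' x0 = 0"
    using x0(1) r nz by (auto simp: Y_def add_nonneg_eq_0_iff order_le_less)
  have "(v \<longlongrightarrow> s0) (at_right x0)" using v_isCont[OF x0'(1)] x0'(3) by (auto simp: isCont_def intro: tendsto_within_subset)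
  from tendstoD[OF this \<delta>(1)] obtain c where c: "c > x0" "\<And>x. x0 < x \<Longrightarrow> x < c \<Longrightarrow> \<bar>v x - s0\<bar> < \<delta>"
    unfolding eventually_at_right_field dist_real_def by blast
  define x2 where "x2 = (x0 + min c x1) / 2"
  have x2: "x0 < x2" "x2 < c" "x2 < x1" using c(1) x0' by (auto simp: x2_def min_def)
  have small: "\<bar>v x - s0\<bar> < \<delta>" if "x0 \<le> x" "x \<le> x2" for x
    using c(2)[of x] that x2 x0'(3) \<delta>(1) by (cases "x = x0") auto
  \<comment> \<open>The rate 1 + C comes from Y' \<le> (1 + C) Y; the friction term contributes with
    the favourable sign.\<close>
  have "Y x2 * exp (- (1 + C) * x2) \<le> Y x0 * exp (- (1 + C) * x0)"
  proof (rule DERIV_nonpos_imp_nonincreasing[of x0 x2 "\<lambda>x. Y x * exp (- (1 + C) * x)"])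
    fix x assume x: "x0 \<le> x" "x \<le> x2"
    then have xp: "0 < x" using x0' by simp
    define Y' where "Y' = 2 * (v x - s0) * v' x + 2 * v' x * (- (N - 1) / x * v' x - f (v x))"
    have Yd: "(Y has_real_derivative Y') (at x)"
      unfolding Y_def[abs_def] Y'_def using xp
      by (auto intro!: derivative_eq_intros v_deriv v'_deriv)
    have "2 * (v x - s0) * v' x \<le> (v x - s0)\<^sup>2 + (v' x)\<^sup>2"
      using sum_squares_bound[of "v x - s0" "v' x"] by simp
    moreover have "- (2 * v' x * f (v x)) \<le> C * ((v x - s0)\<^sup>2 + (v' x)\<^sup>2)"
    proof -
      have "- (2 * v' x * f (v x)) \<le> 2 * \<bar>v' x\<bar> * \<bar>f (v x)\<bar>" by (simp add: abs_if mult_less_0_iff zero_less_mult_iff)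
      also have "\<dots> \<le> 2 * \<bar>v' x\<bar> * (C * \<bar>v x - s0\<bar>)"
        by (intro mult_left_mono lip small x) simp
      also have "\<dots> = C * (2 * \<bar>v x - s0\<bar> * \<bar>v' x\<bar>)" by simp
      also have "\<dots> \<le> C * (\<bar>v x - s0\<bar>\<^sup>2 + \<bar>v' x\<bar>\<^sup>2)"
        by (intro mult_left_mono sum_squares_bound) (simp add: C_def)
      finally show ?thesis by simp
    qed
    moreover have "2 * v' x * (- (N - 1) / x * v' x) \<le> 0"
    proof -
      have "2 * v' x * (- (N - 1) / x * v' x) = - (2 * (N - 1) / x * (v' x)\<^sup>2)"
        using xp by (simp add: power2_eq_square field_simps)
      then show ?thesis using N xp by simp
    qed
    ultimately have "Y' \<le> (1 + C) * Y x" unfolding Y'_def Y_def by (simp add: algebra_simps)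
    then have "(Y' - (1 + C) * Y x) * exp (- (1 + C) * x) \<le> 0" by (simp add: mult_le_0_iff)
    moreover have "((\<lambda>x. Y x * exp (- (1 + C) * x)) has_real_derivative
       Y' * exp (- (1 + C) * x) + exp (- (1 + C) * x) * (- (1 + C) * 1) * Y x) (at x)"
      by (intro DERIV_mult Yd DERIV_chain2[OF DERIV_exp] DERIV_cmult DERIV_ident)
    ultimately show "\<exists>y. ((\<lambda>x. Y x * exp (- (1 + C) * x)) has_real_derivative y) (at x) \<and> y \<le> 0"
      by (intro exI[of _ "Y' * exp (- (1 + C) * x) + exp (- (1 + C) * x) * (- (1 + C) * 1) * Y x"])
        (simp add: algebra_simps)
  qed (use x2 in simp)
  then have "Y x2 * exp (- (1 + C) * x2) \<le> 0" using x0(1) by simp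
  then have "Y x2 \<le> 0" by (simp add: mult_le_0_iff)
  moreover have "0 \<le> Y x2" by (simp add: Y_def)
  ultimately have "Y x2 = 0" by linarith
  then show False using x0(2)[of x2] x0(1) x2 by simp
qed

text \<open>The maximum over [p,q] lies inside. Were it at most b, the flux would not decrease,
  against v' > 0 at \<open>c\<close> and v' < 0 at \<open>d\<close>. So it lies above b, where f > 0
  turns a critical point into a crossing.\<close>

lemma up_between_downs:
  assumes p: "0 < p" "p < q" "down_cross (Jcal v) 0 p" "down_cross (Jcal v) 0 q"
    and pos: "\<And>r. p \<le> r \<Longrightarrow> r \<le> q \<Longrightarrow> 0 < v r"
  obtains r where "p < r" "r < q" "up_cross (Jcal v) 0 r"
proof -
  have ev: "\<forall>\<^sub>F x in at_right p. 0 < v' x" "\<forall>\<^sub>F x in at_left q. v' x < 0"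
    using p by (auto simp: down_cross_Jcal_iff)
  obtain c d where cd: "p < c" "c < d" "d < q" "0 < v' c" "v' d < 0" using cross_sides[OF ev p(2)] .
  have cont: "continuous_on {p..q} v" using v_cont by (rule continuous_on_subset) (use p in auto)
  obtain r where r: "r \<in> {p..q}" "\<And>x. x \<in> {p..q} \<Longrightarrow> v x \<le> v r"
    using continuous_attains_sup[OF _ _ cont] p by (metis atLeastAtMost_iff compact_Icc empty_iff less_imp_le order_refl)
  have ne: "r \<noteq> p" "r \<noteq> q"
  proof -
    obtain x where x: "p < x" "x \<le> q" "\<And>y. p < y \<Longrightarrow> y < x \<Longrightarrow> 0 < v' y"
      using ev(1) p(2) unfolding eventually_at_right_field by (metis less_imp_le linorder_not_le order_refl order_less_le_trans)
    have "v p < v x"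
      by (rule DERIV_pos_imp_increasing_open[OF x(1) _ continuous_on_subset[OF cont]])
        (use x p v_deriv in \<open>auto intro!: exI[of _ "v' _"]\<close>)
    then show "r \<noteq> p" using r(2)[of x] x by auto
    obtain x where x: "x < q" "p \<le> x" "\<And>y. x < y \<Longrightarrow> y < q \<Longrightarrow> v' y < 0"
      using ev(2) p(2) unfolding eventually_at_left_field by (metis less_imp_le linorder_not_le order_refl order_le_less_trans)
    have "v q < v x"
      by (rule DERIV_neg_imp_decreasing_open[OF x(1) _ continuous_on_subset[OF cont]])
        (use x p v_deriv in \<open>auto intro!: exI[of _ "v' _"]\<close>)
    then show "r \<noteq> q" using r(2)[of x] x by auto
  qed
  then have r': "p < r" "r < q" "0 < r" using r(1) p by auto
  have "v' r = 0"
  proof (rule DERIV_local_max[OF v_deriv[OF r'(3)], of "min (r - p) (q - r)"])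
    show "\<forall>y. \<bar>r - y\<bar> < min (r - p) (q - r) \<longrightarrow> v y \<le> v r"
    proof (intro allI impI r(2))
      fix y assume "\<bar>r - y\<bar> < min (r - p) (q - r)"
      then have "\<bar>r - y\<bar> < r - p" "\<bar>r - y\<bar> < q - r" by simp_all
      then have "p \<le> y" "y \<le> q" by linarith+
      then show "y \<in> {p..q}" by simp
    qed
  qed (use r' in simp)
  have "b < v r"
  proof (rule ccontr)
    assume "\<not> b < v r"
    then have "0 \<le> v x \<and> v x \<le> b" if "c \<le> x" "x \<le> d" for x
      using pos[of x] r(2)[of x] that cd by simp
    then have "g c \<le> g d" by (intro g_mono) (use cd p in auto)
    then show False using g_sgn[of c] g_sgn[of d] cd p by simp
  qed
  then show ?thesis using that[OF r'(1,2)] critical_imp_cross(1)[OF r'(3) \<open>v' r = 0\<close>] f_pos by blast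
qed

text \<open>The counterpart for minima is weaker: the minimum lies below b, where f may vanish, so
  it need not be a downward crossing.\<close>

lemma critical_between_ups:
  assumes p: "0 < p" "p < q" "up_cross (Jcal v) 0 p" "up_cross (Jcal v) 0 q"
  obtains r where "p < r" "r < q" "v' r = 0" "v r < b"
proof -
  have ev: "\<forall>\<^sub>F x in at_right p. v' x < 0" "\<forall>\<^sub>F x in at_left q. 0 < v' x"
    using p by (auto simp: up_cross_Jcal_iff)
  obtain c d where cd: "p < c" "c < d" "d < q" "v' c < 0" "0 < v' d" using cross_sides[OF ev p(2)] .
  obtain y where y: "y \<in> {c..d}" "v y \<le> b"
  proof (rule ccontr)
    assume "\<not> thesis"
    then have "b < v x" if "c \<le> x" "x \<le> d" for x using that \<open>\<And>y. y \<in> {c..d} \<Longrightarrow> v y \<le> b \<Longrightarrow> thesis\<close> by force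
    then have "g d < g c" using g_antimono[of c d] cd p by simp
    then show False using g_sgn[of c] g_sgn[of d] cd p by simp
  qed
  have cont: "continuous_on {c..d} v" using v_cont by (rule continuous_on_subset) (use p cd in auto)
  obtain r where r: "r \<in> {c..d}" "\<And>x. x \<in> {c..d} \<Longrightarrow> v r \<le> v x"
    using continuous_attains_inf[OF _ _ cont] y(1) by (metis compact_Icc empty_iff)
  have r0: "0 < r" using r(1) cd p by simp
  have "v' r = 0"
  proof (rule ccontr)
    assume "v' r \<noteq> 0"
    then consider "v' r < 0" | "0 < v' r" by linarith
    then show False
    proof cases
      case 1
      then have "r < d" using r(1) cd by (cases "r = d") auto
      from deriv_neg_eventually(2)[OF v_deriv[OF r0] 1] obtain e where
        e: "e > r" "\<And>x. r < x \<Longrightarrow> x < e \<Longrightarrow> v x < v r" unfolding eventually_at_right_field by blast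
      have "v ((r + min d e) / 2) < v r" by (rule e(2)) (use e(1) \<open>r < d\<close> in \<open>auto simp: min_def\<close>)
      then show False using r(2)[of "(r + min d e) / 2"] r(1) e(1) \<open>r < d\<close> by (auto simp: min_def split: if_splits)
    next
      case 2
      then have "c < r" using r(1) cd by (cases "r = c") auto
      from deriv_pos_eventually(1)[OF v_deriv[OF r0] 2] obtain e where
        e: "e < r" "\<And>x. e < x \<Longrightarrow> x < r \<Longrightarrow> v x < v r" unfolding eventually_at_left_field by blast
      have "v ((r + max c e) / 2) < v r" by (rule e(2)) (use e(1) \<open>c < r\<close> in \<open>auto simp: max_def\<close>)
      then show False using r(2)[of "(r + max c e) / 2"] r(1) e(1) \<open>c < r\<close> by (auto simp: max_def split: if_splits)
    qed
  qed
  moreover have "v r \<noteq> b" using critical_ne_b[OF r0 \<open>v' r = 0\<close>] b_pos by auto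
  then have "v r < b" using r(2)[OF y(1)] y(2) by linarith
  ultimately show ?thesis using that[of r] r(1) cd by simp
qed

lemma infinite_axis_crossings_unbounded:
  assumes "infinite {r \<in> axis_crossings v. R0 < r}"
  shows "\<exists>r>R. r \<in> axis_crossings v"
proof (rule ccontr)
  assume "\<not> ?thesis"
  then have "{r \<in> axis_crossings v. R0 < r} \<subseteq> {r \<in> axis_crossings v. r \<le> R}" by (auto simp: not_less)
  then show False using finite_axis_crossings assms finite_subset by blast
qed

text \<open>If downward crossings ceased, the minima between upward ones would sit at zeros of f at
  which f is not differentiable, since otherwise v would rest there for ever. \<open>H1\<close>
  leaves finitely many such heights, hence finitely many energies, although the energy drops
  strictly at every upward crossing in between.\<close>

lemma infinitely_many_crossings:
  assumes inf: "\<And>R. \<exists>r>R. r \<in> axis_crossings v" and r0: "0 < r0" "\<And>r. r0 \<le> r \<Longrightarrow> 0 < v r"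
  shows "\<exists>r>R. up_cross (Jcal v) 0 r" "\<exists>r>R. down_cross (Jcal v) 0 r"
proof -
  show up: "\<exists>r>R. up_cross (Jcal v) 0 r" for R
  proof (rule ccontr)
    assume neg: "\<not> ?thesis"
    obtain p where p: "p > max r0 R" "p \<in> axis_crossings v" using inf by blast
    obtain q where q: "q > p" "q \<in> axis_crossings v" using inf by blast
    have "down_cross (Jcal v) 0 p" "down_cross (Jcal v) 0 q"
      using p q neg by (auto simp: axis_crossings_def)
    then obtain r where "p < r" "up_cross (Jcal v) 0 r"
      using up_between_downs[of p q] p q r0 by (metis max_less_iff_conj less_imp_le less_trans order_less_le_trans)
    then show False using neg p by auto
  qed
  show "\<exists>r>R. down_cross (Jcal v) 0 r"
  proof (rule ccontr)
    assume neg: "\<not> ?thesis"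
    define D where "D = {s. 0 < s \<and> \<not> f differentiable (at s)}"
    have finD: "finite D" using H1 by (simp add: H1_def D_def)
    define M where "M = {r. 0 < r \<and> v' r = 0 \<and> v r \<in> D}"
    have unb: "\<exists>r>R'. r \<in> M" for R'
    proof -
      obtain p where p: "p > max r0 (max R R')" "up_cross (Jcal v) 0 p" using up by blast
      obtain q where q: "q > p" "up_cross (Jcal v) 0 q" using up by blast
      have p0: "0 < p" using p r0 by simp
      obtain r where r: "p < r" "r < q" "v' r = 0" "v r < b" by (rule critical_between_ups[OF p0 q(1) p(2) q(2)])
      have r': "0 < r" "0 < v r" "R < r" using r p p0 r0(2)[of r] by auto
      have "\<not> f (v r) < 0" using critical_imp_cross(2)[OF r'(1) r(3)] neg r' by blast
      then have f0: "f (v r) = 0" using f_nonpos[of "v r"] r r' by simp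
      have "\<not> f differentiable (at (v r))"
      proof
        assume "f differentiable (at (v r))"
        then have rest: "v' x = 0" if "r \<le> x" for x
          using rest_at_differentiable_zero[OF r'(1) r(3) f0] that by blast
        have "\<forall>\<^sub>F x in at_left q. 0 < v' x" using q p0 by (simp add: up_cross_Jcal_iff)
        then obtain c where c: "c < q" "\<And>x. c < x \<Longrightarrow> x < q \<Longrightarrow> 0 < v' x" unfolding eventually_at_left_field by blast
        have "0 < v' ((q + max c r) / 2)" by (rule c(2)) (use c(1) r in \<open>auto simp: max_def\<close>)
        moreover have "v' ((q + max c r) / 2) = 0" by (rule rest) (use c(1) r in \<open>auto simp: max_def\<close>)
        ultimately show False by simp
      qed
      then show ?thesis using r r' p by (intro exI[of _ r]) (auto simp: M_def D_def)
    qed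
    have "E ` M \<subseteq> F ` D" by (auto simp: M_def E_critical)
    then have fin: "finite (E ` M)" using finD finite_subset by blast
    have "M \<noteq> {}" using unb by blast
    \<comment> \<open>A minimum of least energy. Past the next upward crossing there is another one,
      necessarily of smaller energy.\<close>
    then obtain r where r: "r \<in> M" "E r = Min (E ` M)" using Min_in[OF fin] by (metis imageE image_is_empty)
    obtain p where p: "p > r" "up_cross (Jcal v) 0 p" using up by blast
    have rp: "0 < r" "0 < p" using r p by (auto simp: M_def)
    have "\<forall>\<^sub>F x in at_right p. v' x < 0" using p rp by (simp add: up_cross_Jcal_iff)
    then obtain c where c: "c > p" "\<And>x. p < x \<Longrightarrow> x < c \<Longrightarrow> v' x < 0" unfolding eventually_at_right_field by blast
    obtain r2 where r2: "r2 > c" "r2 \<in> M" using unb by blast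
    have "E r2 < E r"
      by (rule E_strict[of r "(p + c) / 2"]) (use c(2)[of "(p + c) / 2"] c(1) p rp r2 in auto)
    moreover have "E r \<le> E r2" using r(2) Min_le[OF fin] r2 by simp
    ultimately show False by simp
  qed
qed

end

section \<open>Times defined as suprema\<close>

text \<open>A time given as a supremum is used in two ways: the property holds up to it, and it
  fails at or arbitrarily shortly after a finite one.\<close>

lemma Sup_time:
  fixes t :: real and P :: "real \<Rightarrow> bool"
  assumes Z: "Z = Sup {ereal r | r. t < r \<and> (\<forall>s. t < s \<and> s < r \<longrightarrow> P s)}"
    and ev: "\<forall>\<^sub>F s in at_right t. P s"
  shows "ereal t < Z" "\<And>s. t < s \<Longrightarrow> ereal s < Z \<Longrightarrow> P s"
    "\<And>z d. Z = ereal z \<Longrightarrow> 0 < d \<Longrightarrow> \<exists>s\<ge>z. s < z + d \<and> \<not> P s"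
proof -
  obtain c where c: "t < c" "\<And>s. t < s \<Longrightarrow> s < c \<Longrightarrow> P s"
    using ev unfolding eventually_at_right_field by blast
  have "ereal c \<le> Z" unfolding Z by (rule Sup_upper) (use c in blast)
  then show tZ: "ereal t < Z" using c(1) by (metis less_ereal.simps(1) order_less_le_trans)
  show P: "P s" if s: "t < s" "ereal s < Z" for s
  proof -
    have "\<exists>x\<in>{ereal r | r. t < r \<and> (\<forall>s. t < s \<and> s < r \<longrightarrow> P s)}. ereal s < x"
      using s(2) unfolding Z less_Sup_iff .
    then show ?thesis using s(1) by auto
  qed
  show "\<exists>s\<ge>z. s < z + d \<and> \<not> P s" if z: "Z = ereal z" "0 < d" for z d
  proof (rule ccontr)
    assume n: "\<not> ?thesis"
    have "P s" if "t < s" "s < z + d" for s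
      using P[of s] n that z(1) by (cases "s < z") auto
    moreover have "t < z + d" using tZ z by auto
    ultimately have "ereal (z + d) \<le> Z" unfolding Z by (intro Sup_upper) blast
    then show False using z by simp
  qed
qed

text \<open>The derivative is a parameter because \<open>(-1)\<^sup>n u'\<close> and the derivative of \<open>(-1)\<^sup>n u\<close> are only
  known to agree at positive times.\<close>

definition next_time :: "(real \<Rightarrow> real) \<Rightarrow> (real \<Rightarrow> real) \<Rightarrow> real \<Rightarrow> ereal" where
  "next_time w d z =
     (if z = 0 then Sup {ereal r | r. 0 < r \<and> (\<forall>s. 0 < s \<and> s < r \<longrightarrow> 0 < w s \<and> d s < 0)}
      else let T = Sup {ereal r | r. z < r \<and> (\<forall>s. z < s \<and> s < r \<longrightarrow> 0 \<le> d s)} in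
        if T = \<infinity> then \<infinity>
        else Sup {ereal r | r. T < ereal r \<and> (\<forall>s. T < ereal s \<and> s < r \<longrightarrow> 0 < w s \<and> d s < 0)})"

text \<open>Multiplication by (-1)^n turns every stage into the same positive excursion. The second
  assumption matches the test z = 0 in \<open>next_time\<close>, which separates the starting point,
  where no ascent comes first, from a sign change.\<close>

lemma Z_time_Suc:
  assumes "Z_time w n = ereal z" "z = 0 \<longleftrightarrow> n = 0"
  shows "Z_time w (Suc n) = next_time (\<lambda>s. (-1) ^ n * w s) (\<lambda>s. (-1) ^ n * deriv w s) z"
proof (cases n)
  case 0
  then show ?thesis using assms by (simp add: next_time_def Ball_def)
next
  case (Suc m)
  then show ?thesis using assms by (simp add: next_time_def turn_time_def Let_def)
qed

context radial_ode
begin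

subsection \<open>One excursion\<close>

definition at_start :: "real \<Rightarrow> bool" where
  "at_start z \<longleftrightarrow> z = 0 \<and> 0 < a \<or> 0 < z \<and> v z = 0 \<and> 0 < v' z"

text \<open>\<open>T\<close> tolerates v' = 0 on the way up. If finite, it ends at a critical point
  above b, because the flux does not decrease while 0 \<le> v \<le> b; otherwise v is monotone and
  bounded and converges.\<close>

lemma ascent:
  assumes z: "0 < z" "v z = 0" "0 < v' z" and d: "\<forall>s>0. d s = v' s"
    and T: "T = Sup {ereal r | r. z < r \<and> (\<forall>s. z < s \<and> s < r \<longrightarrow> 0 \<le> d s)}"
  obtains (turn) t where "T = ereal t" "z < t" "v' t = 0" "b < v t"
      "\<And>s. z < s \<Longrightarrow> s \<le> t \<Longrightarrow> 0 < v s" "\<And>s. z < s \<Longrightarrow> s < t \<Longrightarrow> 0 \<le> v' s"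
    | (asymptotic) l where "T = \<infinity>" "0 < l" "(v \<longlongrightarrow> l) at_top" "\<And>s. z < s \<Longrightarrow> 0 < v s"
proof -
  have "\<forall>\<^sub>F s in at_right z. 0 < v' s"
    using order_tendstoD(1)[OF isContD[OF v'_isCont[OF z(1)]], of 0] z by (simp add: eventually_at_split)
  then have "\<forall>\<^sub>F s in at_right z. z < s \<and> 0 < v' s"
    using eventually_at_right_less[of z] by eventually_elim simp
  then have ev: "\<forall>\<^sub>F s in at_right z. 0 \<le> d s"
    by eventually_elim (use d z in simp)
  note S = Sup_time[OF T ev]
  have v'0: "0 \<le> v' s" if "z < s" "ereal s < T" for s using S(2)[OF that] d z that by simp
  have mono: "v p \<le> v q" if "z \<le> p" "p \<le> q" "ereal q \<le> T" for p q
  proof (rule DERIV_nonneg_imp_increasing_open[OF that(2)])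
    fix x assume "p < x" "x < q"
    then have "z < x" "ereal x < T" using that by (auto intro: less_le_trans[of _ "ereal q"])
    then show "\<exists>y. (v has_real_derivative y) (at x) \<and> 0 \<le> y" using v'0 v_deriv[of x] z by auto
  qed (use v_cont continuous_on_subset that z in force)
  have pos: "0 < v s" if s: "z < s" "ereal s \<le> T" for s
  proof -
    from deriv_pos_eventually(2)[OF v_deriv[OF z(1)] z(3)] obtain c where
      c: "c > z" "\<And>x. z < x \<Longrightarrow> x < c \<Longrightarrow> v z < v x" unfolding eventually_at_right_field by blast
    define x where "x = (z + min c s) / 2"
    have x: "z < x" "x < c" "x \<le> s" using c(1) s by (auto simp: x_def min_def)
    have "0 < v x" using c(2)[of x] x z by simp
    also have "v x \<le> v s" using mono[of x s] x s by simp
    finally show ?thesis .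
  qed
  show thesis
  proof (cases T)
    case (real t)
    have t: "z < t" using S(1) real by simp
    then have t0: "0 < t" using z by simp
    have "v' t \<le> 0"
    proof (rule ccontr)
      assume "\<not> v' t \<le> 0"
      then have "\<forall>\<^sub>F s in at t. 0 < v' s"
        using order_tendstoD(1)[OF isContD[OF v'_isCont[OF t0]], of 0] by simp
      then obtain e where e: "e > 0" "\<And>s. s \<noteq> t \<Longrightarrow> \<bar>s - t\<bar> < e \<Longrightarrow> 0 < v' s"
        unfolding eventually_at dist_real_def by blast
      obtain s where "t \<le> s" "s < t + e" "\<not> 0 \<le> d s" using S(3)[OF real e(1)] by blast
      then show False using e(2)[of s] d t0 \<open>\<not> v' t \<le> 0\<close> by (cases "s = t") auto
    qed
    moreover have "0 \<le> v' t"
    proof (rule tendsto_lowerbound)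
      show "(v' \<longlongrightarrow> v' t) (at_left t)" using v'_isCont[OF t0] by (auto simp: isCont_def intro: tendsto_within_subset)
      show "\<forall>\<^sub>F s in at_left t. 0 \<le> v' s"
        unfolding eventually_at_left_field using v'0 real t by (intro exI[of _ z]) auto
    qed simp
    ultimately have v't: "v' t = 0" by simp
    have "b < v t"
    proof (rule ccontr)
      assume "\<not> b < v t"
      then have "0 \<le> v r \<and> v r \<le> b" if "z \<le> r" "r \<le> t" for r
        using mono[of z r] mono[of r t] that real z by simp
      then have "g z \<le> g t" by (intro g_mono) (use t z in auto)
      then show False using g_sgn[of z] g_sgn[of t] z t0 v't by simp
    qed
    then show thesis using turn[OF real t v't] pos v'0 real by simp
  next
    case PInf
    have low: "- \<bar>a\<bar> \<le> - v r" if "z \<le> r" for r using abs_v_less[of r] that z by simp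
    have anti: "- v s \<le> - v r" if "z \<le> r" "r \<le> s" for r s using mono[OF that] PInf by simp
    obtain m where "((\<lambda>r. - v r) \<longlongrightarrow> m) at_top" "\<And>r. z \<le> r \<Longrightarrow> m \<le> - v r"
      by (rule antimono_bounded_below_convergent[of z "\<lambda>r. - v r", OF anti low]) blast+
    then have "(v \<longlongrightarrow> - m) at_top" "v (z + 1) \<le> - m"
      using tendsto_minus[of "\<lambda>r. - v r" m at_top] by (auto simp: le_minus_iff)
    moreover have "0 < v (z + 1)" using pos PInf by simp
    ultimately have "0 < - m" by linarith
    with \<open>(v \<longlongrightarrow> - m) at_top\<close> show thesis using asymptotic[of "- m"] pos PInf by simp
  next
    case MInf then show thesis using S(1) by simp
  qed
qed

text \<open>The signs are strict here, so the descent stops at the first zero of v or v'. A critical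
  stop above b is impossible because the negative flux decreases further there; at b the energy
  excludes it.\<close>

lemma descent:
  assumes t: "0 \<le> t" "b < v t" "t = 0 \<or> v' t = 0" and d: "\<forall>s>0. d s = v' s"
    and Z: "Z = Sup {ereal r | r. t < r \<and> (\<forall>s. t < s \<and> s < r \<longrightarrow> 0 < v s \<and> d s < 0)}"
  shows "ereal t < Z" "\<And>s. t < s \<Longrightarrow> ereal s < Z \<Longrightarrow> 0 < v s \<and> v' s < 0"
    "(\<exists>y>t. Z = ereal y \<and> v y = 0 \<and> v' y \<le> 0) \<or> (\<exists>y>t. Z = ereal y \<and> 0 < v y \<and> v y < b \<and> v' y = 0) \<or>
     (Z = \<infinity> \<and> (\<exists>l\<ge>0. (v \<longlongrightarrow> l) at_top))"
proof -
  have "\<forall>\<^sub>F s in at_right t. v' s < 0"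
  proof (cases "t = 0")
    case True
    obtain e where "e > 0" "\<And>r. 0 < r \<Longrightarrow> r < e \<Longrightarrow> a * v' r < 0" by (blast intro: v'_near_0)
    moreover have "0 < a" using True t v_0 b_pos by simp
    ultimately show ?thesis unfolding eventually_at_right_field using True
      by (intro exI[of _ e]) (auto simp: mult_less_0_iff)
  next
    case False
    then have "up_cross (Jcal v) 0 t" using critical_imp_cross(1)[of t] t f_pos by simp
    then show ?thesis using False t by (simp add: up_cross_Jcal_iff)
  qed
  moreover have "\<forall>\<^sub>F s in at_right t. 0 < v s"
  proof -
    have "(v \<longlongrightarrow> v t) (at t within {0..})" using v_cont t by (simp add: continuous_on_def)
    then have "(v \<longlongrightarrow> v t) (at_right t)" by (rule tendsto_within_subset) (use t in auto)
    then show ?thesis by (rule order_tendstoD) (use t b_pos in simp)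
  qed
  ultimately have ev: "\<forall>\<^sub>F s in at_right t. 0 < v s \<and> d s < 0"
    using eventually_at_right_less[of t] by eventually_elim (use d t in simp)
  note S = Sup_time[OF Z ev]
  show "ereal t < Z" by (rule S(1))
  show P: "0 < v s \<and> v' s < 0" if "t < s" "ereal s < Z" for s using S(2)[OF that] d t that by simp
  have mono: "v q \<le> v p" if "t \<le> p" "p \<le> q" "ereal q \<le> Z" for p q
  proof (rule DERIV_nonpos_imp_decreasing_open[OF that(2)])
    fix x assume "p < x" "x < q"
    then have "t < x" "ereal x < Z" using that by (auto intro: less_le_trans[of _ "ereal q"])
    then show "\<exists>y. (v has_real_derivative y) (at x) \<and> y \<le> 0" using P[of x] v_deriv[of x] t by (auto intro: less_imp_le)
  qed (use v_cont continuous_on_subset that t in force)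
  show "(\<exists>y>t. Z = ereal y \<and> v y = 0 \<and> v' y \<le> 0) \<or> (\<exists>y>t. Z = ereal y \<and> 0 < v y \<and> v y < b \<and> v' y = 0) \<or>
     (Z = \<infinity> \<and> (\<exists>l\<ge>0. (v \<longlongrightarrow> l) at_top))"
  proof (cases Z)
    case (real y)
    have y: "t < y" using S(1) real by simp
    then have y0: "0 < y" using t by simp
    have evl: "\<forall>\<^sub>F s in at_left y. 0 < v s \<and> v' s < 0"
      unfolding eventually_at_left_field using P real y by (intro exI[of _ t]) auto
    have "0 \<le> v y"
    proof (rule tendsto_lowerbound)
      show "(v \<longlongrightarrow> v y) (at_left y)" using v_isCont[OF y0] by (auto simp: isCont_def intro: tendsto_within_subset)
    qed (use evl in \<open>auto elim!: eventually_mono\<close>)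
    moreover have v'y: "v' y \<le> 0"
    proof (rule tendsto_upperbound)
      show "(v' \<longlongrightarrow> v' y) (at_left y)" using v'_isCont[OF y0] by (auto simp: isCont_def intro: tendsto_within_subset)
    qed (use evl in \<open>auto elim!: eventually_mono\<close>)
    moreover have "\<not> (0 < v y \<and> v' y < 0)"
    proof
      assume n: "0 < v y \<and> v' y < 0"
      have "\<forall>\<^sub>F s in at y. 0 < v s" "\<forall>\<^sub>F s in at y. v' s < 0"
        using order_tendstoD[OF isContD[OF v_isCont[OF y0]]] order_tendstoD[OF isContD[OF v'_isCont[OF y0]]] n by blast+
      then have "\<forall>\<^sub>F s in at y. 0 < v s \<and> v' s < 0" by eventually_elim simp
      then obtain e where e: "e > 0" "\<And>s. s \<noteq> y \<Longrightarrow> \<bar>s - y\<bar> < e \<Longrightarrow> 0 < v s \<and> v' s < 0"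
        unfolding eventually_at dist_real_def by blast
      obtain s where "y \<le> s" "s < y + e" "\<not> (0 < v s \<and> d s < 0)" using S(3)[OF real e(1)] by blast
      then show False using e(2)[of s] d y0 n by (cases "s = y") auto
    qed
    moreover have "v y < b" if "0 < v y" "v' y = 0"
    proof (rule ccontr)
      assume "\<not> v y < b"
      then have vb: "b < v y" using critical_ne_b[OF y0 that(2)] that by auto
      define m where "m = (t + y) / 2"
      have m: "t < m" "m < y" using y by (auto simp: m_def)
      have "g y < g m"
      proof (rule g_antimono)
        show "b < v r" if "m \<le> r" "r \<le> y" for r using mono[of r y] that m real vb by simp
      qed (use m t in auto)
      moreover have "g m < 0" using g_sgn[of m] P[of m] m t real by simp
      ultimately show False using g_sgn[of y] y0 that by simp
    qed
    ultimately show ?thesis using real y by (cases "v y = 0") auto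
  next
    case PInf
    have low: "0 \<le> v r" if "t \<le> r" for r using P[of r] that PInf t b_pos by (cases "r = t") auto
    have anti: "v s \<le> v r" if "t \<le> r" "r \<le> s" for r s using mono[OF that] PInf by simp
    obtain l where "(v \<longlongrightarrow> l) at_top" "0 \<le> l"
      by (rule antimono_bounded_below_convergent[of t v, OF anti low]) blast+
    then show ?thesis using PInf by blast
  next
    case MInf then show ?thesis using S(1) by simp
  qed
qed

text \<open>The three ways in which an excursion from a zero (or from the starting point) can end: in a
  sign change, in a double zero or a decay to zero, or without ever returning to zero.\<close>

definition ends_crossing :: "ereal \<Rightarrow> real \<Rightarrow> bool" where
  "ends_crossing Z z \<longleftrightarrow> (\<exists>y>z. Z = ereal y \<and> v y = 0 \<and> v' y < 0 \<and> (\<forall>s. z < s \<and> s < y \<longrightarrow> 0 < v s))"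

definition ends_ground :: "ereal \<Rightarrow> real \<Rightarrow> bool" where
  "ends_ground Z z \<longleftrightarrow>
     ((\<exists>y>0. Z = ereal y \<and> v y = 0 \<and> v' y = 0) \<or> Z = \<infinity>) \<and> (v \<longlongrightarrow> 0) at_top \<and>
     (\<forall>r>0. 0 \<le> E r) \<and> (\<forall>r>z. 0 < v r \<or> v r = 0 \<and> v' r = 0) \<and>
     (\<exists>t\<ge>0. ereal t < Z \<and> (\<forall>s. t < s \<and> ereal s < Z \<longrightarrow> v' s < 0) \<and>
        {r \<in> axis_crossings v. z < r} = (if z = 0 then {} else {t}))"

definition ends_positive :: "ereal \<Rightarrow> real \<Rightarrow> bool" where
  "ends_positive Z z \<longleftrightarrow>
     ((\<exists>y>0. Z = ereal y \<and> 0 < v y) \<or> Z = \<infinity> \<and> (\<exists>l>0. (v \<longlongrightarrow> l) at_top)) \<and>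
     (\<exists>r>0. E r < 0) \<and> (\<forall>r>z. 0 < v r)"

text \<open>The limit is a zero of f, so 0 < l \<le> b, and E tends to F l < 0.\<close>

lemma positive_limit_E_neg: assumes "(v \<longlongrightarrow> l) at_top" "0 < l" shows "\<exists>r>0. E r < 0"
proof -
  have "F l < 0" using F_neg_le_b[of l] abs_limit_le_b[OF assms(1)] assms(2) by simp
  then have "\<forall>\<^sub>F r in at_top. E r < 0" by (rule order_tendstoD(2)[OF limit_imp(3)[OF assms(1)]])
  then have "\<forall>\<^sub>F r in at_top. E r < 0 \<and> 0 < r" using eventually_gt_at_top by (rule eventually_conj)
  from eventually_happens[OF this] show ?thesis by auto
qed

text \<open>The point t is the peak of the excursion; z = t = 0 is the initial one, which has no
  ascent.\<close>

lemma excursion_end: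
  assumes zt: "z = 0 \<and> t = 0 \<or> 0 < z \<and> z < t" and t: "b < v t" "t = 0 \<or> v' t = 0"
    and pos: "\<forall>s. z < s \<and> s \<le> t \<longrightarrow> 0 < v s" and inc: "\<forall>s. z < s \<and> s < t \<longrightarrow> 0 \<le> v' s"
    and d: "\<forall>s>0. d s = v' s"
    and Z: "Z = Sup {ereal r | r. t < r \<and> (\<forall>s. t < s \<and> s < r \<longrightarrow> 0 < v s \<and> d s < 0)}"
  shows "ends_crossing Z z \<or> ends_ground Z z \<or> ends_positive Z z"
proof -
  have t0: "0 \<le> t" using zt by auto
  note D = descent[OF t0 t d Z]
  have pos': "0 < v s" if "z < s" "ereal s < Z" for s
    using pos D(2)[of s] that by (cases "s \<le> t") auto
  have ground: "ends_ground Z z"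
    if A: "(\<exists>y>0. Z = ereal y \<and> v y = 0 \<and> v' y = 0) \<or> Z = \<infinity>" and lim: "(v \<longlongrightarrow> 0) at_top"
  proof -
    have E0: "0 \<le> E r" if "0 < r" for r
    proof (rule tendsto_upperbound[OF limit_imp(3)[OF lim], unfolded F_zero])
      show "\<forall>\<^sub>F x in at_top. E x \<le> E r"
        using eventually_ge_at_top[of r] by eventually_elim (use that E_antimono in blast)
    qed simp
    have after: "v r = 0 \<and> v' r = 0" if Zr: "Z \<le> ereal r" for r
    proof -
      obtain y where y: "0 < y" "Z = ereal y" "v y = 0" "v' y = 0" using A Zr by auto
      then have "y \<le> r" using Zr by simp
      then show ?thesis using double_zero[OF y(1,3,4)] double_zero_deriv[OF y(1,3,4)] by blast
    qed
    have "\<forall>r>z. 0 < v r \<or> v r = 0 \<and> v' r = 0"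
      using pos' after by (meson not_le)
    \<comment> \<open>Decay to zero keeps E \<ge> 0, so a critical point on the ascent has height at
      least \<beta> and v would turn there; hence only the peak is a crossing. For z = 0 the peak is
      the starting point, which \<open>axis_crossings\<close> omits.\<close>
    moreover have "{r \<in> axis_crossings v. z < r} = (if z = 0 then {} else {t})"
    proof -
      have "r = t \<and> z \<noteq> 0" if r: "r \<in> axis_crossings v" "z < r" for r
      proof -
        have r0: "0 < r" "v' r = 0" "v r \<noteq> 0" using axis_crossing_critical axis_crossing_nonzero r by blast+
        have "ereal r < Z" using after[of r] r0 by (meson not_le)
        then have "\<not> t < r" using D(2)[of r] r0 by auto
        moreover have "\<not> r < t"
        proof
          assume rt: "r < t"
          have "\<beta> \<le> \<bar>v r\<bar>" using critical_beta[OF r0(1,2) E0[OF r0(1)] r0(3)] .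
          then have "b < v r" using pos r(2) rt b_less_beta by auto
          then have "up_cross (Jcal v) 0 r" using critical_imp_cross(1)[OF r0(1,2)] f_pos by simp
          then have "\<forall>\<^sub>F x in at_right r. v' x < 0" using r0 by (simp add: up_cross_Jcal_iff)
          moreover have "\<forall>\<^sub>F x in at_right r. 0 \<le> v' x"
            unfolding eventually_at_right_field using rt inc r(2) by (intro exI[of _ t]) auto
          ultimately have "\<forall>\<^sub>F x in at_right r. False" by eventually_elim simp
          then show False by simp
        qed
        ultimately show ?thesis using zt r r0 by auto
      qed
      moreover have "t \<in> axis_crossings v \<and> z < t" if "z \<noteq> 0"
      proof -
        have "t \<noteq> 0" using that zt by simp
        then have "0 < t" "v' t = 0" using t zt by auto
        then have "up_cross (Jcal v) 0 t" using critical_imp_cross(1) f_pos t by blast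
        then show ?thesis using \<open>0 < t\<close> that zt by (auto simp: axis_crossings_def)
      qed
      ultimately show ?thesis by auto
    qed
    ultimately show ?thesis unfolding ends_ground_def using A lim E0 t0 D(1,2) by blast
  qed
  consider y where "t < y" "Z = ereal y" "v y = 0" "v' y < 0"
    | y where "t < y" "Z = ereal y" "v y = 0" "v' y = 0"
    | y where "t < y" "Z = ereal y" "0 < v y" "v y < b" "v' y = 0"
    | l where "Z = \<infinity>" "0 \<le> l" "(v \<longlongrightarrow> l) at_top"
    using D(3) by (metis less_eq_real_def)
  then show ?thesis
  proof cases
    case 1
    then have "ends_crossing Z z" unfolding ends_crossing_def using zt pos' by (intro exI[of _ y]) auto
    then show ?thesis by blast
  next
    case 2
    then have y0: "0 < y" using t0 by simp
    have "\<forall>\<^sub>F r in at_top. v r = 0"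
      using eventually_ge_at_top[of y] by eventually_elim (use double_zero[OF y0 2(3,4)] in blast)
    then have "(v \<longlongrightarrow> 0) at_top" by (rule tendsto_eventually)
    then show ?thesis using ground 2 y0 by blast
  next
    case 3
    then have y0: "0 < y" using t0 by simp
    \<comment> \<open>A stop at a height in (0,b) has energy F(v) < 0 and traps v on the positive
      side.\<close>
    have Ey: "E y < 0" using 3 F_neg_le_b[of "v y"] E_critical[of y] by simp
    have "0 < v r" if "z < r" for r
      using pos'[OF that] trapped_sign[OF y0 Ey 3(3), of r] 3(2) by (cases "r < y") auto
    then have "ends_positive Z z" unfolding ends_positive_def using 3 y0 Ey by blast
    then show ?thesis by blast
  next
    case 4
    show ?thesis
    proof (cases "l = 0")
      case True then show ?thesis using ground 4 by blast
    next
      case False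
      then have l: "0 < l" using 4(2) by simp
      have "\<forall>r>z. 0 < v r" using pos' 4(1) by simp
      then have "ends_positive Z z"
        unfolding ends_positive_def using 4(1,3) l positive_limit_E_neg[OF 4(3) l] by blast
      then show ?thesis by blast
    qed
  qed
qed

lemma excursion:
  assumes z: "at_start z" and d: "\<forall>s>0. d s = v' s"
  shows "ends_crossing (next_time v d z) z \<or> ends_ground (next_time v d z) z \<or> ends_positive (next_time v d z) z"
proof (cases "z = 0")
  case True
  then have "0 < a" using z by (simp add: at_start_def)
  then have "b < v 0" using a v_0 b_less_beta by simp
  then show ?thesis
    using excursion_end[of z 0 d, OF _ _ _ _ _ d refl] True by (simp add: next_time_def)
next
  case False
  then have z: "0 < z" "v z = 0" "0 < v' z" using z by (auto simp: at_start_def)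
  define T where "T = Sup {ereal r | r. z < r \<and> (\<forall>s. z < s \<and> s < r \<longrightarrow> 0 \<le> d s)}"
  from z d T_def show ?thesis
  proof (cases rule: ascent)
    case (turn t)
    then have n: "next_time v d z = Sup {ereal r | r. t < r \<and> (\<forall>s. t < s \<and> s < r \<longrightarrow> 0 < v s \<and> d s < 0)}"
      unfolding next_time_def T_def[symmetric] using z by simp
    show ?thesis
      by (rule excursion_end[OF _ turn(4) _ _ _ d n]) (use turn z in auto)
  next
    case (asymptotic l)
    then have "next_time v d z = \<infinity>"
      unfolding next_time_def T_def[symmetric] using z by simp
    then have "ends_positive (next_time v d z) z"
      unfolding ends_positive_def using asymptotic positive_limit_E_neg[OF asymptotic(3,2)] by blast
    then show ?thesis by blast
  qed
qed


section \<open>Normalising the sign of an excursion\<close>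

lemma signed: "radial_ode f b \<beta> N (\<lambda>r. (-1) ^ n * v r) ((-1) ^ n * a)"
  using neg radial_ode_axioms by (cases "even n") simp_all

lemma deriv_signed: "0 < r \<Longrightarrow> deriv (\<lambda>r. (-1) ^ n * v r) r = (-1) ^ n * v' r"
  by (rule DERIV_imp_deriv) (intro DERIV_cmult v_deriv)

lemma E_signed: assumes "0 < r" shows "radial_ode.E f (\<lambda>r. (-1) ^ n * v r) r = E r"
proof -
  interpret w: radial_ode f b \<beta> N "\<lambda>r. (-1) ^ n * v r" "(-1) ^ n * a" by (rule signed)
  show ?thesis unfolding w.E_def E_def deriv_signed[OF assms] by (cases "even n") simp_all
qed

lemma crossings_signed:
  "zero_crossings (\<lambda>r. (-1) ^ n * v r) = zero_crossings v"
  "axis_crossings (\<lambda>r. (-1) ^ n * v r) = axis_crossings v"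
  using zero_crossings_neg axis_crossings_neg by (cases "even n", simp_all)+

lemma tendsto_signed: assumes "((\<lambda>r. (-1) ^ n * v r) \<longlongrightarrow> l) F'" shows "(v \<longlongrightarrow> (-1) ^ n * l) F'"
  using tendsto_mult[OF tendsto_const assms, of "(-1) ^ n"] by (simp add: mult.assoc[symmetric] power_mult_distrib[symmetric])

subsection \<open>The last excursion\<close>

text \<open>On the half line of s b, \<open>up_cross_Jcal_imp\<close> and
  \<open>down_cross_Jcal_imp\<close> leave only crossings on the correct side of the centre, and
  \<open>critical_ne_b\<close> makes the slope nonzero whenever v = s b.\<close>

lemma rotates_about_b:
  assumes s: "s = 1 \<or> s = -1" and I: "\<And>r. r \<in> I \<Longrightarrow> 0 < r \<and> (0 < s * v r \<or> v r = 0 \<and> v' r = 0)"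
  shows "rotates_about v (s * b) I"
  unfolding rotates_about_def
proof (intro ballI conjI impI)
  fix r assume "r \<in> I"
  then have r: "0 < r" "0 \<le> s * v r" using I[of r] by auto
  have nz: "v' r \<noteq> 0" if "v r = s * b" using critical_ne_b[OF r(1)] that s b_pos by auto
  show "curve v r \<noteq> (s * b, 0)" using nz r by (auto simp: curve_def Jcal_pos)
  show "s * b < v r" if "up_cross (Jcal v) 0 r" using up_cross_Jcal_imp[OF r(1) that] s r b_pos by auto
  show "v r < s * b" if "down_cross (Jcal v) 0 r" using down_cross_Jcal_imp[OF r(1) that] s r b_pos by auto
  show "0 < Jcal v r" if "down_cross v (s * b) r"
    using down_cross_v_imp[OF r(1) that] nz r(1) by (simp add: Jcal_pos divide_less_0_iff)
  show "Jcal v r < 0" if "up_cross v (s * b) r"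
    using up_cross_v_imp[OF r(1) that] nz r(1) by (simp add: Jcal_pos zero_less_divide_iff)
qed

text \<open>With E > 0 zeros are simple and critical points have |v| \<ge> \<beta> > b, which rules
  out the axis crossings that belong to a rotation about \<plusminus>b alone.\<close>

lemma rotates_about_0:
  assumes I: "\<And>r. r \<in> I \<Longrightarrow> 0 < r \<and> 0 < E r"
  shows "rotates_about v 0 I"
  unfolding rotates_about_def
proof (intro ballI conjI impI)
  fix r assume "r \<in> I"
  then have r: "0 < r" "0 < E r" using I[of r] by auto
  have nz: "v' r \<noteq> 0" if "v r = 0" using r that by (auto simp: E_def)
  have big: "b < \<bar>v r\<bar>" if "v' r = 0"
    using critical_beta[OF r(1) that] nz r that b_less_beta by fastforce
  show "curve v r \<noteq> (0, 0)" using nz r by (auto simp: curve_def Jcal_pos)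
  show "0 < v r" if "up_cross (Jcal v) 0 r"
    using up_cross_Jcal_imp[OF r(1) that] big that r(1) b_pos by (auto simp: up_cross_Jcal_iff)
  show "v r < 0" if "down_cross (Jcal v) 0 r"
    using down_cross_Jcal_imp[OF r(1) that] big that r(1) b_pos by (auto simp: down_cross_Jcal_iff)
  show "0 < Jcal v r" if "down_cross v 0 r"
    using down_cross_v_imp[OF r(1) that] nz r(1) by (simp add: Jcal_pos divide_less_0_iff)
  show "Jcal v r < 0" if "up_cross v 0 r"
    using up_cross_v_imp[OF r(1) that] nz r(1) by (simp add: Jcal_pos zero_less_divide_iff)
qed

lemma positive_end:
  assumes z: "0 \<le> z" "\<forall>r>z. 0 < v r" and E: "\<exists>r>0. E r < 0"
  shows "no_interior_zero f b \<Longrightarrow> (v \<longlongrightarrow> b) at_top"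
    "no_interior_zero f b \<Longrightarrow> finite {r \<in> axis_crossings v. z < r} \<Longrightarrow> \<exists>R\<ge>0. \<forall>r>R. v' r \<noteq> 0"
    "infinite {r \<in> axis_crossings v. z < r} \<Longrightarrow>
      (\<exists>r>R. up_cross (Jcal v) 0 r) \<and> (\<exists>r>R. down_cross (Jcal v) 0 r)"
proof -
  obtain r1 where r1: "0 < r1" "E r1 < 0" using E by blast
  \<comment> \<open>Late enough for negative energy and strictly inside the last excursion.\<close>
  define r0 where "r0 = max r1 (z + 1)"
  have r0: "0 < r0" "E r0 < 0" "0 < v r0" "z < r0"
    using z r1 E_antimono[of r1 r0] by (auto simp: r0_def)
  show "(v \<longlongrightarrow> b) at_top" if "no_interior_zero f b" using trapped_tendsto[OF that r0(1-3)] .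
  show "\<exists>R\<ge>0. \<forall>r>R. v' r \<noteq> 0"
    if nz: "no_interior_zero f b" and fin: "finite {r \<in> axis_crossings v. z < r}"
  proof -
    obtain R where R: "\<And>r. r \<in> axis_crossings v \<Longrightarrow> z < r \<Longrightarrow> r \<le> R"
      using bdd_above_finite[OF fin] unfolding bdd_above_def by blast
    \<comment> \<open>f vanishes at no positive height other than b, and b is no critical height, so
      a late critical point would be a further crossing.\<close>
    have "v' r \<noteq> 0" if r: "max r0 R < r" for r
    proof
      assume v'r: "v' r = 0"
      have rp: "0 < r" "z < r" "0 < v r" using r r0 z(2) by auto
      have "v r \<noteq> b" using critical_ne_b[OF rp(1) v'r] rp(3) by simp
      then have "f (v r) \<noteq> 0"
        using f_pos[of "v r"] bspec[OF nz[unfolded no_interior_zero_def], of "v r"] rp(3)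
        by (cases "v r < b") auto
      then have "r \<in> axis_crossings v"
        using critical_imp_cross[OF rp(1) v'r] rp(1) unfolding axis_crossings_def by (cases "0 < f (v r)") auto
      then show False using R[of r] rp r by simp
    qed
    then show ?thesis using r0(1) by (intro exI[of _ "max r0 R"]) auto
  qed
  show "(\<exists>r>R. up_cross (Jcal v) 0 r) \<and> (\<exists>r>R. down_cross (Jcal v) 0 r)"
    if "infinite {r \<in> axis_crossings v. z < r}"
  proof -
    have pos: "0 < v r" if "r0 \<le> r" for r using z(2) r0(4) that by simp
    have unb: "\<exists>r>R. r \<in> axis_crossings v" for R
      using infinite_axis_crossings_unbounded[OF that] .
    show ?thesis using infinitely_many_crossings[OF unb r0(1) pos] by blast
  qed
qed

lemma positive_end_signed:
  assumes z: "0 \<le> z" "\<forall>r>z. 0 < (-1) ^ n * v r" and E: "\<exists>r>0. E r < 0"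
  shows "no_interior_zero f b \<Longrightarrow> (v \<longlongrightarrow> (-1) ^ n * b) at_top"
    "no_interior_zero f b \<Longrightarrow> finite {r \<in> axis_crossings v. z < r} \<Longrightarrow> J_ends_at v ((-1) ^ n * b)"
    "infinite {r \<in> axis_crossings v. z < r} \<Longrightarrow>
      (\<exists>r>R. up_cross (Jcal v) 0 r) \<and> (\<exists>r>R. down_cross (Jcal v) 0 r)"
proof -
  interpret w: radial_ode f b \<beta> N "\<lambda>r. (-1) ^ n * v r" "(-1) ^ n * a" by (rule signed)
  have "\<exists>r>0. w.E r < 0" using E E_signed by metis
  note W = w.positive_end[OF z this, unfolded crossings_signed]
  show lim: "(v \<longlongrightarrow> (-1) ^ n * b) at_top" if "no_interior_zero f b"
    using tendsto_signed[OF W(1)[OF that]] .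
  show "J_ends_at v ((-1) ^ n * b)"
    if nz: "no_interior_zero f b" and fin: "finite {r \<in> axis_crossings v. z < r}"
  proof -
    obtain R where R: "R \<ge> 0" "\<forall>r>R. w.v' r \<noteq> 0" using W(2)[OF nz fin] by blast
    then have v'nz: "v' r \<noteq> 0" if "r \<in> {R<..}" for r using that by (auto simp: deriv_signed)
    have "continuous_on {R<..} v'"
      using R(1) by (intro continuous_at_imp_continuous_on ballI v'_isCont) simp
    then have "monotone_branch v {R<..}"
      unfolding monotone_branch_def by (rule nonzero_constant_sign[rotated]) (use v'nz in \<open>auto simp: is_interval_1\<close>)
    then show ?thesis
      using R(1) by (intro J_ends_atI[of R \<infinity>] lim[OF nz] limit_imp(1)[OF lim[OF nz]]) (auto simp: greaterThan_def)
  qed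
  show "(\<exists>r>R. up_cross (Jcal v) 0 r) \<and> (\<exists>r>R. down_cross (Jcal v) 0 r)"
    if inf: "infinite {r \<in> axis_crossings v. z < r}"
  proof (cases "even n")
    case True then show ?thesis using W(3)[OF inf, of R] by simp
  next
    case False
    \<comment> \<open>Crossings of -v and of v are exchanged only at positive times, hence the
      maximum with 0.\<close>
    then have 1: "\<exists>r>max 0 R. up_cross (Jcal (\<lambda>r. - v r)) 0 r" "\<exists>r>max 0 R. down_cross (Jcal (\<lambda>r. - v r)) 0 r"
      using W(3)[OF inf, of "max 0 R"] by simp_all
    then show ?thesis using up_cross_Jcal_neg by (meson max_less_iff_conj)
  qed
qed

lemma Jcal_tendsto_0: assumes "(v \<longlongrightarrow> l) at_top" shows "(Jcal v \<longlongrightarrow> 0) at_top"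
proof (rule Lim_transform_eventually)
  show "((\<lambda>r. - v' r / r) \<longlongrightarrow> 0) at_top"
    using tendsto_divide_0[OF tendsto_minus[OF limit_imp(1)[OF assms]] filterlim_at_top_imp_at_infinity[OF filterlim_ident]] by simp
  show "\<forall>\<^sub>F r in at_top. - v' r / r = Jcal v r"
    using eventually_gt_at_top[of 0] by eventually_elim (simp add: Jcal_pos)
qed

subsection \<open>Counting the sign changes\<close>

text \<open>z is the n-th sign change, or 0 if n = 0. The count ties \<open>Z_time\<close>, a nested
  supremum, to the set \<open>zero_crossings\<close>.\<close>

definition stage :: "nat \<Rightarrow> real \<Rightarrow> bool" where
  "stage n z \<longleftrightarrow> (n = 0 \<and> z = 0 \<or> 0 < n \<and> 0 < z \<and> v z = 0 \<and> 0 < (-1) ^ n * v' z) \<and>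
     Z_time v n = ereal z \<and> card (zero_crossings v \<inter> {..z}) = n"

definition ground_end :: "nat \<Rightarrow> real \<Rightarrow> bool" where
  "ground_end n z \<longleftrightarrow> (v \<longlongrightarrow> 0) at_top \<and> J_ends_at v 0 \<and>
     (\<forall>r>z. 0 < (-1) ^ n * v r \<or> v r = 0 \<and> v' r = 0) \<and>
     (\<exists>t. {r \<in> axis_crossings v. z < r} = (if z = 0 then {} else {t}))"

text \<open>The three outcomes of an excursion of (-1)^n v become membership in the next
  \<open>Nset\<close>, \<open>Gset\<close> or \<open>Pset\<close>; in the last two cases no sign
  change lies beyond z.\<close>

lemma stage_step:
  fixes u :: "real \<Rightarrow> real \<Rightarrow> real"
  assumes u: "u a = v" and a0: "0 < a" and st: "stage n z" and Nn: "a \<in> Nset \<beta> u n"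
  shows "(\<exists>y. stage (Suc n) y \<and> a \<in> Nset \<beta> u (Suc n)) \<or>
    a \<notin> Nset \<beta> u (Suc n) \<and> zero_crossings v \<subseteq> {..z} \<and>
      (a \<in> Gset \<beta> u (Suc n) \<and> ground_end n z \<or>
       a \<in> Pset \<beta> u (Suc n) \<and> (\<forall>r>z. 0 < (-1) ^ n * v r) \<and> (\<exists>r>0. E r < 0))"
proof -
  interpret w: radial_ode f b \<beta> N "\<lambda>r. (-1) ^ n * v r" "(-1) ^ n * a" by (rule signed)
  have z: "0 \<le> z" "z = 0 \<longleftrightarrow> n = 0" using st by (auto simp: stage_def)
  have sq: "(-1) ^ n * ((-1) ^ n * x) = x" for x :: real by (simp add: mult.assoc[symmetric] power_mult_distrib[symmetric])
  have "w.at_start z" using st a0 by (auto simp: stage_def w.at_start_def deriv_signed)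
  moreover have "\<forall>s>0. (-1) ^ n * v' s = w.v' s" by (simp add: deriv_signed)
  moreover define Z where "Z = Z_time v (Suc n)"
  have "Z = next_time (\<lambda>s. (-1) ^ n * v s) (\<lambda>s. (-1) ^ n * v' s) z"
    unfolding Z_def using st z by (intro Z_time_Suc) (auto simp: stage_def)
  ultimately consider "w.ends_crossing Z z" | "w.ends_ground Z z" | "w.ends_positive Z z"
    using w.excursion by metis
  then show ?thesis
  proof cases
    case 1
    then obtain y where y: "z < y" "Z = ereal y" "v y = 0" "w.v' y < 0" "\<forall>s. z < s \<and> s < y \<longrightarrow> 0 < (-1) ^ n * v s"
      unfolding w.ends_crossing_def by auto
    have y0: "0 < y" using y z by simp
    have v'y: "(-1) ^ n * v' y < 0" using y(4) deriv_signed[OF y0] by simp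
    \<comment> \<open>v keeps its sign strictly between z and y, so y is the only new sign change
      and the count rises by one.\<close>
    have "zero_crossings v \<inter> {..y} = insert y (zero_crossings v \<inter> {..z})"
    proof (intro equalityI subsetI)
      fix r assume r: "r \<in> zero_crossings v \<inter> {..y}"
      then have "\<not> (z < r \<and> r < y)" using y(5) by (auto simp: zero_crossing_iff)
      then show "r \<in> insert y (zero_crossings v \<inter> {..z})" using r by auto
    qed (use y y0 v'y in \<open>auto simp: zero_crossing_iff\<close>)
    moreover have "y \<notin> zero_crossings v \<inter> {..z}" using y by simp
    ultimately have "card (zero_crossings v \<inter> {..y}) = Suc n"
      using st finite_zero_crossings by (simp add: stage_def)
    then have "stage (Suc n) y"
      using y y0 v'y by (simp add: stage_def Z_def)
    moreover have "a \<in> Nset \<beta> u (Suc n)"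
      using Nn u y v'y by (simp add: at_time_def Z_def[symmetric])
    ultimately show ?thesis by blast
  next
    case 2
    then have G: "(\<exists>y>0. Z = ereal y \<and> (-1) ^ n * v y = 0 \<and> w.v' y = 0) \<or> Z = \<infinity>"
      "((\<lambda>r. (-1) ^ n * v r) \<longlongrightarrow> 0) at_top"
      "\<And>r. z < r \<Longrightarrow> 0 < (-1) ^ n * v r \<or> (-1) ^ n * v r = 0 \<and> w.v' r = 0"
      "\<exists>t\<ge>0. ereal t < Z \<and> (\<forall>s. t < s \<and> ereal s < Z \<longrightarrow> w.v' s < 0) \<and>
        {r \<in> axis_crossings v. z < r} = (if z = 0 then {} else {t})"
      unfolding w.ends_ground_def crossings_signed by blast+
    have lim: "(v \<longlongrightarrow> 0) at_top" using tendsto_signed[OF G(2)] by simp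
    have Zc: "(\<exists>y>0. Z = ereal y \<and> v y = 0 \<and> v' y = 0) \<or> Z = \<infinity>"
      using G(1) deriv_signed by fastforce
    have at: "at_time v Z = 0" "at_time v' Z = 0"
      using Zc lim limit_imp(1)[OF lim] by (auto simp: at_time_def intro!: tendsto_Lim)
    have sgn: "\<forall>r>z. 0 < (-1) ^ n * v r \<or> v r = 0 \<and> v' r = 0"
    proof (intro allI impI)
      fix r assume r: "z < r"
      show "0 < (-1) ^ n * v r \<or> v r = 0 \<and> v' r = 0" using G(3)[OF r] deriv_signed[of r n] r z by auto
    qed
    obtain t where t: "0 \<le> t" "ereal t < Z" "\<forall>s. t < s \<and> ereal s < Z \<longrightarrow> w.v' s < 0"
      "{r \<in> axis_crossings v. z < r} = (if z = 0 then {} else {t})" using G(4) by blast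
    have "J_ends_at v 0"
    proof (rule J_ends_atI[OF t(1,2) _ _ lim _ limit_imp(1)[OF lim]])
      have "(-1) ^ n * v' s < 0" if "t < s" "ereal s < Z" for s
        using t(1,3) that deriv_signed[of s n] by auto
      then show "monotone_branch v {r. t < r \<and> ereal r < Z}"
        unfolding monotone_branch_def by (cases "even n") auto
      show "v r = 0 \<and> v' r = 0" if Zr: "Z \<le> ereal r" for r
      proof -
        obtain y where y: "0 < y" "Z = ereal y" "v y = 0" "v' y = 0" using Zc Zr by auto
        then have "y \<le> r" using Zr by simp
        then show ?thesis using double_zero[OF y(1,3,4)] double_zero_deriv[OF y(1,3,4)] by blast
      qed
      show "Z = ereal (real_of_ereal Z)" if "Z \<noteq> \<infinity>" using Zc that by auto
    qed
    then have "ground_end n z" unfolding ground_end_def using lim sgn t(4) by blast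
    moreover have "zero_crossings v \<subseteq> {..z}"
      using sgn by (force simp: zero_crossing_iff not_le[symmetric])
    moreover have "a \<notin> Nset \<beta> u (Suc n)" using at u by (simp add: Z_def)
    moreover have "a \<in> Gset \<beta> u (Suc n)" using at u Nn by (simp add: Gset_def Z_def)
    ultimately show ?thesis by blast
  next
    case 3
    then have G: "(\<exists>y>0. Z = ereal y \<and> 0 < (-1) ^ n * v y) \<or> Z = \<infinity> \<and> (\<exists>l>0. ((\<lambda>r. (-1) ^ n * v r) \<longlongrightarrow> l) at_top)"
      "\<exists>r>0. w.E r < 0" "\<forall>r>z. 0 < (-1) ^ n * v r"
      unfolding w.ends_positive_def by blast+
    have at: "0 < (-1) ^ n * at_time v Z"
      using G(1)
    proof
      assume "Z = \<infinity> \<and> (\<exists>l>0. ((\<lambda>r. (-1) ^ n * v r) \<longlongrightarrow> l) at_top)"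
      then obtain l where l: "Z = \<infinity>" "0 < l" "((\<lambda>r. (-1) ^ n * v r) \<longlongrightarrow> l) at_top" by blast
      have "at_time v Z = (-1) ^ n * l"
        using tendsto_signed[OF l(3)] l(1) by (simp add: at_time_def tendsto_Lim)
      then show ?thesis using l(2) sq by simp
    qed (auto simp: at_time_def)
    have "\<exists>r>0. E r < 0" using G(2) E_signed by metis
    moreover have "zero_crossings v \<subseteq> {..z}"
      using G(3) by (force simp: zero_crossing_iff not_le[symmetric])
    moreover have "a \<notin> Nset \<beta> u (Suc n)" using at u by (auto simp: Z_def)
    moreover have "a \<in> Pset \<beta> u (Suc n)" using at u Nn by (simp add: Pset_def Z_def)
    ultimately show ?thesis using G(3) by blast
  qed
qed

text \<open>As long as not all sign changes have been passed, one lies beyond z, and this excludes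
  the two final alternatives of \<open>stage_step\<close>.\<close>

lemma stage_reached:
  assumes u: "u a = v" and a0: "0 < a" and n: "n \<le> card (zero_crossings v)"
  shows "\<exists>z. stage n z \<and> a \<in> Nset \<beta> u n"
  using n
proof (induction n)
  case 0
  have "zero_crossings v \<inter> {..0} = {}" by (auto simp: zero_crossing_iff)
  then show ?case using a a0 by (auto simp: stage_def zero_ereal_def)
next
  case (Suc n)
  then obtain z where z: "stage n z" "a \<in> Nset \<beta> u n" by auto
  have "\<not> zero_crossings v \<subseteq> {..z}"
  proof
    assume "zero_crossings v \<subseteq> {..z}"
    then have "zero_crossings v \<inter> {..z} = zero_crossings v" by blast
    then show False using z(1) Suc.prems by (simp add: stage_def)
  qed
  then show ?case using stage_step[of u, OF u a0 z] by blast
qed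

text \<open>Stage k + 1 would need more sign changes than there are, so the excursion after stage k
  is the last. It starts at the maximum of \<open>zero_crossings\<close>, or at 0 if there are
  none.\<close>

lemma last_stage:
  assumes u: "u a = v" and a0: "0 < a" and k: "k = card (zero_crossings v)"
  defines "z \<equiv> last_zero_crossing v"
  shows "stage k z" "a \<in> Nset \<beta> u k" "a \<notin> Nset \<beta> u (Suc k)"
    "a \<in> Gset \<beta> u (Suc k) \<and> ground_end k z \<or>
     a \<in> Pset \<beta> u (Suc k) \<and> (\<forall>r>z. 0 < (-1) ^ k * v r) \<and> (\<exists>r>0. E r < 0)"
proof -
  obtain y where y: "stage k y" "a \<in> Nset \<beta> u k" using stage_reached[of u, OF u a0, of k] k by auto
  have no: "\<not> stage (Suc k) x" for x
  proof
    assume "stage (Suc k) x"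
    then have "card (zero_crossings v \<inter> {..x}) = Suc k" by (simp add: stage_def)
    then show False using card_mono[OF finite_zero_crossings, of "zero_crossings v \<inter> {..x}"] k by simp
  qed
  have S: "a \<notin> Nset \<beta> u (Suc k) \<and> zero_crossings v \<subseteq> {..y} \<and>
      (a \<in> Gset \<beta> u (Suc k) \<and> ground_end k y \<or>
       a \<in> Pset \<beta> u (Suc k) \<and> (\<forall>r>y. 0 < (-1) ^ k * v r) \<and> (\<exists>r>0. E r < 0))"
    using stage_step[of u, OF u a0 y] no by blast
  have "z = y"
  proof (cases "k = 0")
    case True
    then have "zero_crossings v = {}" using k finite_zero_crossings by simp
    then show ?thesis using y True by (simp add: z_def last_zero_crossing_def stage_def)
  next
    case False
    then have "y \<in> zero_crossings v" using y by (auto simp: stage_def zero_crossing_iff)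
    then show ?thesis using S finite_zero_crossings
      by (auto simp: z_def last_zero_crossing_def intro!: Max_eqI)
  qed
  then show "stage k z" "a \<in> Nset \<beta> u k" "a \<notin> Nset \<beta> u (Suc k)"
    "a \<in> Gset \<beta> u (Suc k) \<and> ground_end k z \<or>
     a \<in> Pset \<beta> u (Suc k) \<and> (\<forall>r>z. 0 < (-1) ^ k * v r) \<and> (\<exists>r>0. E r < 0)"
    using y S by auto
qed

end

section \<open>The complete curve\<close>

theorem proposition3p2:
  fixes N \<alpha> b \<beta> :: real and f :: "real \<Rightarrow> real" and u :: "real \<Rightarrow> real \<Rightarrow> real"
    and k :: nat and j :: enat and c :: real
  assumes "N > 2" and "H1 f b \<beta>"
    and "\<alpha> > \<beta>" and "radial_solution N f \<alpha> (u \<alpha>)"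
    and k: "k = card (zero_crossings (u \<alpha>))"
    and j: "j = final_axis_count (u \<alpha>)"
    and c: "c = (-1) ^ k * b"
  shows
    "\<comment> \<open>the curve consists of the graphs of J and J-bar\<close>
     (\<forall>I. is_interval I \<and> open I \<and> I \<subseteq> {0<..} \<and> monotone_branch (u \<alpha>) I \<longrightarrow>
        curve (u \<alpha>) ` I = (\<lambda>s. (s, J_branch (u \<alpha>) I s)) ` (u \<alpha> ` I)) \<and>
     \<comment> \<open>(i)\<close>
     curve (u \<alpha>) 0 = (\<alpha>, f \<alpha> / N) \<and> continuous_on {0..} (curve (u \<alpha>)) \<and>
     moves_counterclockwise (u \<alpha>) \<and> winds_inwards (u \<alpha>) \<and> no_self_intersection (u \<alpha>) \<and>
     \<comment> \<open>(ii)\<close>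
     finite (zero_crossings (u \<alpha>)) \<and>
     rotates_about (u \<alpha>) 0 {0<..last_zero_crossing (u \<alpha>)} \<and>
     (\<forall>r\<in>{0<..last_zero_crossing (u \<alpha>)}. Jcal (u \<alpha>) r = 0 \<longrightarrow> u \<alpha> r \<notin> {-\<beta><..<\<beta>}) \<and>
     \<alpha> \<in> Nset \<beta> u k \<and> \<alpha> \<notin> Nset \<beta> u (k + 1) \<and>
     \<comment> \<open>(iii)\<close>
     rotates_about (u \<alpha>) c {last_zero_crossing (u \<alpha>)<..} \<and>
     (j = 0 \<longrightarrow>
        (no_interior_zero f b \<longrightarrow> J_ends_at (u \<alpha>) c \<and> (u \<alpha> \<longlongrightarrow> c) at_top) \<and>
        \<alpha> \<in> Pset \<beta> u (k + 1)) \<and>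
     (j = 1 \<longrightarrow>
        (no_interior_zero f b \<longrightarrow> J_ends_at (u \<alpha>) c \<and> (u \<alpha> \<longlongrightarrow> c) at_top) \<and>
          \<alpha> \<in> Pset \<beta> u (k + 1) \<or>
        J_ends_at (u \<alpha>) 0 \<and> \<alpha> \<in> Gset \<beta> u (k + 1) \<and> bound_state N f (k + 1) (u \<alpha>)) \<and>
     (j \<ge> 2 \<longrightarrow>
        \<alpha> \<in> Pset \<beta> u (k + 1) \<and>
        (no_interior_zero f b \<longrightarrow>
           (u \<alpha> \<longlongrightarrow> c) at_top \<and> (Jcal (u \<alpha>) \<longlongrightarrow> 0) at_top \<and> (j \<noteq> \<infinity> \<longrightarrow> J_ends_at (u \<alpha>) c)) \<and>
        (j = \<infinity> \<longrightarrow>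
           (\<forall>R. \<exists>r>R. up_cross (Jcal (u \<alpha>)) 0 r) \<and> (\<forall>R. \<exists>r>R. down_cross (Jcal (u \<alpha>)) 0 r)))"
proof -
  have "\<beta> > 0" using nonlinearity.b_less_beta[of f b \<beta>] nonlinearity.b_pos[of f b \<beta>] assms(2)
    by (simp add: nonlinearity_def)
  then have a0: "0 < \<alpha>" using assms(3) by simp
  interpret radial_ode f b \<beta> N "u \<alpha>" \<alpha>
    by unfold_locales (use assms a0 in auto)
  define z where "z = last_zero_crossing (u \<alpha>)"
  note S = last_stage[of u, OF refl a0 k, folded z_def]
  have z: "0 \<le> z" "z = 0 \<longleftrightarrow> k = 0" using S(1) by (auto simp: stage_def)
  have k0: "k = 0 \<longleftrightarrow> zero_crossings (u \<alpha>) = {}" using k finite_zero_crossings by simp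
  have sgn: "(-1) ^ k = (1::real) \<or> (-1) ^ k = (-1::real)" by (cases "even k") auto
  \<comment> \<open>The last sign change is a simple zero, so E is positive there and hence before;
    for k = 0 the range of r is empty.\<close>
  have Epos: "0 < E r" if "0 < r" "r \<le> z" for r
  proof -
    have "0 < E z" using S(1) that by (auto simp: stage_def E_def)
    then show ?thesis using E_antimono[OF that] by simp
  qed
  have after: "\<forall>r>z. 0 < (-1) ^ k * u \<alpha> r \<or> u \<alpha> r = 0 \<and> v' r = 0"
    using S(4) unfolding ground_end_def by blast
  have jdef: "j = ecard {r \<in> axis_crossings (u \<alpha>). z < r} + (if z = 0 then 1 else 0)"
    using j z k0 by (simp add: final_axis_count_def z_def)
  have part1: "\<forall>I. is_interval I \<and> open I \<and> I \<subseteq> {0<..} \<and> monotone_branch (u \<alpha>) I \<longrightarrow>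
        curve (u \<alpha>) ` I = (\<lambda>s. (s, J_branch (u \<alpha>) I s)) ` (u \<alpha> ` I)"
    using curve_eq_graph by blast
  have curve0: "curve (u \<alpha>) 0 = (\<alpha>, f \<alpha> / N)" by (simp add: curve_def v_0 Jcal_0)
  have rot0: "rotates_about (u \<alpha>) 0 {0<..z}" by (rule rotates_about_0) (use Epos in auto)
  have crit: "\<forall>r\<in>{0<..z}. Jcal (u \<alpha>) r = 0 \<longrightarrow> u \<alpha> r \<notin> {-\<beta><..<\<beta>}"
  proof (intro ballI impI)
    fix r assume r: "r \<in> {0<..z}" "Jcal (u \<alpha>) r = 0"
    then have c: "0 < r" "v' r = 0" "0 < E r" using Epos by (auto simp: Jcal_pos)
    then have "u \<alpha> r \<noteq> 0" by (auto simp: E_def)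
    then have "\<beta> \<le> \<bar>u \<alpha> r\<bar>" using critical_beta c by simp
    then show "u \<alpha> r \<notin> {-\<beta><..<\<beta>}" by auto
  qed
  have rotb: "rotates_about (u \<alpha>) c {z<..}"
    unfolding c by (rule rotates_about_b[OF sgn]) (use after z in auto)
  have ends: "(j = 0 \<longrightarrow>
        (no_interior_zero f b \<longrightarrow> J_ends_at (u \<alpha>) c \<and> (u \<alpha> \<longlongrightarrow> c) at_top) \<and>
        \<alpha> \<in> Pset \<beta> u (k + 1)) \<and>
     (j = 1 \<longrightarrow>
        (no_interior_zero f b \<longrightarrow> J_ends_at (u \<alpha>) c \<and> (u \<alpha> \<longlongrightarrow> c) at_top) \<and>
          \<alpha> \<in> Pset \<beta> u (k + 1) \<or>
        J_ends_at (u \<alpha>) 0 \<and> \<alpha> \<in> Gset \<beta> u (k + 1) \<and> bound_state N f (k + 1) (u \<alpha>)) \<and>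
     (j \<ge> 2 \<longrightarrow>
        \<alpha> \<in> Pset \<beta> u (k + 1) \<and>
        (no_interior_zero f b \<longrightarrow>
           (u \<alpha> \<longlongrightarrow> c) at_top \<and> (Jcal (u \<alpha>) \<longlongrightarrow> 0) at_top \<and> (j \<noteq> \<infinity> \<longrightarrow> J_ends_at (u \<alpha>) c)) \<and>
        (j = \<infinity> \<longrightarrow>
           (\<forall>R. \<exists>r>R. up_cross (Jcal (u \<alpha>)) 0 r) \<and> (\<forall>R. \<exists>r>R. down_cross (Jcal (u \<alpha>)) 0 r)))"
    using S(4)
  proof
    assume G: "\<alpha> \<in> Gset \<beta> u (Suc k) \<and> ground_end k z"
    then obtain t where t: "{r \<in> axis_crossings (u \<alpha>). z < r} = (if z = 0 then {} else {t})"
      and lim: "(u \<alpha> \<longlongrightarrow> 0) at_top" and J: "J_ends_at (u \<alpha>) 0"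
      unfolding ground_end_def by blast
    \<comment> \<open>The one intersection is the peak after the last sign change, or the starting
      point counted by convention if v never changes sign.\<close>
    have j1: "j = 1" unfolding jdef t by (simp add: ecard_def one_enat_def zero_enat_def)
    have "\<exists>r>0. u \<alpha> r \<noteq> u \<alpha> 0" using abs_v_less[of 1] v_0 a0 by (intro exI[of _ 1]) auto
    then have "bound_state N f (k + 1) (u \<alpha>)"
      unfolding bound_state_def using assms(4) v_0 lim finite_zero_crossings k by simp
    moreover have "\<not> (2::enat) \<le> 1" by (simp add: one_enat_def numeral_eq_enat)
    ultimately show ?thesis using j1 J G by simp
  next
    assume P: "\<alpha> \<in> Pset \<beta> u (Suc k) \<and> (\<forall>r>z. 0 < (-1) ^ k * u \<alpha> r) \<and> (\<exists>r>0. E r < 0)"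
    then have P': "\<forall>r>z. 0 < (-1) ^ k * u \<alpha> r" "\<exists>r>0. E r < 0" by blast+
    note W = positive_end_signed[OF z(1) P', folded c]
    have jinf: "j = \<infinity> \<longleftrightarrow> infinite {r \<in> axis_crossings (u \<alpha>). z < r}"
      unfolding jdef by (auto simp: ecard_def plus_enat_def split: enat.split)
    \<comment> \<open>The trapped case can occur for every j; the same facts serve all three ranges,
      and only the finiteness of j makes a difference.\<close>
    have "J_ends_at (u \<alpha>) c" if "no_interior_zero f b" "j \<noteq> \<infinity>" using W(2) that jinf by blast
    moreover have "(0::enat) \<noteq> \<infinity>" "(1::enat) \<noteq> \<infinity>" by simp_all
    ultimately show ?thesis using W(1,3) P jinf Jcal_tendsto_0 by (metis Suc_eq_plus1)
  qed
  show ?thesis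
    unfolding z_def[symmetric]
    using part1 curve0 curve_cont moves_counterclockwise_v winds_inwards_v[OF a0] no_self_intersection_v
      finite_zero_crossings rot0 crit S(2,3) rotb ends by (simp only: Suc_eq_plus1 simp_thms)
qed

end
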